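(* Under Assumption A (see context), there exists a sequence of threshold levels $\mu=\mu(n)>0$, which can be chosen as a function of $k_{\min}(n)$, $k_{\max}(n)$, $n$, $m$ and $\delta$ only, such that the OMP estimate $\hat I_{\rm OMP}$ produced by Algorithm OMP with threshold $\mu(n)$ satisfies $$\lim_{n\to\infty}\Pr\big(\hat I_{\rm OMP}\neq I_{\rm true}\big)=0 .$$
   Context: Setting: for each $n$, $\mathbf{x}\in\mathbb{R}^n$ is a deterministic vector with support $I_{\rm true}=\{j: x_j\neq 0\}$ and sparsity level $k=k(n)=|I_{\rm true}|$. The number of measurements $m=m(n)$ is deterministic. $\mathbf{A}\in\mathbb{R}^{m\times n}$ and $\mathbf{w}\in\mathbb{R}^m$ are independent, each with i.i.d. $\mathcal N(0,1/m)$ entries, and $\mathbf{y}=\mathbf{A}\mathbf{x}+\mathbf{w}$. The $j$-th column of $\mathbf A$ is $\mathbf a_j$. Let $x_{\min}=\min_{j\in I_{\rm true}}|x_j|$. Assumption A: (a) $k_{\min}(n)\le k(n)\le k_{\max}(n)$ for deterministic sequences with $k_{\min}(n)\to\infty$ and $k_{\max}(n)<n/2$ for all $n$; (b) $m\ge(1+\delta)\,2k_{\max}\log(n-k_{\min})$ for some fixed $\delta>0$; (c) $k\,x_{\min}^2\to\infty$ as $n\to\infty$; (d) for every $\epsilon>0$, $(n-k)^{-\epsilon}\log(1+\|\mathbf x\|^2)\to 0$ as $n\to\infty$; (e) $\mathbf A,\mathbf w,\mathbf y$ are as in the setting. Algorithm OMP (input $\mathbf y$, $\mathbf A$, threshold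 $\mu>0$): set $t=0$, $\hat I(0)=\emptyset$. Repeat: let $\mathbf P(t)$ be the orthogonal projection onto the orthogonal complement of $\mathrm{span}\{\mathbf a_i: i\in\hat I(t)\}$; for each $j=1,\dots,n$ compute $\rho(t,j)=|\mathbf a_j^{T}\mathbf P(t)\mathbf y|^2/\|\mathbf P(t)\mathbf y\|^2$; let $\rho^*(t)=\max_j\rho(t,j)$ and $i^*(t)$ an index attaining the maximum. If $\rho^*(t)>\mu$, set $\hat I(t+1)=\hat I(t)\cup\{i^*(t)\}$, increase $t$ by one and repeat; otherwise stop and output $\hat I_{\rm OMP}=\hat I(t)$. *)

theory Defs
  imports "HOL-Probability.Probability"
begin

text \<open>Conventions. Vectors of R^m are functions nat => real, only coordinates r < m matter.
 The m x n matrix A is a function on pairs (row r, column j), r < m, j < n.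
 The j-th column a_j is (\<lambda>r. A (r, j)).\<close>

text \<open>Orthogonal projection of y onto the orthogonal complement (in R^m) of
 span of the columns a_i, i in S: the unique z (zero outside coordinates < m) with
 y - z in the span and z orthogonal to every a_i, i in S.\<close>
definition proj_perp :: "nat \<Rightarrow> (nat \<times> nat \<Rightarrow> real) \<Rightarrow> nat set \<Rightarrow> (nat \<Rightarrow> real) \<Rightarrow> (nat \<Rightarrow> real)" where
  "proj_perp m A S y = (THE z. (\<forall>r. m \<le> r \<longrightarrow> z r = 0)
       \<and> (\<exists>c. \<forall>r<m. y r - z r = (\<Sum>i\<in>S. c i * A (r, i)))
       \<and> (\<forall>i\<in>S. (\<Sum>r<m. A (r, i) * z r) = 0))"

definition omp_rho :: "nat \<Rightarrow> (nat \<times> nat \<Rightarrow> real) \<Rightarrow> (nat \<Rightarrow> real) \<Rightarrow> nat set \<Rightarrow> nat \<Rightarrow> real" where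
  "omp_rho m A y S j =
     (let p = proj_perp m A S y in (\<Sum>r<m. A (r, j) * p r)\<^sup>2 / (\<Sum>r<m. (p r)\<^sup>2))"

definition omp_rho_star :: "nat \<Rightarrow> nat \<Rightarrow> (nat \<times> nat \<Rightarrow> real) \<Rightarrow> (nat \<Rightarrow> real) \<Rightarrow> nat set \<Rightarrow> real" where
  "omp_rho_star m n A y S = Max (omp_rho m A y S ` {..<n})"

text \<open>The maximizing index i*(t); ties (a probability-zero event) are broken by the least index.\<close>
definition omp_istar :: "nat \<Rightarrow> nat \<Rightarrow> (nat \<times> nat \<Rightarrow> real) \<Rightarrow> (nat \<Rightarrow> real) \<Rightarrow> nat set \<Rightarrow> nat" where
  "omp_istar m n A y S = (LEAST j. j < n \<and> omp_rho m A y S j = omp_rho_star m n A y S)"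

text \<open>hat I(t), the index set after t selection steps (meaningful while the algorithm has not stopped).\<close>
fun omp_set :: "nat \<Rightarrow> nat \<Rightarrow> (nat \<times> nat \<Rightarrow> real) \<Rightarrow> (nat \<Rightarrow> real) \<Rightarrow> nat \<Rightarrow> nat set" where
  "omp_set m n A y 0 = {}"
| "omp_set m n A y (Suc t) = insert (omp_istar m n A y (omp_set m n A y t)) (omp_set m n A y t)"

definition omp_output :: "nat \<Rightarrow> nat \<Rightarrow> (nat \<times> nat \<Rightarrow> real) \<Rightarrow> (nat \<Rightarrow> real) \<Rightarrow> real \<Rightarrow> nat set" where
  "omp_output m n A y \<mu> =
     omp_set m n A y (LEAST t. \<not> (omp_rho_star m n A y (omp_set m n A y t) > \<mu>))"

definition gauss_var_inv :: "nat \<Rightarrow> real measure" where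
  "gauss_var_inv m = density lborel (normal_density 0 (1 / sqrt (real m)))"

definition omp_space :: "nat \<Rightarrow> nat \<Rightarrow> ((nat \<times> nat \<Rightarrow> real) \<times> (nat \<Rightarrow> real)) measure" where
  "omp_space m n = (PiM ({..<m} \<times> {..<n}) (\<lambda>_. gauss_var_inv m)) \<Otimes>\<^sub>M (PiM {..<m} (\<lambda>_. gauss_var_inv m))"

definition meas :: "nat \<Rightarrow> nat \<Rightarrow> (nat \<times> nat \<Rightarrow> real) \<Rightarrow> (nat \<Rightarrow> real) \<Rightarrow> (nat \<Rightarrow> real) \<Rightarrow> (nat \<Rightarrow> real)" where
  "meas m n A x w = (\<lambda>r. (\<Sum>j<n. A (r, j) * x j) + w r)"

definition support :: "nat \<Rightarrow> (nat \<Rightarrow> real) \<Rightarrow> nat set" where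
  "support n x = {j. j < n \<and> x j \<noteq> 0}"

definition xmin :: "nat \<Rightarrow> (nat \<Rightarrow> real) \<Rightarrow> real" where
  "xmin n x = Min ((\<lambda>j. \<bar>x j\<bar>) ` support n x)"

definition sqnorm :: "nat \<Rightarrow> (nat \<Rightarrow> real) \<Rightarrow> real" where
  "sqnorm n x = (\<Sum>j<n. (x j)\<^sup>2)"

end

theory Submission
  imports Defs
begin

text \<open>Write \<open>T\<close> for the support and compare the algorithm with a genie run that sees only the
  columns in \<open>T\<close>. Its residuals \<open>z t\<close> are independent of every column \<open>a\<close> outside \<open>T\<close>, and they are
  nested projections of the measurement, so that \<open>\<parallel>z s - z t\<parallel>\<^sup>2 = \<parallel>z s\<parallel>\<^sup>2 - \<parallel>z t\<parallel>\<^sup>2\<close> for \<open>s \<le> t\<close>. A union bound over all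
  \<open>t\<close> would be too expensive at the scale \<open>\<surd>(2 log n / m)\<close>. Instead, group the times \<open>t\<close> such that within a group
  \<open>\<parallel>z t\<parallel>\<^sup>2\<close> varies by a factor \<open>1 + \<beta>\<close>: only the last residual of each group needs the sharp bound, and the number
  of groups is of order \<open>log (1 + \<parallel>x\<parallel>\<^sup>2)\<close>; the other residuals of a group differ from it by a vector so short that a
  union bound over all \<open>t\<close> is affordable. This replaces the maximal inequality for Brownian motion.

  For progress inside \<open>T\<close>, fix the set \<open>I\<close> selected so far, put \<open>J = T - I\<close>, and let \<open>b\<close> be the part of
  \<open>A\<^sub>J x\<^sub>J\<close> orthogonal to the selected columns. By the Cauchy--Schwarz inequality some column in \<open>J\<close> has a
  correlation above the threshold as soon as \<open>\<parallel>b\<parallel>\<^sup>2 \<ge> (1 - 2\<eta>) \<parallel>x\<^sub>J\<parallel>\<^sup>2\<close> and \<open>\<bar>\<langle>b, w\<rangle>\<bar> \<le> \<eta> \<parallel>b\<parallel>\<^sup>2\<close>. Because \<open>x\<close> is a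
  fixed vector, these are only \<open>2\<^sup>k\<close> scalar events, whose failure probabilities are exponentially small in \<open>m\<close> and in
  \<open>m \<parallel>x\<^sub>J\<parallel>\<^sup>2\<close>, respectively; no bound on singular values is needed.\<close>

section \<open>Orthogonal projections onto complements of column spans\<close>

definition dot :: "nat \<Rightarrow> (nat \<Rightarrow> real) \<Rightarrow> (nat \<Rightarrow> real) \<Rightarrow> real" where
  "dot m u v = (\<Sum>r<m. u r * v r)"

text \<open>Only the coordinates below \<open>m\<close> are constrained, so functions with arbitrary
  values beyond \<open>m\<close> can be members.\<close>

definition col_span :: "nat \<Rightarrow> (nat \<times> nat \<Rightarrow> real) \<Rightarrow> nat set \<Rightarrow> (nat \<Rightarrow> real) set" where
  "col_span m A S = {v. \<exists>c. \<forall>r<m. v r = (\<Sum>i\<in>S. c i * A (r, i))}"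

text \<open>The predicate described by \<open>proj_perp\<close>, separated out so that existence and
  uniqueness can be proved for it. Vanishing beyond \<open>m\<close> is what makes the described
  function unique.\<close>

definition is_proj_perp ::
  "nat \<Rightarrow> (nat \<times> nat \<Rightarrow> real) \<Rightarrow> nat set \<Rightarrow> (nat \<Rightarrow> real) \<Rightarrow> (nat \<Rightarrow> real) \<Rightarrow> bool" where
  "is_proj_perp m A S y z \<longleftrightarrow> (\<forall>r. m \<le> r \<longrightarrow> z r = 0) \<and> (\<lambda>r. y r - z r) \<in> col_span m A S
     \<and> (\<forall>i\<in>S. dot m (\<lambda>r. A (r, i)) z = 0)"

lemma dot_commute: "dot m u v = dot m v u"
  by (simp add: dot_def mult.commute)

lemma dot_add_left: "dot m (\<lambda>r. u r + v r) w = dot m u w + dot m v w"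
  by (simp add: dot_def sum.distrib algebra_simps)

lemma dot_add_right: "dot m w (\<lambda>r. u r + v r) = dot m w u + dot m w v"
  by (simp add: dot_def sum.distrib algebra_simps)

lemma dot_diff_left: "dot m (\<lambda>r. u r - v r) w = dot m u w - dot m v w"
  by (simp add: dot_def sum_subtractf algebra_simps)

lemma dot_diff_right: "dot m w (\<lambda>r. u r - v r) = dot m w u - dot m w v"
  by (simp add: dot_def sum_subtractf algebra_simps)

lemma dot_scale_left: "dot m (\<lambda>r. c * u r) w = c * dot m u w"
  by (simp add: dot_def sum_distrib_left algebra_simps)

lemma dot_scale_right: "dot m w (\<lambda>r. c * u r) = c * dot m w u"
  by (simp add: dot_def sum_distrib_left algebra_simps)

lemma dot_sum_left: "dot m (\<lambda>r. \<Sum>i\<in>I. f i r) w = (\<Sum>i\<in>I. dot m (f i) w)"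
  unfolding dot_def by (simp add: sum_distrib_right) (rule sum.swap)

lemma dot_self_nonneg: "0 \<le> dot m u u"
  by (simp add: dot_def sum_nonneg)

lemma dot_self_eq_0_iff: "dot m u u = 0 \<longleftrightarrow> (\<forall>r<m. u r = 0)"
  unfolding dot_def by (subst sum_nonneg_eq_0_iff) auto

lemma dot_cong: "(\<And>r. r < m \<Longrightarrow> u r = u' r) \<Longrightarrow> (\<And>r. r < m \<Longrightarrow> v r = v' r) \<Longrightarrow> dot m u v = dot m u' v'"
  unfolding dot_def by (intro sum.cong) auto

lemma dot_self_add: "dot m (\<lambda>r. u r + v r) (\<lambda>r. u r + v r) = dot m u u + 2 * dot m u v + dot m v v"
  by (simp add: dot_add_left dot_add_right dot_commute[of m v u])

lemma dot_self_diff: "dot m (\<lambda>r. u r - v r) (\<lambda>r. u r - v r) = dot m u u - 2 * dot m u v + dot m v v"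
  by (simp add: dot_diff_left dot_diff_right dot_commute[of m v u])

section \<open>Column spans and orthogonality to them\<close>

lemma col_span_add:
  assumes "u \<in> col_span m A S" "v \<in> col_span m A S"
  shows "(\<lambda>r. u r + v r) \<in> col_span m A S"
proof -
  from assms obtain c d where "\<forall>r<m. u r = (\<Sum>i\<in>S. c i * A (r, i))" "\<forall>r<m. v r = (\<Sum>i\<in>S. d i * A (r, i))"
    unfolding col_span_def by auto
  then show ?thesis unfolding col_span_def
    by (intro CollectI exI[of _ "\<lambda>i. c i + d i"]) (auto simp: sum.distrib algebra_simps)
qed

lemma col_span_scale:
  assumes "u \<in> col_span m A S"
  shows "(\<lambda>r. a * u r) \<in> col_span m A S"
proof -
  from assms obtain c where "\<forall>r<m. u r = (\<Sum>i\<in>S. c i * A (r, i))"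
    unfolding col_span_def by auto
  then show ?thesis unfolding col_span_def
    by (intro CollectI exI[of _ "\<lambda>i. a * c i"]) (auto simp: sum_distrib_left algebra_simps)
qed

lemma col_span_diff:
  assumes "u \<in> col_span m A S" "v \<in> col_span m A S"
  shows "(\<lambda>r. u r - v r) \<in> col_span m A S"
  using col_span_add[OF assms(1) col_span_scale[OF assms(2), of "-1"]] by simp

lemma col_span_mono:
  assumes "u \<in> col_span m A S" "S \<subseteq> T" "finite T"
  shows "u \<in> col_span m A T"
proof -
  from assms obtain c where c: "\<forall>r<m. u r = (\<Sum>i\<in>S. c i * A (r, i))"
    unfolding col_span_def by auto
  have "(\<Sum>i\<in>T. (if i \<in> S then c i else 0) * A (r, i)) = (\<Sum>i\<in>S. c i * A (r, i))" for r
    by (rule sum.mono_neutral_cong_right) (use assms in auto)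
  then show ?thesis using c unfolding col_span_def
    by (intro CollectI exI[of _ "\<lambda>i. if i \<in> S then c i else 0"]) auto
qed

lemma col_span_column: "finite S \<Longrightarrow> i \<in> S \<Longrightarrow> (\<lambda>r. A (r, i)) \<in> col_span m A S"
  unfolding col_span_def
  by (intro CollectI exI[of _ "\<lambda>l. if l = i then 1 else 0"])
     (auto simp: sum.delta if_distrib[of "\<lambda>c. c * _"] cong: if_cong)

lemma dot_col_span_eq_0:
  assumes "u \<in> col_span m A S" "\<forall>i\<in>S. dot m (\<lambda>r. A (r, i)) z = 0"
  shows "dot m u z = 0"
proof -
  from assms obtain c where c: "\<forall>r<m. u r = (\<Sum>i\<in>S. c i * A (r, i))"
    unfolding col_span_def by auto
  have "dot m u z = dot m (\<lambda>r. \<Sum>i\<in>S. c i * A (r, i)) z"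
    using c by (intro dot_cong) auto
  also have "\<dots> = (\<Sum>i\<in>S. dot m (\<lambda>r. c i * A (r, i)) z)"
    by (rule dot_sum_left)
  also have "\<dots> = 0" using assms(2) by (simp add: dot_scale_left)
  finally show ?thesis .
qed

text \<open>The difference of two candidates lies in the span and is orthogonal to it, hence to
  itself; beyond \<open>m\<close> both candidates vanish.\<close>

lemma is_proj_perp_unique:
  assumes "is_proj_perp m A S y z" "is_proj_perp m A S y z'"
  shows "z = z'"
proof -
  let ?d = "\<lambda>r. z r - z' r"
  have "(\<lambda>r. (y r - z' r) - (y r - z r)) \<in> col_span m A S"
    by (rule col_span_diff) (use assms in \<open>auto simp: is_proj_perp_def\<close>)
  then have "?d \<in> col_span m A S" by simp
  then have "dot m ?d ?d = 0"
    by (rule dot_col_span_eq_0) (use assms in \<open>auto simp: is_proj_perp_def dot_diff_right\<close>)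
  then have "\<forall>r<m. z r = z' r" by (simp add: dot_self_eq_0_iff)
  moreover have "\<forall>r\<ge>m. z r = z' r" using assms by (auto simp: is_proj_perp_def)
  ultimately show ?thesis by (metis ext not_le)
qed

lemma proj_perp_eqI: "is_proj_perp m A S y z \<Longrightarrow> proj_perp m A S y = z"
  unfolding proj_perp_def
  by (rule the_equality)
     (use is_proj_perp_unique in \<open>auto simp: is_proj_perp_def col_span_def dot_def\<close>)

lemma is_proj_perp_empty: "is_proj_perp m A {} y (\<lambda>r. if r < m then y r else 0)"
  by (auto simp: is_proj_perp_def col_span_def)

text \<open>\<open>v - z'\<close> lies in the span, to which \<open>z\<close> is orthogonal. This
  combines self-adjointness and idempotence of the projection.\<close>

lemma dot_is_proj_perp:
  assumes "is_proj_perp m A S u z" "is_proj_perp m A S v z'"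
  shows "dot m z v = dot m z z'"
proof -
  have "dot m (\<lambda>r. v r - z' r) z = 0"
    by (rule dot_col_span_eq_0) (use assms in \<open>auto simp: is_proj_perp_def\<close>)
  then show ?thesis by (simp add: dot_diff_left dot_commute)
qed

text \<open>One Gram--Schmidt step: \<open>p\<close> is the part of the new column orthogonal to the
  old ones, and enlarging the set subtracts from \<open>z\<close> its component along
  \<open>p\<close>.\<close>

lemma is_proj_perp_insert:
  assumes fin: "finite S" and p: "is_proj_perp m A S (\<lambda>r. A (r, i)) p" and z: "is_proj_perp m A S y z"
  shows "is_proj_perp m A (insert i S) y (\<lambda>r. z r - dot m p z / dot m p p * p r)"
proof -
  define \<alpha> where "\<alpha> = dot m p z / dot m p p"
  have mono: "u \<in> col_span m A S \<Longrightarrow> u \<in> col_span m A (insert i S)" for u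
    using fin by (auto intro: col_span_mono)
  have "(\<lambda>r. A (r, i) - (A (r, i) - p r)) \<in> col_span m A (insert i S)"
    using p fin by (intro col_span_diff[OF col_span_column mono]) (auto simp: is_proj_perp_def)
  then have "p \<in> col_span m A (insert i S)" by simp
  then have "(\<lambda>r. (y r - z r) + \<alpha> * p r) \<in> col_span m A (insert i S)"
    using z by (intro col_span_add[OF mono col_span_scale]) (auto simp: is_proj_perp_def)
  then have 1: "(\<lambda>r. y r - (z r - \<alpha> * p r)) \<in> col_span m A (insert i S)"
    by (simp add: algebra_simps)
  have "dot m (\<lambda>r. A (r, i)) z = dot m p z"
    using dot_is_proj_perp[OF z p] by (simp add: dot_commute)
  moreover have "dot m (\<lambda>r. A (r, i)) p = dot m p p"
    using dot_is_proj_perp[OF p p] by (simp add: dot_commute)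
  \<comment> \<open>If the new column already lies in the old span, then \<open>p\<close> vanishes
    and both sides are 0.\<close>
  moreover have "dot m p z = \<alpha> * dot m p p"
  proof (cases "dot m p p = 0")
    case True
    then have "dot m p z = dot m (\<lambda>r. 0) z"
      by (intro dot_cong) (auto simp: dot_self_eq_0_iff)
    then show ?thesis using True by (simp add: dot_def)
  qed (simp add: \<alpha>_def)
  ultimately have "dot m (\<lambda>r. A (r, i)) (\<lambda>r. z r - \<alpha> * p r) = 0"
    by (simp add: dot_diff_right dot_scale_right)
  with 1 show ?thesis using p z unfolding \<alpha>_def[symmetric]
    by (auto simp: is_proj_perp_def dot_diff_right dot_scale_right)
qed

lemma is_proj_perp_proj_perp:
  assumes "finite S"
  shows "is_proj_perp m A S y (proj_perp m A S y)"
proof -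
  have "\<exists>z. is_proj_perp m A S y z" using assms
  proof (induction S arbitrary: y rule: finite_induct)
    case empty
    show ?case using is_proj_perp_empty by blast
  next
    case (insert i S)
    then show ?case using is_proj_perp_insert by meson
  qed
  then show ?thesis using proj_perp_eqI by metis
qed

lemma proj_perp_empty: "proj_perp m A {} y = (\<lambda>r. if r < m then y r else 0)"
  by (rule proj_perp_eqI) (rule is_proj_perp_empty)

text \<open>A recursion by arithmetic operations alone; Bessel's identity and the measurability of
  projections follow from it by induction on \<open>S\<close>.\<close>

lemma proj_perp_insert:
  fixes A :: "nat \<times> nat \<Rightarrow> real" and m i :: nat
  assumes "finite S"
  defines "p \<equiv> proj_perp m A S (\<lambda>r. A (r, i))"
  shows "proj_perp m A (insert i S) y =
    (\<lambda>r. proj_perp m A S y r - dot m p (proj_perp m A S y) / dot m p p * p r)"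
  unfolding p_def
  by (intro proj_perp_eqI is_proj_perp_insert is_proj_perp_proj_perp assms)

section \<open>Calculation rules for projected vectors\<close>

lemma proj_perp_span: "finite S \<Longrightarrow> (\<lambda>r. y r - proj_perp m A S y r) \<in> col_span m A S"
  using is_proj_perp_proj_perp[of S m A y] by (simp add: is_proj_perp_def)

lemma proj_perp_orthogonal: "finite S \<Longrightarrow> i \<in> S \<Longrightarrow> dot m (\<lambda>r. A (r, i)) (proj_perp m A S y) = 0"
  using is_proj_perp_proj_perp[of S m A y] by (simp add: is_proj_perp_def)

lemma dot_proj_perp: "finite S \<Longrightarrow> dot m (proj_perp m A S u) v = dot m (proj_perp m A S u) (proj_perp m A S v)"
  using dot_is_proj_perp is_proj_perp_proj_perp by blast

lemma proj_perp_add_span: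
  assumes fin: "finite S" and u: "u \<in> col_span m A S"
  shows "proj_perp m A S (\<lambda>r. u r + v r) = proj_perp m A S v"
proof (rule proj_perp_eqI)
  have "(\<lambda>r. u r + (v r - proj_perp m A S v r)) \<in> col_span m A S"
    by (rule col_span_add[OF u proj_perp_span[OF fin]])
  then show "is_proj_perp m A S (\<lambda>r. u r + v r) (proj_perp m A S v)"
    using is_proj_perp_proj_perp[OF fin, of m A v] by (simp add: is_proj_perp_def algebra_simps)
qed

lemma proj_perp_add:
  assumes fin: "finite S"
  shows "proj_perp m A S (\<lambda>r. u r + v r) = (\<lambda>r. proj_perp m A S u r + proj_perp m A S v r)"
proof (rule proj_perp_eqI)
  have "(\<lambda>r. (u r - proj_perp m A S u r) + (v r - proj_perp m A S v r)) \<in> col_span m A S"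
    by (rule col_span_add[OF proj_perp_span[OF fin] proj_perp_span[OF fin]])
  then show "is_proj_perp m A S (\<lambda>r. u r + v r) (\<lambda>r. proj_perp m A S u r + proj_perp m A S v r)"
    using is_proj_perp_proj_perp[OF fin, of m A v] is_proj_perp_proj_perp[OF fin, of m A u]
    by (auto simp add: is_proj_perp_def algebra_simps dot_add_right)
qed

lemma proj_perp_scale:
  assumes fin: "finite S"
  shows "proj_perp m A S (\<lambda>r. a * v r) = (\<lambda>r. a * proj_perp m A S v r)"
proof (rule proj_perp_eqI)
  have "(\<lambda>r. a * (v r - proj_perp m A S v r)) \<in> col_span m A S"
    by (rule col_span_scale[OF proj_perp_span[OF fin]])
  then show "is_proj_perp m A S (\<lambda>r. a * v r) (\<lambda>r. a * proj_perp m A S v r)"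
    using is_proj_perp_proj_perp[OF fin, of m A v]
    by (auto simp add: is_proj_perp_def algebra_simps dot_scale_right)
qed

text \<open>Entries outside the columns in \<open>S\<close> may be changed freely; conditioning on
  some columns and masking others both rest on this.\<close>

lemma proj_perp_cong:
  assumes "\<And>r i. r < m \<Longrightarrow> i \<in> S \<Longrightarrow> A (r, i) = B (r, i)" "\<And>r. r < m \<Longrightarrow> u r = v r"
  shows "proj_perp m A S u = proj_perp m B S v"
proof -
  have "((\<exists>c. \<forall>r<m. u r - z r = (\<Sum>i\<in>S. c i * A (r, i))) \<longleftrightarrow>
        (\<exists>c. \<forall>r<m. v r - z r = (\<Sum>i\<in>S. c i * B (r, i))))" for z
    using assms by (intro arg_cong[of _ _ Ex] ext) (auto intro!: sum.cong)
  moreover have "(\<forall>i\<in>S. (\<Sum>r<m. A (r, i) * z r) = 0) \<longleftrightarrow> (\<forall>i\<in>S. (\<Sum>r<m. B (r, i) * z r) = 0)" for z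
    using assms by (intro ball_cong refl) (auto intro!: arg_cong2[of _ _ _ _ "(=)"] sum.cong)
  ultimately show ?thesis unfolding proj_perp_def by simp
qed

lemma dot_proj_perp_pythagoras:
  assumes "finite S" "u \<in> col_span m A S"
  shows "dot m (\<lambda>r. proj_perp m A S y r + u r) (\<lambda>r. proj_perp m A S y r + u r)
    = dot m (proj_perp m A S y) (proj_perp m A S y) + dot m u u"
proof -
  have "dot m u (proj_perp m A S y) = 0"
    by (rule dot_col_span_eq_0[OF assms(2)]) (use assms(1) proj_perp_orthogonal in auto)
  then show ?thesis by (simp add: dot_self_add dot_commute)
qed

text \<open>The projection is the shortest vector differing from \<open>y\<close> by an element of
  the span: \<open>v\<close> is the projection plus such an element, and Pythagoras applies.\<close>

lemma dot_proj_perp_le: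
  assumes "finite S" "(\<lambda>r. y r - v r) \<in> col_span m A S"
  shows "dot m (proj_perp m A S y) (proj_perp m A S y) \<le> dot m v v"
proof -
  let ?u = "\<lambda>r. (y r - proj_perp m A S y r) - (y r - v r)"
  have "?u \<in> col_span m A S" by (rule col_span_diff[OF proj_perp_span[OF assms(1)] assms(2)])
  from dot_proj_perp_pythagoras[OF assms(1) this, of y] dot_self_nonneg[of m ?u]
  show ?thesis by (simp add: algebra_simps)
qed

lemma dot_proj_perp_le_self:
  "finite S \<Longrightarrow> dot m (proj_perp m A S y) (proj_perp m A S y) \<le> dot m y y"
  by (rule dot_proj_perp_le) (auto simp: col_span_def intro: exI[of _ "\<lambda>_. 0"])

text \<open>The two residuals differ by an element of the span for \<open>T\<close>, to which the
  residual for \<open>T\<close> is orthogonal.\<close>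

lemma dot_proj_perp_nested:
  assumes "finite T" "S \<subseteq> T"
  shows "dot m (proj_perp m A S y) (proj_perp m A T y) = dot m (proj_perp m A T y) (proj_perp m A T y)"
proof -
  have fS: "finite S" using assms finite_subset by blast
  have "(\<lambda>r. (y r - proj_perp m A S y r) - (y r - proj_perp m A T y r)) \<in> col_span m A T"
    by (rule col_span_diff[OF col_span_mono[OF proj_perp_span[OF fS] assms(2,1)] proj_perp_span[OF assms(1)]])
  then have "dot m (\<lambda>r. (y r - proj_perp m A S y r) - (y r - proj_perp m A T y r)) (proj_perp m A T y) = 0"
    by (rule dot_col_span_eq_0) (use assms(1) proj_perp_orthogonal in auto)
  then show ?thesis by (simp add: dot_diff_left)
qed

text \<open>The \<open>q i\<close> are Gram--Schmidt vectors, equal to 0 where a column depends on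
  the earlier ones; hence the second clause is an inequality. The first clause carries the
  induction: it makes the older vectors orthogonal to the new one.\<close>

lemma proj_perp_bessel_system:
  assumes "finite S"
  shows "\<exists>q. (\<forall>i. q i \<in> col_span m A S)
    \<and> (\<forall>h. dot m (\<lambda>r. \<Sum>i\<in>S. h i * q i r) (\<lambda>r. \<Sum>i\<in>S. h i * q i r) \<le> (\<Sum>i\<in>S. (h i)\<^sup>2))
    \<and> (\<forall>y. dot m y y - dot m (proj_perp m A S y) (proj_perp m A S y) = (\<Sum>i\<in>S. (dot m (q i) y)\<^sup>2))"
  using assms
proof (induction S rule: finite_induct)
  case empty
  have "dot m (proj_perp m A {} y) (proj_perp m A {} y) = dot m y y" for y
    by (rule dot_cong) (auto simp: proj_perp_empty)
  then show ?case by (intro exI[of _ "\<lambda>i r. 0"]) (auto simp: dot_def col_span_def)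
next
  case (insert l S)
  then obtain q where q1: "\<And>i. q i \<in> col_span m A S"
    and q2: "\<And>h. dot m (\<lambda>r. \<Sum>i\<in>S. h i * q i r) (\<lambda>r. \<Sum>i\<in>S. h i * q i r) \<le> (\<Sum>i\<in>S. (h i)\<^sup>2)"
    and q3: "\<And>y. dot m y y - dot m (proj_perp m A S y) (proj_perp m A S y) = (\<Sum>i\<in>S. (dot m (q i) y)\<^sup>2)"
    by blast
  define p where "p = proj_perp m A S (\<lambda>r. A (r, l))"
  \<comment> \<open>For \<open>p = 0\<close> division by zero makes \<open>e = 0\<close>, so only
    \<open>\<le> 1\<close> is claimed for its squared norm.\<close>
  define e where "e = (\<lambda>r. (1 / sqrt (dot m p p)) * p r)"
  define q' where "q' = q(l := e)"
  have e: "dot m e v = dot m p v / sqrt (dot m p p)" for v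
    by (simp only: e_def dot_scale_left) simp
  have ee: "dot m e e \<le> 1"
  proof -
    have "dot m e e = dot m p p / (sqrt (dot m p p) * sqrt (dot m p p))"
      by (simp only: e dot_commute[of m p e]) simp
    also have "\<dots> \<le> 1" using dot_self_nonneg[of m p] by simp
    finally show ?thesis .
  qed
  have span: "q' i \<in> col_span m A (insert l S)" for i
  proof (cases "i = l")
    case True
    have "(\<lambda>r. A (r, l) - (A (r, l) - p r)) \<in> col_span m A (insert l S)"
      unfolding p_def using insert.hyps
      by (intro col_span_diff[OF col_span_column col_span_mono[OF proj_perp_span]]) auto
    then have "p \<in> col_span m A (insert l S)" by simp
    then have "e \<in> col_span m A (insert l S)" unfolding e_def by (rule col_span_scale)
    then show ?thesis using True by (simp add: q'_def)
  next
    case False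
    then show ?thesis using q1 insert.hyps by (auto simp: q'_def intro: col_span_mono)
  qed
  have eq0: "dot m (q i) e = 0" for i
  proof -
    have "dot m (q i) p = 0"
      by (rule dot_col_span_eq_0[OF q1]) (use insert.hyps proj_perp_orthogonal in \<open>auto simp: p_def\<close>)
    then show ?thesis by (simp add: dot_commute[of m "q i" e] e dot_commute[of m p "q i"])
  qed
  have norm: "dot m (\<lambda>r. \<Sum>i\<in>insert l S. h i * q' i r) (\<lambda>r. \<Sum>i\<in>insert l S. h i * q' i r)
       \<le> (\<Sum>i\<in>insert l S. (h i)\<^sup>2)" for h
  proof -
    let ?s = "\<lambda>r. \<Sum>i\<in>S. h i * q i r"
    have "(\<lambda>r. \<Sum>i\<in>insert l S. h i * q' i r) = (\<lambda>r. h l * e r + ?s r)"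
      using insert.hyps by (auto simp: q'_def intro!: sum.cong ext)
    moreover have "dot m ?s e = 0"
      by (simp add: dot_sum_left dot_scale_left eq0)
    ultimately have "dot m (\<lambda>r. \<Sum>i\<in>insert l S. h i * q' i r) (\<lambda>r. \<Sum>i\<in>insert l S. h i * q' i r)
      = (h l)\<^sup>2 * dot m e e + dot m ?s ?s"
      by (simp add: dot_self_add dot_scale_left dot_scale_right dot_commute[of m e ?s] power2_eq_square)
    also have "\<dots> \<le> (h l)\<^sup>2 * 1 + (\<Sum>i\<in>S. (h i)\<^sup>2)"
      using ee q2 by (intro add_mono mult_left_mono) auto
    finally show ?thesis using insert.hyps by simp
  qed
  have bessel: "dot m y y - dot m (proj_perp m A (insert l S) y) (proj_perp m A (insert l S) y)
      = (\<Sum>i\<in>insert l S. (dot m (q' i) y)\<^sup>2)" for y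
  proof -
    let ?z = "proj_perp m A S y"
    have pz: "dot m p y = dot m p ?z" using dot_proj_perp[OF insert.hyps(1)] by (simp add: p_def)
    have "(dot m p ?z / dot m p p)\<^sup>2 * dot m p p = (dot m p ?z)\<^sup>2 / dot m p p"
      by (simp add: power2_eq_square)
    \<comment> \<open>The new direction lowers the squared residual norm by exactly its own Bessel
      term.\<close>
    then have "dot m (proj_perp m A (insert l S) y) (proj_perp m A (insert l S) y)
      = dot m ?z ?z - (dot m p ?z)\<^sup>2 / dot m p p"
      unfolding proj_perp_insert[OF insert.hyps(1)] p_def[symmetric]
      by (simp only: dot_self_diff dot_scale_left dot_scale_right dot_commute[of m ?z p])
         (simp add: power2_eq_square)
    moreover have "(dot m e y)\<^sup>2 = (dot m p ?z)\<^sup>2 / dot m p p"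
      using dot_self_nonneg[of m p] by (simp add: e pz power_divide)
    moreover have "(\<Sum>i\<in>insert l S. (dot m (q' i) y)\<^sup>2) = (dot m e y)\<^sup>2 + (\<Sum>i\<in>S. (dot m (q i) y)\<^sup>2)"
      using insert.hyps by (auto simp: q'_def intro!: sum.cong)
    ultimately show ?thesis using q3[of y] by simp
  qed
  show ?case using span norm bessel by blast
qed

text \<open>Induction through the recursion for inserting a column; \<open>y\<close> is generalized
  because the recursion also projects the new column.\<close>

lemma proj_perp_measurable:
  assumes "finite S" "\<And>r i. r < m \<Longrightarrow> i \<in> S \<Longrightarrow> (\<lambda>\<omega>. A \<omega> (r, i)) \<in> borel_measurable M"
    and "\<And>r. r < m \<Longrightarrow> (\<lambda>\<omega>. y \<omega> r) \<in> borel_measurable M"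
  shows "(\<lambda>\<omega>. proj_perp m (A \<omega>) S (y \<omega>) r) \<in> borel_measurable M"
  using assms
proof (induction S arbitrary: y r rule: finite_induct)
  case empty
  then show ?case by (cases "r < m") (auto simp: proj_perp_empty)
next
  case (insert l S)
  have [measurable]: "(\<lambda>\<omega>. proj_perp m (A \<omega>) S (y \<omega>) r) \<in> borel_measurable M" for r
    by (rule insert.IH) (use insert.prems in auto)
  have [measurable]: "(\<lambda>\<omega>. proj_perp m (A \<omega>) S (\<lambda>r. A \<omega> (r, l)) r) \<in> borel_measurable M" for r
    by (rule insert.IH) (use insert.prems in auto)
  show ?case unfolding proj_perp_insert[OF insert.hyps(1)] dot_def by measurable
qed

section \<open>Tail bounds for Gaussian vectors\<close>

abbreviation gvec :: "nat \<Rightarrow> (nat \<Rightarrow> real) measure" where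
  "gvec m \<equiv> PiM {..<m} (\<lambda>_. gauss_var_inv m)"

lemma sets_gauss [measurable_cong, simp]: "sets (gauss_var_inv m) = sets borel"
  by (simp add: gauss_var_inv_def)

lemma space_gauss [simp]: "space (gauss_var_inv m) = UNIV"
  by (simp add: gauss_var_inv_def)

lemma prob_space_gauss: "m > 0 \<Longrightarrow> prob_space (gauss_var_inv m)"
  unfolding gauss_var_inv_def by (rule prob_space_normal_density) simp

section \<open>Exponential moments of Gaussian variables and vectors\<close>

lemma nn_integral_normal_density:
  assumes "\<sigma> > 0"
  shows "(\<integral>\<^sup>+v. ennreal (normal_density \<mu> \<sigma> v) \<partial>lborel) = 1"
  using prob_space.emeasure_space_1[OF prob_space_normal_density[OF assms, of \<mu>]]
  by (simp add: emeasure_density)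

lemma nn_integral_gauss_exp_square:
  assumes m: "m > 0" and \<theta>: "\<theta> < 1"
  shows "(\<integral>\<^sup>+v. ennreal (exp (\<theta> * (real m / 2) * v\<^sup>2)) \<partial>gauss_var_inv m) = ennreal (1 / sqrt (1 - \<theta>))"
proof -
  \<comment> \<open>Standard deviation of the normal density that results when the exponential
    factor is merged into the Gaussian one.\<close>
  define \<sigma> where "\<sigma> = 1 / sqrt (real m * (1 - \<theta>))"
  have \<sigma>: "\<sigma> > 0" using assms by (simp add: \<sigma>_def)
  have s2: "\<sigma>\<^sup>2 = 1 / (real m * (1 - \<theta>))" using assms by (simp add: \<sigma>_def power_divide)
  have eq: "normal_density 0 (1 / sqrt (real m)) v * exp (\<theta> * (real m / 2) * v\<^sup>2)
      = (1 / sqrt (1 - \<theta>)) * normal_density 0 \<sigma> v" for v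
  proof -
    have "exp (- (v\<^sup>2) / (2 * (1 / real m))) * exp (\<theta> * (real m / 2) * v\<^sup>2)
       = exp (- (v\<^sup>2) / (2 * (1 / (real m * (1 - \<theta>)))))"
      unfolding exp_add[symmetric] by (simp add: algebra_simps)
    moreover have "1 / sqrt (2 * pi * (1 / real m)) = (1 / sqrt (1 - \<theta>)) * (1 / sqrt (2 * pi * (1 / (real m * (1 - \<theta>)))))"
      using assms by (simp add: real_sqrt_mult real_sqrt_divide)
    ultimately show ?thesis unfolding normal_density_def s2
      by (simp add: power_divide)
  qed
  have "(\<integral>\<^sup>+v. ennreal (exp (\<theta> * (real m / 2) * v\<^sup>2)) \<partial>gauss_var_inv m)
    = (\<integral>\<^sup>+v. ennreal (normal_density 0 (1 / sqrt (real m)) v) * ennreal (exp (\<theta> * (real m / 2) * v\<^sup>2)) \<partial>lborel)"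
    unfolding gauss_var_inv_def by (subst nn_integral_density) auto
  also have "\<dots> = (\<integral>\<^sup>+v. ennreal (1 / sqrt (1 - \<theta>)) * ennreal (normal_density 0 \<sigma> v) \<partial>lborel)"
    using assms by (intro nn_integral_cong) (simp only: ennreal_mult[symmetric] normal_density_nonneg exp_ge_zero eq, simp add: ennreal_mult[symmetric])
  also have "\<dots> = ennreal (1 / sqrt (1 - \<theta>))"
    by (subst nn_integral_cmult) (auto simp: nn_integral_normal_density \<sigma>)
  finally show ?thesis .
qed

lemma nn_integral_gauss_exp_linear:
  assumes m: "m > 0"
  shows "(\<integral>\<^sup>+v. ennreal (exp (c * v)) \<partial>gauss_var_inv m) = ennreal (exp (c\<^sup>2 / (2 * real m)))"
proof -
  define \<sigma> where "\<sigma> = 1 / sqrt (real m)"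
  have \<sigma>: "\<sigma> > 0" using assms by (simp add: \<sigma>_def)
  have s2: "\<sigma>\<^sup>2 = 1 / real m" using assms by (simp add: \<sigma>_def power_divide)
  \<comment> \<open>Completing the square shifts the mean to \<open>c / real m\<close>.\<close>
  have eq: "normal_density 0 \<sigma> v * exp (c * v) = exp (c\<^sup>2 / (2 * real m)) * normal_density (c / real m) \<sigma> v" for v
  proof -
    have "exp (- (v\<^sup>2) / (2 * (1 / real m))) * exp (c * v)
       = exp (c\<^sup>2 / (2 * real m)) * exp (- ((v - c / real m)\<^sup>2) / (2 * (1 / real m)))"
      unfolding exp_add[symmetric] using m by (simp add: field_simps power2_eq_square)
    then show ?thesis unfolding normal_density_def s2 by simp
  qed
  have "(\<integral>\<^sup>+v. ennreal (exp (c * v)) \<partial>gauss_var_inv m)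
    = (\<integral>\<^sup>+v. ennreal (normal_density 0 \<sigma> v) * ennreal (exp (c * v)) \<partial>lborel)"
    unfolding gauss_var_inv_def \<sigma>_def by (subst nn_integral_density) auto
  also have "\<dots> = (\<integral>\<^sup>+v. ennreal (exp (c\<^sup>2 / (2 * real m))) * ennreal (normal_density (c / real m) \<sigma> v) \<partial>lborel)"
    by (intro nn_integral_cong) (simp only: ennreal_mult[symmetric] normal_density_nonneg exp_ge_zero eq)
  also have "\<dots> = ennreal (exp (c\<^sup>2 / (2 * real m)))"
    by (subst nn_integral_cmult) (auto simp: nn_integral_normal_density \<sigma>)
  finally show ?thesis .
qed

lemma product_sigma_finite_gauss: "m > 0 \<Longrightarrow> product_sigma_finite (\<lambda>_. gauss_var_inv m)"
  unfolding product_sigma_finite_def using prob_space_gauss prob_space_imp_sigma_finite by blast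

lemma prob_space_PiM_gauss: "m > 0 \<Longrightarrow> prob_space (PiM K (\<lambda>_. gauss_var_inv m))"
  by (intro prob_space_PiM prob_space_gauss)

lemma nn_integral_PiM_exp_square:
  assumes m: "m > 0" and \<theta>: "\<theta> < 1" and K: "finite K"
  shows "(\<integral>\<^sup>+v. ennreal (exp (\<theta> * (real m / 2) * (\<Sum>i\<in>K. (v i)\<^sup>2))) \<partial>PiM K (\<lambda>_. gauss_var_inv m))
    = ennreal ((1 / sqrt (1 - \<theta>)) ^ card K)"
proof -
  interpret product_sigma_finite "\<lambda>_. gauss_var_inv m" by (rule product_sigma_finite_gauss[OF m])
  have "ennreal (exp (\<theta> * (real m / 2) * (\<Sum>i\<in>K. (v i)\<^sup>2))) = (\<Prod>i\<in>K. ennreal (exp (\<theta> * (real m / 2) * (v i)\<^sup>2)))" for v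
    by (simp add: prod_ennreal sum_distrib_left exp_sum K)
  then have "(\<integral>\<^sup>+v. ennreal (exp (\<theta> * (real m / 2) * (\<Sum>i\<in>K. (v i)\<^sup>2))) \<partial>PiM K (\<lambda>_. gauss_var_inv m))
    = (\<Prod>i\<in>K. \<integral>\<^sup>+v. ennreal (exp (\<theta> * (real m / 2) * v\<^sup>2)) \<partial>gauss_var_inv m)"
    by (simp only:) (rule product_nn_integral_prod[OF K], simp)
  then show ?thesis
    using \<theta> by (simp only: nn_integral_gauss_exp_square[OF m \<theta>]) (simp add: ennreal_power)
qed

lemma nn_integral_PiM_exp_linear:
  assumes m: "m > 0" and K: "finite K"
  shows "(\<integral>\<^sup>+v. ennreal (exp (\<Sum>i\<in>K. c i * v i)) \<partial>PiM K (\<lambda>_. gauss_var_inv m))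
    = ennreal (exp ((\<Sum>i\<in>K. (c i)\<^sup>2) / (2 * real m)))"
proof -
  interpret product_sigma_finite "\<lambda>_. gauss_var_inv m" by (rule product_sigma_finite_gauss[OF m])
  have "ennreal (exp (\<Sum>i\<in>K. c i * v i)) = (\<Prod>i\<in>K. ennreal (exp (c i * v i)))" for v
    by (simp add: prod_ennreal exp_sum K)
  then have "(\<integral>\<^sup>+v. ennreal (exp (\<Sum>i\<in>K. c i * v i)) \<partial>PiM K (\<lambda>_. gauss_var_inv m))
    = (\<Prod>i\<in>K. \<integral>\<^sup>+v. ennreal (exp (c i * v)) \<partial>gauss_var_inv m)"
    by (simp only:) (rule product_nn_integral_prod[OF K], simp)
  then show ?thesis
    by (simp only: nn_integral_gauss_exp_linear[OF m]) (simp add: prod_ennreal exp_sum sum_divide_distrib K)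
qed

text \<open>Markov's inequality for \<open>exp (f \<omega>)\<close>. The Chernoff bounds below are
  instances in which \<open>f\<close> contains the chosen exponent.\<close>

lemma measure_le_exp_bound:
  assumes "prob_space M" and [measurable]: "f \<in> borel_measurable M"
    and le: "(\<integral>\<^sup>+\<omega>. ennreal (exp (f \<omega>)) \<partial>M) \<le> ennreal B" and B: "B \<ge> 0"
  shows "measure M {\<omega> \<in> space M. \<tau> \<le> f \<omega>} \<le> B * exp (- \<tau>)"
proof -
  interpret prob_space M by fact
  have "emeasure M {\<omega> \<in> space M. \<tau> \<le> f \<omega>} \<le> emeasure M {\<omega> \<in> space M. 1 \<le> ennreal (exp (- \<tau>)) * ennreal (exp (f \<omega>))}"
    by (intro emeasure_mono) (auto simp: ennreal_mult[symmetric] exp_add[symmetric] simp flip: ennreal_1)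
  also have "\<dots> \<le> ennreal (exp (- \<tau>)) * (\<integral>\<^sup>+\<omega>. ennreal (exp (f \<omega>)) * indicator (space M) \<omega> \<partial>M)"
    by (rule nn_integral_Markov_inequality) auto
  also have "(\<integral>\<^sup>+\<omega>. ennreal (exp (f \<omega>)) * indicator (space M) \<omega> \<partial>M) = (\<integral>\<^sup>+\<omega>. ennreal (exp (f \<omega>)) \<partial>M)"
    by (intro nn_integral_cong) auto
  also have "ennreal (exp (- \<tau>)) * \<dots> \<le> ennreal (exp (- \<tau>)) * ennreal B"
    by (intro mult_left_mono le) auto
  also have "\<dots> = ennreal (B * exp (- \<tau>))"
    using B by (simp add: ennreal_mult[symmetric] mult.commute)
  finally show ?thesis using B by (simp add: emeasure_eq_measure)
qed

section \<open>Chernoff bounds for norms, linear forms and projections\<close>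

lemma dot_measurable [measurable]:
  assumes "\<And>r. r < m \<Longrightarrow> (\<lambda>\<omega>. u \<omega> r) \<in> borel_measurable M" "\<And>r. r < m \<Longrightarrow> (\<lambda>\<omega>. v \<omega> r) \<in> borel_measurable M"
  shows "(\<lambda>\<omega>. dot m (u \<omega>) (v \<omega>)) \<in> borel_measurable M"
  unfolding dot_def using assms by (intro borel_measurable_sum borel_measurable_times) auto

lemma gvec_coord [measurable]: "r < m \<Longrightarrow> (\<lambda>v. v r) \<in> borel_measurable (gvec m)"
  using measurable_component_singleton[of r "{..<m}" "\<lambda>_. gauss_var_inv m"]
  by (simp cong: measurable_cong_sets)

lemma gvec_norm_upper_tail:
  assumes m: "m > 0" and \<eta>: "\<eta> > 0"
  shows "measure (gvec m) {v \<in> space (gvec m). 1 + \<eta> \<le> dot m v v} \<le> exp (- ((\<eta> - ln (1 + \<eta>)) / 2 * real m))"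
proof -
  \<comment> \<open>The minimizer of the Chernoff exponent, determined by
    \<open>1 / (1 - \<theta>) = 1 + \<eta>\<close>.\<close>
  define \<theta> where "\<theta> = \<eta> / (1 + \<eta>)"
  have \<theta>: "0 < \<theta>" "\<theta> < 1" "1 - \<theta> = 1 / (1 + \<eta>)" using \<eta> by (auto simp: \<theta>_def field_simps)
  have "(\<integral>\<^sup>+v. ennreal (exp (\<theta> * (real m / 2) * dot m v v)) \<partial>gvec m) \<le> ennreal ((1 / sqrt (1 - \<theta>)) ^ m)"
    using nn_integral_PiM_exp_square[OF m \<theta>(2), of "{..<m}"] by (simp add: dot_def power2_eq_square)
  then have "measure (gvec m) {v \<in> space (gvec m). \<theta> * (real m / 2) * (1 + \<eta>) \<le> \<theta> * (real m / 2) * dot m v v}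
      \<le> (1 / sqrt (1 - \<theta>)) ^ m * exp (- (\<theta> * (real m / 2) * (1 + \<eta>)))"
    using \<theta> \<eta> by (intro measure_le_exp_bound prob_space_PiM_gauss m) auto
  moreover have "(1 / sqrt (1 - \<theta>)) ^ m = exp (ln (1 + \<eta>) / 2 * real m)"
  proof -
    have "1 / sqrt (1 - \<theta>) = exp (ln (1 + \<eta>) / 2)"
      using \<eta> \<theta> by (simp add: real_sqrt_divide ln_sqrt[symmetric])
    then show ?thesis by (simp only: exp_of_nat2_mult)
  qed
  moreover have "\<theta> * (real m / 2) * (1 + \<eta>) \<le> \<theta> * (real m / 2) * dot m v v \<longleftrightarrow> 1 + \<eta> \<le> dot m v v" for v
    using \<theta> m by simp
  moreover have "exp (ln (1 + \<eta>) / 2 * real m) * exp (- (\<theta> * (real m / 2) * (1 + \<eta>)))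
      = exp (- ((\<eta> - ln (1 + \<eta>)) / 2 * real m))"
    unfolding exp_add[symmetric] using \<eta> by (simp add: \<theta>_def field_simps)
  ultimately show ?thesis by (simp only:)
qed

lemma gvec_norm_lower_tail:
  assumes m: "m > 0" and \<eta>: "\<eta> > 0" "\<eta> < 1"
  shows "measure (gvec m) {v \<in> space (gvec m). dot m v v \<le> 1 - \<eta>} \<le> exp (- ((- \<eta> - ln (1 - \<eta>)) / 2 * real m))"
proof -
  \<comment> \<open>The same optimization with \<open>1 - \<eta>\<close> in place of
    \<open>1 + \<eta>\<close>; the negative sign of \<open>\<theta>\<close> turns the bound into one
    for the lower tail.\<close>
  define \<theta> where "\<theta> = - \<eta> / (1 - \<eta>)"
  have \<theta>: "\<theta> < 0" "\<theta> < 1" "1 - \<theta> = 1 / (1 - \<eta>)" using \<eta> by (auto simp: \<theta>_def field_simps)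
  have "(\<integral>\<^sup>+v. ennreal (exp (\<theta> * (real m / 2) * dot m v v)) \<partial>gvec m) \<le> ennreal ((1 / sqrt (1 - \<theta>)) ^ m)"
    using nn_integral_PiM_exp_square[OF m \<theta>(2), of "{..<m}"] by (simp add: dot_def power2_eq_square)
  then have "measure (gvec m) {v \<in> space (gvec m). \<theta> * (real m / 2) * (1 - \<eta>) \<le> \<theta> * (real m / 2) * dot m v v}
      \<le> (1 / sqrt (1 - \<theta>)) ^ m * exp (- (\<theta> * (real m / 2) * (1 - \<eta>)))"
    using \<theta> \<eta> by (intro measure_le_exp_bound prob_space_PiM_gauss m) auto
  moreover have "(1 / sqrt (1 - \<theta>)) ^ m = exp (ln (1 - \<eta>) / 2 * real m)"
  proof -
    have "1 / sqrt (1 - \<theta>) = exp (ln (1 - \<eta>) / 2)"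
      using \<eta> \<theta> by (simp add: real_sqrt_divide ln_sqrt[symmetric])
    then show ?thesis by (simp only: exp_of_nat2_mult)
  qed
  moreover have "\<theta> * (real m / 2) * (1 - \<eta>) \<le> \<theta> * (real m / 2) * dot m v v \<longleftrightarrow> dot m v v \<le> 1 - \<eta>" for v
  proof -
    have neg: "\<theta> * (real m / 2) < 0" using \<theta> m by (simp add: mult_neg_pos)
    show ?thesis by (simp only: mult_le_cancel_left) (use neg in auto)
  qed
  moreover have "exp (ln (1 - \<eta>) / 2 * real m) * exp (- (\<theta> * (real m / 2) * (1 - \<eta>)))
      = exp (- ((- \<eta> - ln (1 - \<eta>)) / 2 * real m))"
    unfolding exp_add[symmetric] using \<eta> by (simp add: \<theta>_def field_simps)
  ultimately show ?thesis by (simp only:)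
qed

text \<open>The form \<open>dot m c v\<close> is centered Gaussian with variance
  \<open>dot m c c / real m\<close>. An upper bound \<open>B\<close> in place of the exact norm also
  covers \<open>c = 0\<close>.\<close>

lemma gvec_linear_tail:
  assumes m: "m > 0" and \<tau>: "\<tau> \<ge> 0" and B: "dot m c c \<le> B" "B > 0"
  shows "measure (gvec m) {v \<in> space (gvec m). \<tau> \<le> \<bar>dot m c v\<bar>} \<le> 2 * exp (- (real m * \<tau>\<^sup>2 / (2 * B)))"
proof -
  interpret prob_space "gvec m" by (rule prob_space_PiM_gauss[OF m])
  have one: "measure (gvec m) {v \<in> space (gvec m). \<tau> \<le> dot m (\<lambda>r. s * c r) v} \<le> exp (- (real m * \<tau>\<^sup>2 / (2 * B)))"
    if "s\<^sup>2 = 1" for s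
  proof -
    \<comment> \<open>This value minimizes
      \<open>l\<^sup>2 * B / (2 * real m) - l * \<tau>\<close>.\<close>
    define l where "l = real m * \<tau> / B"
    have l: "l \<ge> 0" using assms by (simp add: l_def)
    have "(\<integral>\<^sup>+v. ennreal (exp (l * dot m (\<lambda>r. s * c r) v)) \<partial>gvec m)
      = (\<integral>\<^sup>+v. ennreal (exp (\<Sum>i<m. (l * s * c i) * v i)) \<partial>gvec m)"
      by (simp add: dot_def sum_distrib_left algebra_simps)
    also have "\<dots> = ennreal (exp ((\<Sum>i<m. (l * s * c i)\<^sup>2) / (2 * real m)))"
      by (rule nn_integral_PiM_exp_linear[OF m]) simp
    also have "(\<Sum>i<m. (l * s * c i)\<^sup>2) = l\<^sup>2 * dot m c c"
      unfolding power_mult_distrib that by (simp add: dot_def sum_distrib_left power2_eq_square)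
    also have "ennreal (exp (l\<^sup>2 * dot m c c / (2 * real m))) \<le> ennreal (exp (l\<^sup>2 * B / (2 * real m)))"
      using B by (intro ennreal_leI) (auto intro!: divide_right_mono mult_left_mono)
    finally have "measure (gvec m) {v \<in> space (gvec m). l * \<tau> \<le> l * dot m (\<lambda>r. s * c r) v}
        \<le> exp (l\<^sup>2 * B / (2 * real m)) * exp (- (l * \<tau>))"
      by (intro measure_le_exp_bound prob_space_PiM_gauss m) auto
    moreover have "l\<^sup>2 * B / (2 * real m) - l * \<tau> = - (real m * \<tau>\<^sup>2 / (2 * B))"
      using m B by (simp add: l_def field_simps power2_eq_square)
    moreover have "measure (gvec m) {v \<in> space (gvec m). \<tau> \<le> dot m (\<lambda>r. s * c r) v}
      \<le> measure (gvec m) {v \<in> space (gvec m). l * \<tau> \<le> l * dot m (\<lambda>r. s * c r) v}"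
      using l by (intro finite_measure_mono) (auto intro: mult_left_mono)
    ultimately show ?thesis by (simp add: exp_add[symmetric])
  qed
  have "measure (gvec m) {v \<in> space (gvec m). \<tau> \<le> \<bar>dot m c v\<bar>}
    \<le> measure (gvec m) ({v \<in> space (gvec m). \<tau> \<le> dot m (\<lambda>r. 1 * c r) v} \<union> {v \<in> space (gvec m). \<tau> \<le> dot m (\<lambda>r. (-1) * c r) v})"
    unfolding dot_scale_left by (intro finite_measure_mono) auto
  also have "\<dots> \<le> exp (- (real m * \<tau>\<^sup>2 / (2 * B))) + exp (- (real m * \<tau>\<^sup>2 / (2 * B)))"
    by (rule order.trans[OF measure_Un_le add_mono[OF one one]]) auto
  finally show ?thesis by simp
qed

text \<open>Hubbard--Stratonovich: writing each factor \<open>exp (\<theta> m s\<^sup>2 / 2)\<close> as a Gaussian average of an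
  exponential that is linear in \<open>s\<close> makes the \<open>v\<close>-integral explicit, so that the rotation invariance
  of the Gaussian measure is not needed.\<close>

lemma nn_integral_bessel_exp_square:
  assumes m: "m > 0" and \<theta>: "0 \<le> \<theta>" "\<theta> < 1" and S: "finite S"
    and q: "\<And>h. dot m (\<lambda>r. \<Sum>i\<in>S. h i * q i r) (\<lambda>r. \<Sum>i\<in>S. h i * q i r) \<le> (\<Sum>i\<in>S. (h i)\<^sup>2)"
  shows "(\<integral>\<^sup>+v. ennreal (exp (\<theta> * (real m / 2) * (\<Sum>i\<in>S. (dot m (q i) v)\<^sup>2))) \<partial>gvec m)
    \<le> ennreal ((1 / sqrt (1 - \<theta>)) ^ card S)"
proof -
  let ?H = "PiM S (\<lambda>_. gauss_var_inv m)"
  \<comment> \<open>Chosen so that the Gaussian average of \<open>exp (?c * s * h)\<close> over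
    \<open>h\<close> is \<open>exp (\<theta> * (real m / 2) * s\<^sup>2)\<close>.\<close>
  let ?c = "real m * sqrt \<theta>"
  interpret V: prob_space "gvec m" by (rule prob_space_PiM_gauss[OF m])
  interpret H: prob_space ?H by (rule prob_space_PiM_gauss[OF m])
  interpret pair_sigma_finite "gvec m" ?H ..
  have [measurable]: "i \<in> S \<Longrightarrow> (\<lambda>v. v i) \<in> borel_measurable ?H" for i
    using measurable_component_singleton[of i S "\<lambda>_. gauss_var_inv m"]
    by (simp cong: measurable_cong_sets)
  have lin: "(\<Sum>i\<in>S. (?c * dot m (q i) v) * h i) = (\<Sum>r<m. (?c * (\<Sum>i\<in>S. h i * q i r)) * v r)" for v h
    unfolding dot_def sum_distrib_left sum_distrib_right
    by (subst sum.swap) (intro sum.cong refl, simp add: algebra_simps)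
  have sq: "ennreal (exp (\<theta> * (real m / 2) * (\<Sum>i\<in>S. (dot m (q i) v)\<^sup>2)))
    = (\<integral>\<^sup>+h. ennreal (exp (\<Sum>i\<in>S. (?c * dot m (q i) v) * h i)) \<partial>?H)" for v
  proof -
    have "(\<Sum>i\<in>S. (?c * dot m (q i) v)\<^sup>2) / (2 * real m) = \<theta> * (real m / 2) * (\<Sum>i\<in>S. (dot m (q i) v)\<^sup>2)"
    proof -
      have "(\<Sum>i\<in>S. (?c * dot m (q i) v)\<^sup>2) = ((real m)\<^sup>2 * \<theta>) * (\<Sum>i\<in>S. (dot m (q i) v)\<^sup>2)"
        using \<theta> by (simp add: power_mult_distrib sum_distrib_left)
      then show ?thesis using m by (simp add: power2_eq_square)
    qed
    then show ?thesis unfolding nn_integral_PiM_exp_linear[OF m S] by simp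
  qed
  \<comment> \<open>For fixed \<open>h\<close> the exponent is linear in \<open>v\<close>, with a
    multiple of \<open>\<Sum>i\<in>S. h i * q i r\<close> as coefficients; the hypothesis on
    \<open>q\<close> bounds their norm.\<close>
  have lin': "(\<integral>\<^sup>+v. ennreal (exp (\<Sum>i\<in>S. (?c * dot m (q i) v) * h i)) \<partial>gvec m)
     \<le> ennreal (exp (\<theta> * (real m / 2) * (\<Sum>i\<in>S. (h i)\<^sup>2)))" for h
  proof -
    let ?s = "\<lambda>r. \<Sum>i\<in>S. h i * q i r"
    have "(\<Sum>r<m. (?c * ?s r)\<^sup>2) = ((real m)\<^sup>2 * \<theta>) * dot m ?s ?s"
      unfolding power_mult_distrib real_sqrt_pow2[OF \<theta>(1)]
      by (simp add: dot_def sum_distrib_left[symmetric] power2_eq_square[symmetric])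
    then have "(\<Sum>r<m. (?c * ?s r)\<^sup>2) / (2 * real m) = \<theta> * (real m / 2) * dot m ?s ?s"
      using m by (simp add: power2_eq_square)
    also have "\<dots> \<le> \<theta> * (real m / 2) * (\<Sum>i\<in>S. (h i)\<^sup>2)"
      using \<theta> q by (intro mult_left_mono) auto
    finally show ?thesis unfolding lin
      by (subst nn_integral_PiM_exp_linear[OF m]) (auto intro: ennreal_leI)
  qed
  have "(\<integral>\<^sup>+v. ennreal (exp (\<theta> * (real m / 2) * (\<Sum>i\<in>S. (dot m (q i) v)\<^sup>2))) \<partial>gvec m)
    = (\<integral>\<^sup>+v. (\<integral>\<^sup>+h. ennreal (exp (\<Sum>i\<in>S. (?c * dot m (q i) v) * h i)) \<partial>?H) \<partial>gvec m)"
    unfolding sq ..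
  also have "\<dots> = (\<integral>\<^sup>+h. (\<integral>\<^sup>+v. ennreal (exp (\<Sum>i\<in>S. (?c * dot m (q i) v) * h i)) \<partial>gvec m) \<partial>?H)"
    by (rule Fubini'[symmetric]) (unfold dot_def, measurable)
  also have "\<dots> \<le> (\<integral>\<^sup>+h. ennreal (exp (\<theta> * (real m / 2) * (\<Sum>i\<in>S. (h i)\<^sup>2))) \<partial>?H)"
    by (intro nn_integral_mono lin')
  also have "\<dots> = ennreal ((1 / sqrt (1 - \<theta>)) ^ card S)"
    by (rule nn_integral_PiM_exp_square[OF m \<theta>(2) S])
  finally show ?thesis .
qed

text \<open>By Bessel's identity the lost energy is a sum of \<open>card S\<close> squared linear
  forms, each of which costs only a constant factor in the exponential moment.\<close>

lemma gvec_proj_perp_defect_tail: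
  assumes m: "m > 0" and S: "finite S"
  shows "measure (gvec m) {v \<in> space (gvec m). \<eta> \<le> dot m v v - dot m (proj_perp m A S v) (proj_perp m A S v)}
    \<le> 2 ^ card S * exp (- (\<eta> / 4 * real m))"
proof -
  obtain q where q: "\<And>h. dot m (\<lambda>r. \<Sum>i\<in>S. h i * q i r) (\<lambda>r. \<Sum>i\<in>S. h i * q i r) \<le> (\<Sum>i\<in>S. (h i)\<^sup>2)"
    and b: "\<And>y. dot m y y - dot m (proj_perp m A S y) (proj_perp m A S y) = (\<Sum>i\<in>S. (dot m (q i) y)\<^sup>2)"
    using proj_perp_bessel_system[OF S, of m A] by blast
  \<comment> \<open>The exponent is taken at \<open>\<theta> = 1/2\<close>, which gives a factor
    \<open>sqrt 2\<close> per direction, rounded up to 2 afterwards.\<close>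
  have "measure (gvec m) {v \<in> space (gvec m). \<eta> / 4 * real m \<le> (1/2) * (real m / 2) * (\<Sum>i\<in>S. (dot m (q i) v)\<^sup>2)}
     \<le> (1 / sqrt (1 - 1/2)) ^ card S * exp (- (\<eta> / 4 * real m))"
    by (intro measure_le_exp_bound prob_space_PiM_gauss m nn_integral_bessel_exp_square S q) auto
  also have "\<dots> \<le> 2 ^ card S * exp (- (\<eta> / 4 * real m))"
  proof -
    have "1 / sqrt (1 - 1/2 :: real) = sqrt 2" by (simp add: real_sqrt_divide)
    also have "\<dots> \<le> 2" by (rule real_le_lsqrt) auto
    finally show ?thesis by (intro mult_right_mono power_mono) auto
  qed
  also have "{v \<in> space (gvec m). \<eta> / 4 * real m \<le> (1/2) * (real m / 2) * (\<Sum>i\<in>S. (dot m (q i) v)\<^sup>2)}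
     = {v \<in> space (gvec m). \<eta> \<le> dot m v v - dot m (proj_perp m A S v) (proj_perp m A S v)}"
    unfolding b using m by (auto simp: field_simps)
  finally show ?thesis .
qed

lemma gvec_proj_perp_measurable [measurable]:
  "finite S \<Longrightarrow> (\<lambda>v. proj_perp m A S v r) \<in> borel_measurable (gvec m)"
  by (rule proj_perp_measurable[where A="\<lambda>_. A"]) auto

text \<open>The loss \<open>2 * \<eta>\<close> is split evenly: either the full vector is short by
  \<open>\<eta>\<close>, or the projection removes at least \<open>\<eta>\<close>.\<close>

lemma gvec_proj_perp_lower_tail:
  assumes m: "m > 0" and S: "finite S" and \<eta>: "0 < \<eta>" "\<eta> < 1"
  shows "measure (gvec m) {v \<in> space (gvec m). dot m (proj_perp m A S v) (proj_perp m A S v) \<le> 1 - 2 * \<eta>}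
    \<le> exp (- ((- \<eta> - ln (1 - \<eta>)) / 2 * real m)) + 2 ^ card S * exp (- (\<eta> / 4 * real m))"
proof -
  interpret prob_space "gvec m" by (rule prob_space_PiM_gauss[OF m])
  have "measure (gvec m) {v \<in> space (gvec m). dot m (proj_perp m A S v) (proj_perp m A S v) \<le> 1 - 2 * \<eta>}
    \<le> measure (gvec m) ({v \<in> space (gvec m). dot m v v \<le> 1 - \<eta>} \<union>
        {v \<in> space (gvec m). \<eta> \<le> dot m v v - dot m (proj_perp m A S v) (proj_perp m A S v)})"
    using S by (intro finite_measure_mono) auto
  also have "\<dots> \<le> exp (- ((- \<eta> - ln (1 - \<eta>)) / 2 * real m)) + 2 ^ card S * exp (- (\<eta> / 4 * real m))"
    using S by (intro order.trans[OF measure_Un_le add_mono[OF gvec_norm_lower_tail[OF m \<eta>] gvec_proj_perp_defect_tail[OF m S]]]) auto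
  finally show ?thesis .
qed

section \<open>Conditioning on columns of the Gaussian matrix\<close>

text \<open>The joint law of the coordinates is the product of their laws. The characterization of
  independence by laws covers nonempty index sets, hence the case distinction.\<close>

lemma indep_vars_PiM_coordinates:
  assumes "\<And>i. i \<in> K \<Longrightarrow> prob_space (M i)"
  shows "prob_space.indep_vars (PiM K M) M (\<lambda>i \<omega>. \<omega> i) K"
proof (cases "K = {}")
  case True
  interpret prob_space "PiM K M" by (intro prob_space_PiM assms)
  show ?thesis unfolding indep_vars_def indep_sets_def using True by auto
next
  case False
  interpret prob_space "PiM K M" by (intro prob_space_PiM assms)
  have "distr (PiM K M) (PiM K M) (\<lambda>x. \<lambda>i\<in>K. x i) = distr (PiM K M) (PiM K M) (\<lambda>x. x)"
    by (intro distr_cong refl) (auto simp: space_PiM PiE_def extensional_restrict)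
  also have "\<dots> = PiM K M" by (rule distr_id)
  also have "\<dots> = PiM K (\<lambda>i. distr (PiM K M) (M i) (\<lambda>x. x i))"
    using assms by (intro PiM_cong refl) (simp add: distr_PiM_component)
  finally show ?thesis using False by (subst indep_vars_iff_distr_eq_PiM') auto
qed

text \<open>Restricted to the first \<open>m\<close> coordinates so that the combination is a point
  of the product space \<open>gvec m\<close>.\<close>

definition comb :: "nat \<Rightarrow> nat set \<Rightarrow> (nat \<Rightarrow> real) \<Rightarrow> (nat \<times> nat \<Rightarrow> real) \<Rightarrow> nat \<Rightarrow> real" where
  "comb m J x A = (\<lambda>r\<in>{..<m}. \<Sum>j\<in>J. A (r, j) * x j)"

text \<open>Different rows use disjoint blocks of entries and are therefore independent; each row is
  a sum of independent normal variables of total variance \<open>1 / real m\<close>. Nonzero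
  coefficients keep every summand nondegenerate.\<close>

lemma distr_comb:
  assumes m: "m > 0" and J: "finite J" "(\<Sum>j\<in>J. (x j)\<^sup>2) = 1" and nz: "\<And>j. j \<in> J \<Longrightarrow> x j \<noteq> 0"
  shows "distr (PiM ({..<m} \<times> J) (\<lambda>_. gauss_var_inv m)) (gvec m) (comb m J x) = gvec m"
proof -
  let ?K = "{..<m} \<times> J"
  let ?P = "PiM ?K (\<lambda>_. gauss_var_inv m)"
  let ?s = "1 / sqrt (real m)"
  interpret prob_space ?P by (rule prob_space_PiM_gauss[OF m])
  have J0: "J \<noteq> {}" using J by auto
  have coord: "indep_vars (\<lambda>_. gauss_var_inv m) (\<lambda>i \<omega>. \<omega> i) ?K"
    by (rule indep_vars_PiM_coordinates) (rule prob_space_gauss[OF m])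
  have rows: "indep_vars (\<lambda>_. gauss_var_inv m) (\<lambda>r A. \<Sum>j\<in>J. A (r, j) * x j) {..<m}"
  proof -
    have "indep_vars (\<lambda>r. PiM ({r} \<times> J) (\<lambda>_. gauss_var_inv m)) (\<lambda>r \<omega>. restrict \<omega> ({r} \<times> J)) {..<m}"
      by (rule indep_vars_restrict[OF coord]) (auto simp: disjoint_family_on_def)
    then have "indep_vars (\<lambda>_. gauss_var_inv m) (\<lambda>r \<omega>. \<Sum>j\<in>J. (restrict \<omega> ({r} \<times> J)) (r, j) * x j) {..<m}"
    proof (rule indep_vars_compose2)
      fix r assume "r \<in> {..<m}"
      have [measurable]: "j \<in> J \<Longrightarrow> (\<lambda>\<omega>. \<omega> (r, j)) \<in> borel_measurable (PiM ({r} \<times> J) (\<lambda>_. gauss_var_inv m))" for j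
        using measurable_component_singleton[of "(r, j)" "{r} \<times> J" "\<lambda>_. gauss_var_inv m"]
        by (simp cong: measurable_cong_sets)
      show "(\<lambda>\<omega>. \<Sum>j\<in>J. \<omega> (r, j) * x j) \<in> PiM ({r} \<times> J) (\<lambda>_. gauss_var_inv m) \<rightarrow>\<^sub>M gauss_var_inv m"
        by measurable
    qed
    then show ?thesis by simp
  qed
  have row_law: "distr ?P (gauss_var_inv m) (\<lambda>A. \<Sum>j\<in>J. A (r, j) * x j) = gauss_var_inv m" if r: "r < m" for r
  proof -
    have "indep_vars (\<lambda>_. gauss_var_inv m) (\<lambda>i \<omega>. \<omega> i) ({r} \<times> J)"
      by (rule indep_vars_subset[OF coord]) (use r in auto)
    then have "indep_vars (\<lambda>_. borel) (\<lambda>i \<omega>. \<omega> i * x (snd i)) ({r} \<times> J)"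
      by (rule indep_vars_compose2)
         (intro borel_measurable_times measurable_ident_sets[OF sets_gauss] borel_measurable_const)
    moreover have "distributed ?P lborel (\<lambda>\<omega>. \<omega> (r, j) * x j) (normal_density 0 (\<bar>x j\<bar> * ?s))" if j: "j \<in> J" for j
    proof -
      have "distr ?P (gauss_var_inv m) (\<lambda>\<omega>. \<omega> (r, j)) = gauss_var_inv m"
        by (rule distr_PiM_component) (use r j prob_space_gauss[OF m] in auto)
      moreover have "distr ?P lborel (\<lambda>\<omega>. \<omega> (r, j)) = distr ?P (gauss_var_inv m) (\<lambda>\<omega>. \<omega> (r, j))"
        by (intro distr_cong) auto
      ultimately have "distr ?P lborel (\<lambda>\<omega>. \<omega> (r, j)) = density lborel (normal_density 0 ?s)"
        by (simp add: gauss_var_inv_def)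
      moreover have "(\<lambda>\<omega>. \<omega> (r, j)) \<in> borel_measurable ?P"
        using measurable_component_singleton[of "(r, j)" ?K "\<lambda>_. gauss_var_inv m"] r j
        by (simp cong: measurable_cong_sets)
      ultimately have "distributed ?P lborel (\<lambda>\<omega>. \<omega> (r, j)) (normal_density 0 ?s)"
        by (simp add: distributed_def)
      from normal_density_affine[OF this, of "x j" 0] show ?thesis
        using m nz[OF j] by (simp add: mult.commute)
    qed
    ultimately have "distributed ?P lborel (\<lambda>\<omega>. \<Sum>i\<in>{r} \<times> J. \<omega> i * x (snd i))
       (normal_density (\<Sum>i\<in>{r} \<times> J. 0) (sqrt (\<Sum>i\<in>{r} \<times> J. (\<bar>x (snd i)\<bar> * ?s)\<^sup>2)))"
      using m nz J J0 by (intro sum_indep_normal) auto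
    moreover have "(\<Sum>i\<in>{r} \<times> J. f i) = (\<Sum>j\<in>J. f (r, j))" for f :: "nat \<times> nat \<Rightarrow> real"
      by (rule sum.reindex_bij_witness[of _ "Pair r" snd]) auto
    ultimately have "distributed ?P lborel (\<lambda>\<omega>. \<Sum>j\<in>J. \<omega> (r, j) * x j)
       (normal_density 0 (sqrt (\<Sum>j\<in>J. (\<bar>x j\<bar> * ?s)\<^sup>2)))"
      by simp
    moreover have "sqrt (\<Sum>j\<in>J. (\<bar>x j\<bar> * ?s)\<^sup>2) = ?s"
    proof -
      have "(\<Sum>j\<in>J. (\<bar>x j\<bar> * ?s)\<^sup>2) = ?s\<^sup>2"
        unfolding power_mult_distrib power2_abs sum_distrib_right[symmetric] J by simp
      then show ?thesis by simp
    qed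
    ultimately have "distr ?P lborel (\<lambda>\<omega>. \<Sum>j\<in>J. \<omega> (r, j) * x j) = density lborel (normal_density 0 ?s)"
      by (simp add: distributed_def)
    moreover have "distr ?P (gauss_var_inv m) (\<lambda>\<omega>. \<Sum>j\<in>J. \<omega> (r, j) * x j) = distr ?P lborel (\<lambda>\<omega>. \<Sum>j\<in>J. \<omega> (r, j) * x j)"
      by (intro distr_cong) auto
    ultimately show ?thesis by (simp add: gauss_var_inv_def)
  qed
  have "distr ?P (gvec m) (\<lambda>A. \<lambda>r\<in>{..<m}. \<Sum>j\<in>J. A (r, j) * x j)
     = PiM {..<m} (\<lambda>r. distr ?P (gauss_var_inv m) (\<lambda>A. \<Sum>j\<in>J. A (r, j) * x j))"
    using rows m by (subst (asm) indep_vars_iff_distr_eq_PiM') (auto simp: indep_vars_def)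
  also have "\<dots> = gvec m"
    using row_law by (intro PiM_cong) auto
  finally show ?thesis by (simp add: comb_def[abs_def])
qed

lemma comb_measurable [measurable]:
  "comb m J x \<in> PiM ({..<m} \<times> J) (\<lambda>_. gauss_var_inv m) \<rightarrow>\<^sub>M gvec m"
proof -
  have "(\<lambda>A. A (r, j)) \<in> borel_measurable (PiM ({..<m} \<times> J) (\<lambda>_. gauss_var_inv m))" if "r < m" "j \<in> J" for r j
    using measurable_component_singleton[of "(r, j)" "{..<m} \<times> J" "\<lambda>_. gauss_var_inv m"] that
    by (simp cong: measurable_cong_sets)
  then show ?thesis unfolding comb_def
    by (intro measurable_restrict) (auto intro!: borel_measurable_sum borel_measurable_times cong: measurable_cong_sets)
qed

section \<open>Bounding probabilities by freezing columns, noise or matrix\<close>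

abbreviation gmat :: "nat \<Rightarrow> nat \<Rightarrow> (nat \<times> nat \<Rightarrow> real) measure" where
  "gmat m n \<equiv> PiM ({..<m} \<times> {..<n}) (\<lambda>_. gauss_var_inv m)"

text \<open>Conditioning on the columns outside \<open>J\<close>: once they are frozen to
  \<open>a\<close>, the event forces a standard combination of the remaining columns into
  \<open>G\<close>. The set \<open>G\<close> may depend on \<open>a\<close>, but the bound
  \<open>p\<close> may not, so it survives integration over \<open>a\<close>.\<close>

lemma gmat_conditional_bound:
  assumes m: "m > 0" and J: "J \<subseteq> {..<n}" "(\<Sum>j\<in>J. (x j)\<^sup>2) = 1" "\<And>j. j \<in> J \<Longrightarrow> x j \<noteq> 0"
    and E: "E \<in> sets (gmat m n)" and p: "p \<ge> 0"
    and cond: "\<And>a. \<exists>G \<in> sets (gvec m). measure (gvec m) G \<le> p \<and>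
       (\<forall>A\<in>E. (\<forall>r<m. \<forall>i<n. i \<notin> J \<longrightarrow> A (r, i) = a (r, i)) \<longrightarrow> comb m J x A \<in> G)"
  shows "measure (gmat m n) E \<le> p"
proof -
  let ?K1 = "{..<m} \<times> ({..<n} - J)" and ?K2 = "{..<m} \<times> J"
  interpret product_sigma_finite "\<lambda>_. gauss_var_inv m" by (rule product_sigma_finite_gauss[OF m])
  interpret P: prob_space "gmat m n" by (rule prob_space_PiM_gauss[OF m])
  interpret P1: prob_space "PiM ?K1 (\<lambda>_. gauss_var_inv m)" by (rule prob_space_PiM_gauss[OF m])
  interpret P2: prob_space "PiM ?K2 (\<lambda>_. gauss_var_inv m)" by (rule prob_space_PiM_gauss[OF m])
  interpret V: prob_space "gvec m" by (rule prob_space_PiM_gauss[OF m])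
  have fJ: "finite J" using J finite_subset by blast
  have K: "?K1 \<union> ?K2 = {..<m} \<times> {..<n}" using J by auto
  \<comment> \<open>Fubini over the split of the index set into frozen and free columns.\<close>
  have "emeasure (gmat m n) E = (\<integral>\<^sup>+a. emeasure (PiM ?K2 (\<lambda>_. gauss_var_inv m))
      ((\<lambda>b. merge ?K1 ?K2 (a, b)) -` E \<inter> space (PiM ?K2 (\<lambda>_. gauss_var_inv m))) \<partial>PiM ?K1 (\<lambda>_. gauss_var_inv m))"
    using emeasure_fold_integral[of ?K1 ?K2 E] E fJ unfolding K by auto
  also have "\<dots> \<le> (\<integral>\<^sup>+a. ennreal p \<partial>PiM ?K1 (\<lambda>_. gauss_var_inv m))"
  proof (rule nn_integral_mono)
    fix a assume a: "a \<in> space (PiM ?K1 (\<lambda>_. gauss_var_inv m))"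
    from cond[of a] obtain G where G [measurable]: "G \<in> sets (gvec m)" and Gp: "measure (gvec m) G \<le> p"
      and sub: "\<And>A. A \<in> E \<Longrightarrow> (\<And>r i. r < m \<Longrightarrow> i < n \<Longrightarrow> i \<notin> J \<Longrightarrow> A (r, i) = a (r, i)) \<Longrightarrow> comb m J x A \<in> G"
      by blast
    have "(\<lambda>b. merge ?K1 ?K2 (a, b)) -` E \<inter> space (PiM ?K2 (\<lambda>_. gauss_var_inv m))
      \<subseteq> comb m J x -` G \<inter> space (PiM ?K2 (\<lambda>_. gauss_var_inv m))"
    proof
      fix b assume "b \<in> (\<lambda>b. merge ?K1 ?K2 (a, b)) -` E \<inter> space (PiM ?K2 (\<lambda>_. gauss_var_inv m))"
      then have b: "merge ?K1 ?K2 (a, b) \<in> E" and bs: "b \<in> space (PiM ?K2 (\<lambda>_. gauss_var_inv m))" by auto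
      have "comb m J x (merge ?K1 ?K2 (a, b)) \<in> G"
        by (rule sub[OF b]) (auto simp: merge_def)
      moreover have "comb m J x (merge ?K1 ?K2 (a, b)) = comb m J x b"
        by (auto simp: comb_def merge_def intro!: restrict_ext sum.cong)
      ultimately show "b \<in> comb m J x -` G \<inter> space (PiM ?K2 (\<lambda>_. gauss_var_inv m))"
        using bs by simp
    qed
    then have "emeasure (PiM ?K2 (\<lambda>_. gauss_var_inv m))
        ((\<lambda>b. merge ?K1 ?K2 (a, b)) -` E \<inter> space (PiM ?K2 (\<lambda>_. gauss_var_inv m)))
      \<le> emeasure (PiM ?K2 (\<lambda>_. gauss_var_inv m)) (comb m J x -` G \<inter> space (PiM ?K2 (\<lambda>_. gauss_var_inv m)))"
      by (rule emeasure_mono) measurable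
    also have "\<dots> = emeasure (distr (PiM ?K2 (\<lambda>_. gauss_var_inv m)) (gvec m) (comb m J x)) G"
      by (rule emeasure_distr[symmetric]) measurable
    also have "\<dots> = emeasure (gvec m) G" by (simp add: distr_comb[OF m fJ J(2,3)])
    also have "\<dots> \<le> ennreal p" using Gp by (simp add: V.emeasure_eq_measure ennreal_leI)
    finally show "emeasure (PiM ?K2 (\<lambda>_. gauss_var_inv m))
        ((\<lambda>b. merge ?K1 ?K2 (a, b)) -` E \<inter> space (PiM ?K2 (\<lambda>_. gauss_var_inv m))) \<le> ennreal p" .
  qed
  also have "\<dots> = ennreal p" by (simp add: P1.emeasure_space_1)
  finally show ?thesis using p by (simp add: P.emeasure_eq_measure)
qed

text \<open>Fubini with the noise frozen, for events whose randomness comes from the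
  columns.\<close>

lemma omp_space_bound_matrix:
  assumes m: "m > 0" and E: "E \<in> sets (omp_space m n)" and p: "p \<ge> 0"
    and "\<And>w. w \<in> space (gvec m) \<Longrightarrow> measure (gmat m n) {A \<in> space (gmat m n). (A, w) \<in> E} \<le> p"
  shows "measure (omp_space m n) E \<le> p"
proof -
  interpret PM: prob_space "gmat m n" by (rule prob_space_PiM_gauss[OF m])
  interpret V: prob_space "gvec m" by (rule prob_space_PiM_gauss[OF m])
  interpret pair_prob_space "gmat m n" "gvec m" ..
  have "emeasure (omp_space m n) E = (\<integral>\<^sup>+w. emeasure (gmat m n) ((\<lambda>A. (A, w)) -` E) \<partial>gvec m)"
    using E unfolding omp_space_def by (rule emeasure_pair_measure_alt2)
  also have "\<dots> \<le> (\<integral>\<^sup>+w. ennreal p \<partial>gvec m)"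
  proof (rule nn_integral_mono)
    fix w assume w: "w \<in> space (gvec m)"
    have "(\<lambda>A. (A, w)) -` E = {A \<in> space (gmat m n). (A, w) \<in> E}"
      using sets.sets_into_space[OF E] by (auto simp: omp_space_def space_pair_measure)
    then show "emeasure (gmat m n) ((\<lambda>A. (A, w)) -` E) \<le> ennreal p"
      using assms(4)[OF w] by (simp add: PM.emeasure_eq_measure ennreal_leI)
  qed
  also have "\<dots> = ennreal p" by (simp add: V.emeasure_space_1)
  finally show ?thesis using p unfolding omp_space_def by (simp add: emeasure_eq_measure)
qed

text \<open>The counterpart with the matrix frozen, in which every projection becomes
  deterministic.\<close>

lemma omp_space_bound_noise:
  assumes m: "m > 0" and E: "E \<in> sets (omp_space m n)" and p: "p \<ge> 0"
    and "\<And>A. A \<in> space (gmat m n) \<Longrightarrow> measure (gvec m) {w \<in> space (gvec m). (A, w) \<in> E} \<le> p"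
  shows "measure (omp_space m n) E \<le> p"
proof -
  interpret PM: prob_space "gmat m n" by (rule prob_space_PiM_gauss[OF m])
  interpret V: prob_space "gvec m" by (rule prob_space_PiM_gauss[OF m])
  interpret pair_prob_space "gmat m n" "gvec m" ..
  have "emeasure (omp_space m n) E = (\<integral>\<^sup>+A. emeasure (gvec m) (Pair A -` E) \<partial>gmat m n)"
    using E unfolding omp_space_def by (rule V.emeasure_pair_measure_alt)
  also have "\<dots> \<le> (\<integral>\<^sup>+A. ennreal p \<partial>gmat m n)"
  proof (rule nn_integral_mono)
    fix A assume A: "A \<in> space (gmat m n)"
    have "Pair A -` E = {w \<in> space (gvec m). (A, w) \<in> E}"
      using sets.sets_into_space[OF E] by (auto simp: omp_space_def space_pair_measure)
    then show "emeasure (gvec m) (Pair A -` E) \<le> ennreal p"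
      using assms(4)[OF A] by (simp add: V.emeasure_eq_measure ennreal_leI)
  qed
  also have "\<dots> = ennreal p" by (simp add: PM.emeasure_space_1)
  finally show ?thesis using p unfolding omp_space_def by (simp add: emeasure_eq_measure)
qed

section \<open>Residuals and index sets\<close>

text \<open>A two-level chaining argument. Representatives of the norm classes are bounded at
  relative level \<open>1 + \<alpha>\<close>, differences to them at level \<open>\<alpha>\<close>.
  The logarithm in the first term counts the classes; the second term is the crude union over all
  times.\<close>

lemma gvec_nested_residuals_tail:
  fixes z :: "nat \<Rightarrow> nat \<Rightarrow> real"
  assumes m: "m > 0" and lo: "lo > 0" and \<alpha>: "0 < \<alpha>" and L: "0 \<le> L"
    and nested: "\<And>s t. s \<le> t \<Longrightarrow> t \<le> k \<Longrightarrow> dot m (z s) (z t) = dot m (z t) (z t)"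
    and bounds: "\<And>t. t \<le> k \<Longrightarrow> lo \<le> dot m (z t) (z t) \<and> dot m (z t) (z t) \<le> hi"
  shows "measure (gvec m) {v \<in> space (gvec m). \<exists>t\<le>k. (1 + 2 * \<alpha>)\<^sup>2 * (2 * L / real m) * dot m (z t) (z t) < (dot m (z t) v)\<^sup>2}
    \<le> (ln (hi / lo) / ln (1 + \<alpha>\<^sup>2 / 3) + 1) * (2 * exp (- ((1 + \<alpha>)\<^sup>2 * L))) + (real k + 1) * (2 * exp (- (3 * L)))"
proof -
  interpret prob_space "gvec m" by (rule prob_space_PiM_gauss[OF m])
  \<comment> \<open>A difference of squared norm at most \<open>\<beta> * M\<close> exceeds
    \<open>\<alpha> * \<tau> * sqrt M\<close> with probability at most
    \<open>2 * exp (- (\<alpha>\<^sup>2 / \<beta> * L))\<close>. This value makes the exponent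
    \<open>3 * L\<close>, enough to pay later for all times and all columns.\<close>
  define \<beta> where "\<beta> = \<alpha>\<^sup>2 / 3"
  \<comment> \<open>The scale at which a unit vector has Gaussian tail
    \<open>2 * exp (- L)\<close>.\<close>
  define \<tau> where "\<tau> = sqrt (2 * L / real m)"
  define N where "N = (\<lambda>t. dot m (z t) (z t))"
  \<comment> \<open>The class of \<open>t\<close>: the index \<open>c\<close> of the geometric
    interval from \<open>lo * (1 + \<beta>) ^ c\<close> to
    \<open>lo * (1 + \<beta>) ^ (c + 1)\<close> containing \<open>N t\<close>.\<close>
  define g where "g = (\<lambda>t. nat \<lfloor>ln (N t / lo) / ln (1 + \<beta>)\<rfloor>)"
  define G where "G = nat \<lfloor>ln (hi / lo) / ln (1 + \<beta>)\<rfloor>"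
  \<comment> \<open>The last time of a class has the smallest residual of the class. Empty classes
    receive the time 0, so that \<open>rep c \<le> k\<close> always holds.\<close>
  define rep where "rep = (\<lambda>c. if \<exists>t\<le>k. g t = c then Max {t. t \<le> k \<and> g t = c} else 0)"
  define B1 where "B1 = (\<lambda>c. {v \<in> space (gvec m). (1 + \<alpha>) * \<tau> * sqrt (N (rep c)) \<le> \<bar>dot m (z (rep c)) v\<bar>})"
  define B2 where "B2 = (\<lambda>t. {v \<in> space (gvec m). \<alpha> * \<tau> * sqrt (N (rep (g t))) \<le> \<bar>dot m (\<lambda>r. z t r - z (rep (g t)) r) v\<bar>})"
  have \<beta>: "\<beta> > 0" using \<alpha> by (simp add: \<beta>_def)
  have lb: "ln (1 + \<beta>) > 0" using \<beta> by simp
  have \<tau>: "\<tau> \<ge> 0" "\<tau>\<^sup>2 = 2 * L / real m" using L by (auto simp: \<tau>_def)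
  have Npos: "t \<le> k \<Longrightarrow> 0 < N t" for t using bounds[of t] lo by (auto simp: N_def)
  have hilo: "lo \<le> hi" using bounds[of 0] by auto
  have gG: "g t \<le> G" if "t \<le> k" for t
  proof -
    have "ln (N t / lo) \<le> ln (hi / lo)"
      using bounds[OF that] lo Npos[OF that] by (auto simp: N_def divide_right_mono)
    then show ?thesis unfolding g_def G_def using lb by (intro nat_mono floor_mono divide_right_mono) auto
  qed
  have rep_k: "rep c \<le> k" for c
  proof (cases "\<exists>t\<le>k. g t = c")
    case True
    then have "Max {t. t \<le> k \<and> g t = c} \<in> {t. t \<le> k \<and> g t = c}" by (intro Max_in) auto
    then show ?thesis using True by (simp add: rep_def)
  qed (auto simp: rep_def)
  have rep: "g (rep (g t)) = g t \<and> t \<le> rep (g t)" if "t \<le> k" for t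
  proof -
    have ex: "\<exists>s\<le>k. g s = g t" using that by auto
    then have "Max {s. s \<le> k \<and> g s = g t} \<in> {s. s \<le> k \<and> g s = g t}" by (intro Max_in) auto
    moreover have "t \<le> Max {s. s \<le> k \<and> g s = g t}" using that by (intro Max_ge) auto
    ultimately show ?thesis using ex by (simp add: rep_def)
  qed
  have diffN: "dot m (\<lambda>r. z t r - z (rep (g t)) r) (\<lambda>r. z t r - z (rep (g t)) r) = N t - N (rep (g t))"
    if "t \<le> k" for t
    using nested[OF conjunct2[OF rep[OF that]] rep_k] by (simp add: dot_self_diff N_def)
  have N_mono: "N (rep (g t)) \<le> N t" if "t \<le> k" for t
    using diffN[OF that] dot_self_nonneg[of m "\<lambda>r. z t r - z (rep (g t)) r"] by simp
  have N_ratio: "N t - N (rep (g t)) \<le> \<beta> * N (rep (g t))" if t: "t \<le> k" for t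
  proof -
    let ?s = "rep (g t)"
    \<comment> \<open>Nonnegativity prevents truncation by \<open>nat\<close>, so equal classes mean
      equal floors.\<close>
    have ge0: "0 \<le> ln (N u / lo) / ln (1 + \<beta>)" if "u \<le> k" for u
      using bounds[OF that] lo lb by (auto simp: N_def)
    have "\<lfloor>ln (N ?s / lo) / ln (1 + \<beta>)\<rfloor> = \<lfloor>ln (N t / lo) / ln (1 + \<beta>)\<rfloor>"
      using rep[OF t] ge0[OF t] ge0[OF rep_k, of "g t"] unfolding g_def
      by (metis eq_nat_nat_iff zero_le_floor)
    then have "ln (N t / lo) / ln (1 + \<beta>) < ln (N ?s / lo) / ln (1 + \<beta>) + 1" by linarith
    then have "ln (N t / lo) < ln (N ?s / lo) + ln (1 + \<beta>)"
      using lb by (simp add: field_simps)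
    then have "ln (N t) < ln (N ?s) + ln (1 + \<beta>)"
      using Npos[OF t] Npos[OF rep_k, of "g t"] lo by (simp add: ln_div)
    also have "\<dots> = ln (N ?s * (1 + \<beta>))"
      using Npos[OF rep_k, of "g t"] \<beta> by (simp add: ln_mult)
    finally have "N t < N ?s * (1 + \<beta>)"
      using Npos[OF t] Npos[OF rep_k, of "g t"] \<beta> by (subst (asm) ln_less_cancel_iff) auto
    then show ?thesis by (simp add: algebra_simps)
  qed
  have mB1: "measure (gvec m) (B1 c) \<le> 2 * exp (- ((1 + \<alpha>)\<^sup>2 * L))" for c
  proof -
    have "measure (gvec m) (B1 c) \<le> 2 * exp (- (real m * ((1 + \<alpha>) * \<tau> * sqrt (N (rep c)))\<^sup>2 / (2 * N (rep c))))"
      unfolding B1_def using \<alpha> \<tau> Npos[OF rep_k] by (intro gvec_linear_tail m) (auto simp: N_def dot_self_nonneg)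
    also have "real m * ((1 + \<alpha>) * \<tau> * sqrt (N (rep c)))\<^sup>2 / (2 * N (rep c)) = (1 + \<alpha>)\<^sup>2 * L"
      using Npos[OF rep_k, of c] m by (simp add: power_mult_distrib \<tau>(2))
    finally show ?thesis .
  qed
  have mB2: "measure (gvec m) (B2 t) \<le> 2 * exp (- (3 * L))" if t: "t \<le> k" for t
  proof -
    let ?M = "N (rep (g t))"
    have "measure (gvec m) (B2 t) \<le> 2 * exp (- (real m * (\<alpha> * \<tau> * sqrt ?M)\<^sup>2 / (2 * (\<beta> * ?M))))"
      unfolding B2_def using \<alpha> \<tau> \<beta> Npos[OF rep_k] N_ratio[OF t] diffN[OF t]
      by (intro gvec_linear_tail m) (auto simp: N_def dot_self_nonneg)
    also have "real m * (\<alpha> * \<tau> * sqrt ?M)\<^sup>2 / (2 * (\<beta> * ?M)) = 3 * L"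
      using Npos[OF rep_k, of "g t"] m \<alpha> by (simp add: power_mult_distrib \<tau>(2) \<beta>_def)
    finally show ?thesis .
  qed
  have [measurable]: "B1 c \<in> sets (gvec m)" "B2 t \<in> sets (gvec m)" for c t
    unfolding B1_def B2_def by measurable
  have "{v \<in> space (gvec m). \<exists>t\<le>k. (1 + 2 * \<alpha>)\<^sup>2 * (2 * L / real m) * N t < (dot m (z t) v)\<^sup>2}
     \<subseteq> (\<Union>c\<le>G. B1 c) \<union> (\<Union>t\<le>k. B2 t)"
  proof (rule ccontr)
    assume "\<not> ?thesis"
    then obtain v t where v: "v \<in> space (gvec m)" and t: "t \<le> k"
      and big: "(1 + 2 * \<alpha>)\<^sup>2 * (2 * L / real m) * N t < (dot m (z t) v)\<^sup>2"
      and nB: "v \<notin> (\<Union>c\<le>G. B1 c)" "v \<notin> (\<Union>t\<le>k. B2 t)" by blast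
    let ?M = "N (rep (g t))"
    have "\<bar>dot m (z (rep (g t))) v\<bar> < (1 + \<alpha>) * \<tau> * sqrt ?M"
      using nB(1) gG[OF t] v by (auto simp: B1_def not_le)
    moreover have "\<bar>dot m (\<lambda>r. z t r - z (rep (g t)) r) v\<bar> < \<alpha> * \<tau> * sqrt ?M"
      using nB(2) t v by (auto simp: B2_def not_le)
    \<comment> \<open>The triangle inequality adds the levels \<open>1 + \<alpha>\<close> and
      \<open>\<alpha>\<close>.\<close>
    ultimately have "\<bar>dot m (z t) v\<bar> \<le> (1 + 2 * \<alpha>) * \<tau> * sqrt ?M"
      unfolding dot_diff_left by (simp add: algebra_simps)
    also have "\<dots> \<le> (1 + 2 * \<alpha>) * \<tau> * sqrt (N t)"
      using N_mono[OF t] \<alpha> \<tau> by (intro mult_left_mono) auto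
    finally have "(dot m (z t) v)\<^sup>2 \<le> ((1 + 2 * \<alpha>) * \<tau> * sqrt (N t))\<^sup>2"
      by (metis abs_ge_zero power2_abs power_mono)
    also have "\<dots> = (1 + 2 * \<alpha>)\<^sup>2 * (2 * L / real m) * N t"
      using Npos[OF t] by (simp add: power_mult_distrib \<tau>(2))
    finally show False using big by simp
  qed
  then have "measure (gvec m) {v \<in> space (gvec m). \<exists>t\<le>k. (1 + 2 * \<alpha>)\<^sup>2 * (2 * L / real m) * N t < (dot m (z t) v)\<^sup>2}
     \<le> measure (gvec m) ((\<Union>c\<le>G. B1 c) \<union> (\<Union>t\<le>k. B2 t))"
    by (intro finite_measure_mono) auto
  also have "\<dots> \<le> measure (gvec m) (\<Union>c\<le>G. B1 c) + measure (gvec m) (\<Union>t\<le>k. B2 t)"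
    by (intro measure_Un_le) auto
  also have "\<dots> \<le> (\<Sum>c\<le>G. measure (gvec m) (B1 c)) + (\<Sum>t\<le>k. measure (gvec m) (B2 t))"
    by (intro add_mono finite_measure_subadditive_finite) auto
  also have "\<dots> \<le> (\<Sum>c\<le>G. 2 * exp (- ((1 + \<alpha>)\<^sup>2 * L))) + (\<Sum>t\<le>k. 2 * exp (- (3 * L)))"
    by (intro add_mono sum_mono mB1 mB2) auto
  also have "\<dots> = (real G + 1) * (2 * exp (- ((1 + \<alpha>)\<^sup>2 * L))) + (real k + 1) * (2 * exp (- (3 * L)))"
    by (simp add: algebra_simps)
  also have "real G \<le> ln (hi / lo) / ln (1 + \<beta>)"
  proof -
    have "0 \<le> ln (hi / lo) / ln (1 + \<beta>)" using hilo lo lb by simp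
    then show ?thesis unfolding G_def by (simp add: of_nat_nat)
  qed
  finally show ?thesis by (simp add: N_def \<beta>_def)
qed

text \<open>Replaces \<open>LEAST\<close> and \<open>Max\<close> by finitely many comparisons of
  correlations, a form suited to measurability proofs and to comparing two runs.\<close>

lemma omp_istar_eq_iff:
  assumes "n > 0"
  shows "omp_istar m n A y S = j \<longleftrightarrow> j < n \<and> (\<forall>i<n. omp_rho m A y S i \<le> omp_rho m A y S j)
      \<and> (\<forall>i<j. omp_rho m A y S i < omp_rho m A y S j)"
proof -
  let ?\<rho> = "omp_rho m A y S"
  have Max_in: "omp_rho_star m n A y S \<in> ?\<rho> ` {..<n}"
    unfolding omp_rho_star_def using assms by (intro Max_in) auto
  then have ex: "\<exists>j. j < n \<and> ?\<rho> j = omp_rho_star m n A y S" by auto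
  have le: "?\<rho> i \<le> omp_rho_star m n A y S" if "i < n" for i
    unfolding omp_rho_star_def using that by (intro Max_ge) auto
  show ?thesis
  proof
    assume j: "omp_istar m n A y S = j"
    have 1: "j < n" "?\<rho> j = omp_rho_star m n A y S"
      using LeastI_ex[OF ex] j by (auto simp: omp_istar_def)
    have "?\<rho> i < ?\<rho> j" if "i < j" for i
      using not_less_Least[of i "\<lambda>j. j < n \<and> ?\<rho> j = omp_rho_star m n A y S"] that j 1 le[of i]
      by (auto simp: omp_istar_def)
    with 1 le show "j < n \<and> (\<forall>i<n. ?\<rho> i \<le> ?\<rho> j) \<and> (\<forall>i<j. ?\<rho> i < ?\<rho> j)" by auto
  next
    assume j: "j < n \<and> (\<forall>i<n. ?\<rho> i \<le> ?\<rho> j) \<and> (\<forall>i<j. ?\<rho> i < ?\<rho> j)"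
    with ex le have star: "?\<rho> j = omp_rho_star m n A y S" by (metis order.antisym)
    show "omp_istar m n A y S = j" unfolding omp_istar_def
      by (rule Least_equality) (use j star in \<open>auto simp: not_less[symmetric]\<close>)
  qed
qed

section \<open>Growth, measurability and locality of the selected sets\<close>

lemma omp_istar_less: "n > 0 \<Longrightarrow> omp_istar m n A y S < n"
  using omp_istar_eq_iff by blast

lemma omp_rho_istar: "n > 0 \<Longrightarrow> omp_rho m A y S (omp_istar m n A y S) = omp_rho_star m n A y S"
  unfolding omp_rho_star_def using omp_istar_eq_iff[of n m A y S "omp_istar m n A y S"]
  by (intro Max_eqI[symmetric]) auto

lemma omp_set_subset: "n > 0 \<Longrightarrow> omp_set m n A y t \<subseteq> {..<n}"
  by (induction t) (auto simp: omp_istar_less)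

lemma omp_set_mono: "s \<le> t \<Longrightarrow> omp_set m n A y s \<subseteq> omp_set m n A y t"
  by (rule lift_Suc_mono_le) auto

lemma finite_omp_set: "finite (omp_set m n A y t)"
  by (induction t) auto

lemma omp_rho_altdef:
  "omp_rho m A y S j = (dot m (\<lambda>r. A (r, j)) (proj_perp m A S y))\<^sup>2 / dot m (proj_perp m A S y) (proj_perp m A S y)"
  by (simp add: omp_rho_def dot_def Let_def power2_eq_square)

lemma omp_rho_measurable:
  assumes "S \<subseteq> {..<n}" "j < n" "\<And>r i. r < m \<Longrightarrow> i < n \<Longrightarrow> (\<lambda>\<omega>. A \<omega> (r, i)) \<in> borel_measurable M"
    and "\<And>r. r < m \<Longrightarrow> (\<lambda>\<omega>. y \<omega> r) \<in> borel_measurable M"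
  shows "(\<lambda>\<omega>. omp_rho m (A \<omega>) (y \<omega>) S j) \<in> borel_measurable M"
proof -
  have fin: "finite S" using assms finite_subset by blast
  have "(\<lambda>\<omega>. proj_perp m (A \<omega>) S (y \<omega>) r) \<in> borel_measurable M" for r
    by (rule proj_perp_measurable[OF fin]) (use assms in auto)
  then show ?thesis unfolding omp_rho_altdef
    using assms by (intro borel_measurable_divide borel_measurable_power dot_measurable) auto
qed

text \<open>The selected set has finitely many possible values, so the event for the next step
  splits over fixed predecessors \<open>S'\<close>, for which the selection rule is
  measurable.\<close>

lemma omp_set_measurable:
  assumes n: "n > 0" and A: "\<And>r i. r < m \<Longrightarrow> i < n \<Longrightarrow> (\<lambda>\<omega>. A \<omega> (r, i)) \<in> borel_measurable M"
    and y: "\<And>r. r < m \<Longrightarrow> (\<lambda>\<omega>. y \<omega> r) \<in> borel_measurable M"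
  shows "Measurable.pred M (\<lambda>\<omega>. omp_set m n (A \<omega>) (y \<omega>) t = S)"
proof (induction t arbitrary: S)
  case 0
  show ?case by simp
next
  case (Suc t)
  note Suc [measurable]
  have [measurable]: "Measurable.pred M (\<lambda>\<omega>. omp_istar m n (A \<omega>) (y \<omega>) S' = j)" if "S' \<in> Pow {..<n}" for S' j
  proof (cases "j < n")
    case True
    have [measurable]: "i < n \<Longrightarrow> (\<lambda>\<omega>. omp_rho m (A \<omega>) (y \<omega>) S' i) \<in> borel_measurable M" for i
      by (rule omp_rho_measurable) (use that A y in auto)
    have "Measurable.pred M (\<lambda>\<omega>. (\<forall>i\<in>{..<n}. omp_rho m (A \<omega>) (y \<omega>) S' i \<le> omp_rho m (A \<omega>) (y \<omega>) S' j)
        \<and> (\<forall>i\<in>{..<j}. omp_rho m (A \<omega>) (y \<omega>) S' i < omp_rho m (A \<omega>) (y \<omega>) S' j))"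
      using True by (intro pred_intros_logic pred_intros_finite borel_measurable_pred_less) auto
    then show ?thesis unfolding omp_istar_eq_iff[OF n] using True by (simp add: Ball_def)
  next
    case False
    then show ?thesis unfolding omp_istar_eq_iff[OF n] by simp
  qed
  have "omp_set m n (A \<omega>) (y \<omega>) (Suc t) = S \<longleftrightarrow>
     (\<exists>S'\<in>Pow {..<n}. \<exists>j\<in>{..<n}. insert j S' = S \<and> omp_set m n (A \<omega>) (y \<omega>) t = S' \<and> omp_istar m n (A \<omega>) (y \<omega>) S' = j)" for \<omega>
    using omp_set_subset[OF n, of m "A \<omega>" "y \<omega>" t] omp_istar_less[OF n] by auto
  then have eq: "(\<lambda>\<omega>. omp_set m n (A \<omega>) (y \<omega>) (Suc t) = S) =
     (\<lambda>\<omega>. \<exists>S'\<in>Pow {..<n}. \<exists>j\<in>{..<n}. insert j S' = S \<and> omp_set m n (A \<omega>) (y \<omega>) t = S' \<and> omp_istar m n (A \<omega>) (y \<omega>) S' = j)"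
    by (rule ext)
  show ?case unfolding eq by measurable
qed

lemma omp_rho_cong:
  assumes "\<And>r i. r < m \<Longrightarrow> i \<in> S \<Longrightarrow> A (r, i) = B (r, i)" "\<And>r. r < m \<Longrightarrow> A (r, j) = B (r, j)"
    and "\<And>r. r < m \<Longrightarrow> u r = v r"
  shows "omp_rho m A u S j = omp_rho m B v S j"
proof -
  have "proj_perp m A S u = proj_perp m B S v" by (rule proj_perp_cong) (use assms in auto)
  moreover have "dot m (\<lambda>r. A (r, j)) p = dot m (\<lambda>r. B (r, j)) p" for p
    by (rule dot_cong) (use assms in auto)
  ultimately show ?thesis by (simp add: omp_rho_altdef)
qed

lemma omp_set_cong:
  assumes n: "n > 0" and A: "\<And>r i. r < m \<Longrightarrow> i < n \<Longrightarrow> A (r, i) = B (r, i)" and u: "\<And>r. r < m \<Longrightarrow> u r = v r"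
  shows "omp_set m n A u t = omp_set m n B v t"
proof (induction t)
  case (Suc t)
  let ?S = "omp_set m n B v t"
  have "omp_rho m A u ?S j = omp_rho m B v ?S j" if "j < n" for j
    using omp_set_subset[OF n, of m B v t] that by (intro omp_rho_cong) (auto simp: A u)
  then have \<rho>: "omp_rho m B v ?S j = omp_rho m A u ?S j" if "j < n" for j using that by simp
  define l where "l = omp_istar m n B v ?S"
  have "l < n \<and> (\<forall>i<n. omp_rho m B v ?S i \<le> omp_rho m B v ?S l) \<and> (\<forall>i<l. omp_rho m B v ?S i < omp_rho m B v ?S l)"
    using omp_istar_eq_iff[OF n, of m B v ?S l] by (simp add: l_def)
  then have "omp_istar m n A u ?S = l"
    by (subst omp_istar_eq_iff[OF n]) (auto simp: \<rho>[symmetric])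
  then have "omp_istar m n A u ?S = omp_istar m n B v ?S" by (simp add: l_def)
  with Suc show ?case by simp
qed simp

section \<open>Error events\<close>

definition lincomb :: "nat set \<Rightarrow> (nat \<Rightarrow> real) \<Rightarrow> (nat \<times> nat \<Rightarrow> real) \<Rightarrow> nat \<Rightarrow> real" where
  "lincomb J x A = (\<lambda>r. \<Sum>j\<in>J. A (r, j) * x j)"

text \<open>Columns are zeroed rather than deleted, which keeps the index set. A zero column has
  correlation 0 and cannot win against a positive correlation.\<close>

definition mask_cols :: "nat set \<Rightarrow> (nat \<times> nat \<Rightarrow> real) \<Rightarrow> nat \<times> nat \<Rightarrow> real" where
  "mask_cols T A = (\<lambda>(r, j). if j \<in> T then A (r, j) else 0)"

text \<open>The residual after \<open>t\<close> steps of the run in which all columns outside the support are replaced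
  by zero. Unlike the actual residual, it is independent of the columns outside the support, and as
  long as the actual run only selects indices of the support the two residuals agree.\<close>

definition genie_res ::
  "nat \<Rightarrow> nat \<Rightarrow> (nat \<Rightarrow> real) \<Rightarrow> (nat \<times> nat \<Rightarrow> real) \<Rightarrow> (nat \<Rightarrow> real) \<Rightarrow> nat \<Rightarrow> nat \<Rightarrow> real" where
  "genie_res m n x A w t =
     (let B = mask_cols (support n x) A; y = meas m n A x w in proj_perp m B (omp_set m n B y t) y)"

section \<open>Geometry and measurability of the genie residuals\<close>

lemma finite_support [simp]: "finite (support n x)"
  by (simp add: support_def)

lemma support_subset: "support n x \<subseteq> {..<n}"
  by (auto simp: support_def)

lemma meas_eq_lincomb: "meas m n A x w = (\<lambda>r. lincomb (support n x) x A r + w r)"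
  unfolding meas_def lincomb_def
  by (intro ext arg_cong2[of _ _ _ _ "(+)"] sum.mono_neutral_right) (auto simp: support_def)

lemma lincomb_in_col_span: "lincomb J x A \<in> col_span m A J"
  unfolding lincomb_def col_span_def by (auto intro!: exI[of _ x] simp: mult.commute)

lemma genie_res_nested:
  "s \<le> t \<Longrightarrow> dot m (genie_res m n x A w s) (genie_res m n x A w t)
     = dot m (genie_res m n x A w t) (genie_res m n x A w t)"
  unfolding genie_res_def Let_def by (intro dot_proj_perp_nested finite_omp_set omp_set_mono)

lemma genie_res_upper: "dot m (genie_res m n x A w t) (genie_res m n x A w t) \<le> dot m (meas m n A x w) (meas m n A x w)"
  by (simp add: genie_res_def Let_def dot_proj_perp_le_self finite_omp_set)

lemma proj_perp_support_meas: "proj_perp m A (support n x) (meas m n A x w) = proj_perp m A (support n x) w"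
  unfolding meas_eq_lincomb by (intro proj_perp_add_span lincomb_in_col_span) simp

text \<open>The masked run may select zeroed columns once nothing better is left; they add nothing
  to the span.\<close>

lemma col_span_mask:
  assumes "finite S" "finite T" "u \<in> col_span m (mask_cols T A) S"
  shows "u \<in> col_span m A T"
proof -
  from assms obtain c where c: "\<forall>r<m. u r = (\<Sum>i\<in>S. c i * mask_cols T A (r, i))" by (auto simp: col_span_def)
  have "(\<Sum>i\<in>S. c i * mask_cols T A (r, i)) = (\<Sum>i\<in>S \<inter> T. c i * A (r, i))" for r
    by (rule sum.mono_neutral_cong_right) (use assms in \<open>auto simp: mask_cols_def\<close>)
  then have "u \<in> col_span m A (S \<inter> T)" using c by (auto simp: col_span_def)
  then show ?thesis by (rule col_span_mono) (use assms in auto)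
qed

text \<open>The genie residual differs from the measurement by an element of the support span, so
  the projection for the whole support is at most as long; that projection removes the signal and
  leaves only noise.\<close>

lemma genie_res_lower:
  "dot m (proj_perp m A (support n x) w) (proj_perp m A (support n x) w)
    \<le> dot m (genie_res m n x A w t) (genie_res m n x A w t)"
  unfolding proj_perp_support_meas[of m A n x w, symmetric]
  unfolding genie_res_def Let_def
  by (rule dot_proj_perp_le[OF finite_support
        col_span_mask[OF finite_omp_set finite_support proj_perp_span[OF finite_omp_set]]])

text \<open>The form in which independence of the off-support columns is used: changing them does
  not change the residual.\<close>

lemma genie_res_cong:
  assumes "n > 0" "\<And>r i. r < m \<Longrightarrow> i \<in> support n x \<Longrightarrow> A (r, i) = B (r, i)"
  shows "genie_res m n x A w t = genie_res m n x B w t"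
proof -
  let ?T = "support n x"
  have A: "mask_cols ?T A (r, i) = mask_cols ?T B (r, i)" if "r < m" for r i using that assms by (auto simp: mask_cols_def)
  have y: "meas m n A x w r = meas m n B x w r" if "r < m" for r
    using that assms by (auto simp: meas_eq_lincomb lincomb_def intro!: sum.cong)
  have "omp_set m n (mask_cols ?T A) (meas m n A x w) t = omp_set m n (mask_cols ?T B) (meas m n B x w) t"
    by (rule omp_set_cong[OF assms(1)]) (use A y in auto)
  then show ?thesis unfolding genie_res_def Let_def by (auto intro!: proj_perp_cong A y)
qed

lemma omp_space_matrix_measurable [measurable]:
  "r < m \<Longrightarrow> i < n \<Longrightarrow> (\<lambda>\<omega>. fst \<omega> (r, i)) \<in> borel_measurable (omp_space m n)"
proof -
  assume "r < m" "i < n"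
  then have "(\<lambda>A. A (r, i)) \<in> borel_measurable (gmat m n)"
    using measurable_component_singleton[of "(r, i)" "{..<m} \<times> {..<n}" "\<lambda>_. gauss_var_inv m"]
    by (simp cong: measurable_cong_sets)
  then show ?thesis unfolding omp_space_def by measurable
qed

lemma omp_space_noise_measurable [measurable]:
  "r < m \<Longrightarrow> (\<lambda>\<omega>. snd \<omega> r) \<in> borel_measurable (omp_space m n)"
  unfolding omp_space_def by (rule measurable_compose[OF measurable_snd gvec_coord])

lemma lincomb_measurable:
  assumes "J \<subseteq> {..<n}" "r < m"
  shows "(\<lambda>\<omega>. lincomb J x (fst \<omega>) r) \<in> borel_measurable (omp_space m n)"
  unfolding lincomb_def using assms by (intro borel_measurable_sum borel_measurable_times) auto

lemma meas_measurable: "r < m \<Longrightarrow> (\<lambda>\<omega>. meas m n (fst \<omega>) x (snd \<omega>) r) \<in> borel_measurable (omp_space m n)"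
  unfolding meas_eq_lincomb
  by (intro borel_measurable_add lincomb_measurable support_subset) auto

lemma genie_res_measurable [measurable]:
  assumes n: "n > 0"
  shows "(\<lambda>\<omega>. genie_res m n x (fst \<omega>) (snd \<omega>) t r) \<in> borel_measurable (omp_space m n)"
proof -
  let ?T = "support n x"
  let ?B = "\<lambda>\<omega>. mask_cols ?T (fst \<omega>)" and ?y = "\<lambda>\<omega>. meas m n (fst \<omega>) x (snd \<omega>)"
  have B: "(\<lambda>\<omega>. ?B \<omega> (r, i)) \<in> borel_measurable (omp_space m n)" if "r < m" "i < n" for r i
    using that by (cases "i \<in> ?T") (auto simp: mask_cols_def)
  have [measurable]: "Measurable.pred (omp_space m n) (\<lambda>\<omega>. omp_set m n (?B \<omega>) (?y \<omega>) t = S)" for S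
    by (rule omp_set_measurable[OF n]) (use B meas_measurable in auto)
  have P: "(\<lambda>\<omega>. proj_perp m (?B \<omega>) S (?y \<omega>) r) \<in> borel_measurable (omp_space m n)" if "S \<in> Pow {..<n}" for S
    by (rule proj_perp_measurable) (use that finite_subset B meas_measurable in auto)
  \<comment> \<open>The random index set is replaced by a finite sum over its possible
    values.\<close>
  have eq: "genie_res m n x (fst \<omega>) (snd \<omega>) t r = (\<Sum>S\<in>Pow {..<n}.
      if omp_set m n (?B \<omega>) (?y \<omega>) t = S then proj_perp m (?B \<omega>) S (?y \<omega>) r else 0)" for \<omega>
    using omp_set_subset[OF n] by (simp add: genie_res_def Let_def)
  show ?thesis unfolding eq by (intro borel_measurable_sum measurable_If P) auto
qed

text \<open>The norm bounds belong to the event so that, with the noise and the other columns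
  frozen, either the slice is empty or the chaining bound applies. Their failure is charged to
  \<open>noise_event\<close> and \<open>large_event\<close>.\<close>

definition off_event where
  "off_event m n x k lo hi \<nu> j = {\<omega> \<in> space (omp_space m n).
     (\<forall>t\<in>{..k}. lo \<le> dot m (genie_res m n x (fst \<omega>) (snd \<omega>) t) (genie_res m n x (fst \<omega>) (snd \<omega>) t)
        \<and> dot m (genie_res m n x (fst \<omega>) (snd \<omega>) t) (genie_res m n x (fst \<omega>) (snd \<omega>) t) \<le> hi) \<and>
     (\<exists>t\<in>{..k}. \<nu> * dot m (genie_res m n x (fst \<omega>) (snd \<omega>) t) (genie_res m n x (fst \<omega>) (snd \<omega>) t)
        < (dot m (genie_res m n x (fst \<omega>) (snd \<omega>) t) (\<lambda>r. fst \<omega> (r, j)))\<^sup>2)}"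

lemma off_event_sets:
  assumes "n > 0" "j < n"
  shows "off_event m n x k lo hi \<nu> j \<in> sets (omp_space m n)"
proof -
  have [measurable]: "(\<lambda>\<omega>. dot m (genie_res m n x (fst \<omega>) (snd \<omega>) t) (genie_res m n x (fst \<omega>) (snd \<omega>) t))
      \<in> borel_measurable (omp_space m n)" for t
    using assms by (intro dot_measurable genie_res_measurable)
  have [measurable]: "(\<lambda>\<omega>. dot m (genie_res m n x (fst \<omega>) (snd \<omega>) t) (\<lambda>r. fst \<omega> (r, j)))
      \<in> borel_measurable (omp_space m n)" for t
    using assms by (intro dot_measurable genie_res_measurable) auto
  show ?thesis unfolding off_event_def by measurable
qed

lemma measure_off_event:
  assumes m: "m > 0" and n: "n > 0" and j: "j < n" "j \<notin> support n x"
    and lo: "0 < lo" "lo \<le> hi" and \<alpha>: "0 < \<alpha>" and L: "0 \<le> L"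
  shows "measure (omp_space m n) (off_event m n x k lo hi ((1 + 2 * \<alpha>)\<^sup>2 * (2 * L / real m)) j)
    \<le> (ln (hi / lo) / ln (1 + \<alpha>\<^sup>2 / 3) + 1) * (2 * exp (- ((1 + \<alpha>)\<^sup>2 * L))) + (real k + 1) * (2 * exp (- (3 * L)))"
    (is "measure _ ?E \<le> ?p")
proof (rule omp_space_bound_matrix[OF m])
  show E: "?E \<in> sets (omp_space m n)" by (rule off_event_sets[OF n j(1)])
  show p: "0 \<le> ?p" using lo by (intro add_nonneg_nonneg mult_nonneg_nonneg divide_nonneg_nonneg) auto
  fix w assume w: "w \<in> space (gvec m)"
  let ?\<nu> = "(1 + 2 * \<alpha>)\<^sup>2 * (2 * L / real m)"
  let ?F = "{A \<in> space (gmat m n). (A, w) \<in> ?E}"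
  \<comment> \<open>With \<open>J = {j}\<close> and coefficient 1 the free combination is the column
    \<open>j\<close> itself.\<close>
  show "measure (gmat m n) ?F \<le> ?p"
  proof (rule gmat_conditional_bound[OF m _ _ _ _ p, where J="{j}" and x="\<lambda>_. 1"])
    show "?F \<in> sets (gmat m n)"
      using E w unfolding omp_space_def by measurable
    fix a :: "nat \<times> nat \<Rightarrow> real"
    define z where "z = genie_res m n x a w"
    define G where "G = (if \<forall>t\<le>k. lo \<le> dot m (z t) (z t) \<and> dot m (z t) (z t) \<le> hi
       then {v \<in> space (gvec m). \<exists>t\<in>{..k}. ?\<nu> * dot m (z t) (z t) < (dot m (z t) v)\<^sup>2} else {})"
    have "G \<in> sets (gvec m)" unfolding G_def
    proof (split if_split, intro conjI impI)
      show "{v \<in> space (gvec m). \<exists>t\<in>{..k}. ?\<nu> * dot m (z t) (z t) < (dot m (z t) v)\<^sup>2} \<in> sets (gvec m)"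
        by measurable
    qed simp
    moreover have "measure (gvec m) G \<le> ?p"
    proof (cases "\<forall>t\<le>k. lo \<le> dot m (z t) (z t) \<and> dot m (z t) (z t) \<le> hi")
      case True
      then have "G = {v \<in> space (gvec m). \<exists>t\<le>k. ?\<nu> * dot m (z t) (z t) < (dot m (z t) v)\<^sup>2}"
        by (auto simp: G_def)
      moreover have "measure (gvec m) \<dots> \<le> ?p"
      proof (rule gvec_nested_residuals_tail[OF m lo(1) \<alpha> L])
        show "dot m (z s) (z t) = dot m (z t) (z t)" if "s \<le> t" for s t
          unfolding z_def using that by (rule genie_res_nested)
      qed (use True in auto)
      ultimately show ?thesis by simp
    next
      case False
      then have "G = {}" unfolding G_def by (rule if_not_P)
      then show ?thesis using p by simp
    qed
    moreover have "comb m {j} (\<lambda>_. 1) A \<in> G"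
      if A: "A \<in> ?F" and agree: "\<forall>r<m. \<forall>i<n. i \<notin> {j} \<longrightarrow> A (r, i) = a (r, i)" for A
    proof -
      have z: "genie_res m n x A w = z" unfolding z_def
      proof (rule ext, rule genie_res_cong[OF n])
        show "A (r, i) = a (r, i)" if "r < m" "i \<in> support n x" for r i
          using agree that j support_subset[of n x] by auto
      qed
      have c: "dot m (z t) (comb m {j} (\<lambda>_. 1) A) = dot m (z t) (\<lambda>r. A (r, j))" for t
        by (rule dot_cong) (auto simp: comb_def)
      have "comb m {j} (\<lambda>_. 1) A \<in> space (gvec m)" by (auto simp: comb_def space_PiM)
      moreover have bd: "\<forall>t\<le>k. lo \<le> dot m (z t) (z t) \<and> dot m (z t) (z t) \<le> hi"
        and "\<exists>t\<in>{..k}. ?\<nu> * dot m (z t) (z t) < (dot m (z t) (\<lambda>r. A (r, j)))\<^sup>2"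
        using A unfolding off_event_def by (auto simp only: z mem_Collect_eq fst_conv snd_conv)
      moreover have "G = {v \<in> space (gvec m). \<exists>t\<in>{..k}. ?\<nu> * dot m (z t) (z t) < (dot m (z t) v)\<^sup>2}"
        unfolding G_def using bd by (rule if_P)
      ultimately show ?thesis by (simp only: c mem_Collect_eq)
    qed
    ultimately show "\<exists>G\<in>sets (gvec m). measure (gvec m) G \<le> ?p \<and>
       (\<forall>A\<in>?F. (\<forall>r<m. \<forall>i<n. i \<notin> {j} \<longrightarrow> A (r, i) = a (r, i)) \<longrightarrow> comb m {j} (\<lambda>_. 1) A \<in> G)"
      by blast
  qed (use j(1) in auto)
qed

text \<open>Failure of the first progress condition, for the single combination with coefficients
  \<open>x\<close> rather than for all vectors spanned by the columns in \<open>J\<close>.\<close>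

definition shrink_event where
  "shrink_event m n x J I \<eta> = {\<omega> \<in> space (omp_space m n).
     dot m (proj_perp m (fst \<omega>) I (lincomb J x (fst \<omega>))) (proj_perp m (fst \<omega>) I (lincomb J x (fst \<omega>)))
       \<le> (1 - 2 * \<eta>) * (\<Sum>j\<in>J. (x j)\<^sup>2)}"

text \<open>The first conjunct excludes \<open>shrink_event\<close>; it keeps the projected vector
  long, which makes the noise correlation relatively small.\<close>

definition align_event where
  "align_event m n x J I \<eta> = {\<omega> \<in> space (omp_space m n).
     (1 - 2 * \<eta>) * (\<Sum>j\<in>J. (x j)\<^sup>2)
       < dot m (proj_perp m (fst \<omega>) I (lincomb J x (fst \<omega>))) (proj_perp m (fst \<omega>) I (lincomb J x (fst \<omega>))) \<and>
     \<eta> * dot m (proj_perp m (fst \<omega>) I (lincomb J x (fst \<omega>))) (proj_perp m (fst \<omega>) I (lincomb J x (fst \<omega>)))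
       \<le> \<bar>dot m (proj_perp m (fst \<omega>) I (lincomb J x (fst \<omega>))) (snd \<omega>)\<bar>}"

text \<open>Outside this event the signal energy is controlled, which bounds the number of norm
  classes.\<close>

definition large_event where
  "large_event m n x J = {\<omega> \<in> space (omp_space m n).
     2 * (\<Sum>j\<in>J. (x j)\<^sup>2) \<le> dot m (lincomb J x (fst \<omega>)) (lincomb J x (fst \<omega>))}"

text \<open>The upper bound on the noise serves progress inside the support; the lower bound keeps
  the genie residuals away from 0.\<close>

definition noise_event where
  "noise_event m n T \<eta> = {\<omega> \<in> space (omp_space m n). 1 + \<eta> \<le> dot m (snd \<omega>) (snd \<omega>) \<or>
     dot m (proj_perp m (fst \<omega>) T (snd \<omega>)) (proj_perp m (fst \<omega>) T (snd \<omega>)) \<le> 1 - 2 * \<eta>}"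

section \<open>Measurability and probabilities of the error events\<close>

lemma proj_lincomb_measurable [measurable]:
  assumes "J \<subseteq> {..<n}" "I \<subseteq> {..<n}"
  shows "(\<lambda>\<omega>. proj_perp m (fst \<omega>) I (lincomb J x (fst \<omega>)) r) \<in> borel_measurable (omp_space m n)"
  by (rule proj_perp_measurable) (use assms finite_subset lincomb_measurable in auto)

lemma event_sets:
  assumes "J \<subseteq> {..<n}" "I \<subseteq> {..<n}"
  shows "shrink_event m n x J I \<eta> \<in> sets (omp_space m n)"
    "align_event m n x J I \<eta> \<in> sets (omp_space m n)"
    "large_event m n x J \<in> sets (omp_space m n)"
    "noise_event m n I \<eta> \<in> sets (omp_space m n)"
proof -
  let ?b = "\<lambda>\<omega>. proj_perp m (fst \<omega>) I (lincomb J x (fst \<omega>))"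
  have [measurable]: "(\<lambda>\<omega>. dot m (?b \<omega>) (?b \<omega>)) \<in> borel_measurable (omp_space m n)"
    "(\<lambda>\<omega>. dot m (?b \<omega>) (snd \<omega>)) \<in> borel_measurable (omp_space m n)"
    "(\<lambda>\<omega>. dot m (lincomb J x (fst \<omega>)) (lincomb J x (fst \<omega>))) \<in> borel_measurable (omp_space m n)"
    using assms by (intro dot_measurable proj_lincomb_measurable lincomb_measurable omp_space_noise_measurable; simp)+
  have P: "(\<lambda>\<omega>. proj_perp m (fst \<omega>) I (snd \<omega>) r) \<in> borel_measurable (omp_space m n)" for r
    by (rule proj_perp_measurable) (use assms finite_subset in auto)
  have [measurable]: "(\<lambda>\<omega>. dot m (proj_perp m (fst \<omega>) I (snd \<omega>)) (proj_perp m (fst \<omega>) I (snd \<omega>))) \<in> borel_measurable (omp_space m n)"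
    "(\<lambda>\<omega>. dot m (snd \<omega>) (snd \<omega>)) \<in> borel_measurable (omp_space m n)"
    by (intro dot_measurable P omp_space_noise_measurable; simp)+
  show "shrink_event m n x J I \<eta> \<in> sets (omp_space m n)" unfolding shrink_event_def by measurable
  show "align_event m n x J I \<eta> \<in> sets (omp_space m n)" unfolding align_event_def by measurable
  show "large_event m n x J \<in> sets (omp_space m n)" unfolding large_event_def by measurable
  show "noise_event m n I \<eta> \<in> sets (omp_space m n)" unfolding noise_event_def by measurable
qed

text \<open>Dividing by \<open>sqrt X\<close> produces the unit coefficient vector that
  \<open>distr_comb\<close> asks for.\<close>

lemma lincomb_normalized:
  assumes "X = (\<Sum>j\<in>J. (x j)\<^sup>2)" "X > 0" "r < m"
  shows "lincomb J x A r = sqrt X * comb m J (\<lambda>j. x j / sqrt X) A r"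
  using assms(2,3) by (simp add: lincomb_def comb_def sum_distrib_left)

text \<open>As \<open>I\<close> and \<open>J\<close> are disjoint, the projection is fixed once the
  columns outside \<open>J\<close> are frozen, while the normalized combination remains
  Gaussian.\<close>

lemma measure_shrink_event:
  assumes m: "m > 0" and J: "J \<subseteq> {..<n}" "J \<noteq> {}" and I: "I \<subseteq> {..<n}" "I \<inter> J = {}" "card I \<le> k"
    and x: "\<And>j. j \<in> J \<Longrightarrow> x j \<noteq> 0" and \<eta>: "0 < \<eta>" "\<eta> < 1"
  shows "measure (omp_space m n) (shrink_event m n x J I \<eta>)
    \<le> exp (- ((- \<eta> - ln (1 - \<eta>)) / 2 * real m)) + 2 ^ k * exp (- (\<eta> / 4 * real m))" (is "_ \<le> ?p")
proof (rule omp_space_bound_matrix[OF m])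
  define X where "X = (\<Sum>j\<in>J. (x j)\<^sup>2)"
  have fin: "finite J" "finite I" using J I finite_subset by blast+
  have X: "X > 0" unfolding X_def using J x fin by (intro sum_pos) auto
  show E: "shrink_event m n x J I \<eta> \<in> sets (omp_space m n)" by (rule event_sets) (use J I in auto)
  fix w assume w: "w \<in> space (gvec m)"
  let ?F = "{A \<in> space (gmat m n). (A, w) \<in> shrink_event m n x J I \<eta>}"
  let ?x = "\<lambda>j. x j / sqrt X"
  show "measure (gmat m n) ?F \<le> ?p"
  proof (rule gmat_conditional_bound[OF m J(1), where x="?x"])
    show "?F \<in> sets (gmat m n)"
      using E w unfolding omp_space_def by measurable
    show "(\<Sum>j\<in>J. (?x j)\<^sup>2) = 1"
      using X by (simp add: power_divide sum_divide_distrib[symmetric] X_def)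
    fix a :: "nat \<times> nat \<Rightarrow> real"
    define G where "G = {v \<in> space (gvec m). dot m (proj_perp m a I v) (proj_perp m a I v) \<le> 1 - 2 * \<eta>}"
    have "G \<in> sets (gvec m)" unfolding G_def using fin by measurable
    moreover have "measure (gvec m) G \<le> ?p"
    proof -
      have "measure (gvec m) G \<le> exp (- ((- \<eta> - ln (1 - \<eta>)) / 2 * real m)) + 2 ^ card I * exp (- (\<eta> / 4 * real m))"
        unfolding G_def by (rule gvec_proj_perp_lower_tail[OF m fin(2) \<eta>])
      also have "\<dots> \<le> ?p" using I by (intro add_left_mono mult_right_mono power_increasing) auto
      finally show ?thesis .
    qed
    moreover have "comb m J ?x A \<in> G"
      if A: "A \<in> ?F" and agree: "\<forall>r<m. \<forall>i<n. i \<notin> J \<longrightarrow> A (r, i) = a (r, i)" for A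
    proof -
      let ?v = "comb m J ?x A"
      have "proj_perp m A I (lincomb J x A) = proj_perp m a I (\<lambda>r. sqrt X * ?v r)"
        using agree I X by (intro proj_perp_cong) (auto simp: lincomb_normalized[OF X_def])
      also have "\<dots> = (\<lambda>r. sqrt X * proj_perp m a I ?v r)" by (rule proj_perp_scale[OF fin(2)])
      finally have "dot m (proj_perp m A I (lincomb J x A)) (proj_perp m A I (lincomb J x A))
         = X * dot m (proj_perp m a I ?v) (proj_perp m a I ?v)"
        using X by (simp add: dot_scale_left dot_scale_right)
      moreover have "?v \<in> space (gvec m)" by (auto simp: comb_def space_PiM)
      ultimately show ?thesis using A X unfolding shrink_event_def G_def X_def[symmetric]
        by (simp add: mult.commute[of X])
    qed
    ultimately show "\<exists>G\<in>sets (gvec m). measure (gvec m) G \<le> ?p \<and>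
       (\<forall>A\<in>?F. (\<forall>r<m. \<forall>i<n. i \<notin> J \<longrightarrow> A (r, i) = a (r, i)) \<longrightarrow> comb m J ?x A \<in> G)"
      by blast
  qed (use x X in auto)
qed auto

lemma measure_large_event:
  assumes m: "m > 0" and J: "J \<subseteq> {..<n}" "J \<noteq> {}" and x: "\<And>j. j \<in> J \<Longrightarrow> x j \<noteq> 0"
  shows "measure (omp_space m n) (large_event m n x J) \<le> exp (- ((1 - ln 2) / 2 * real m))" (is "_ \<le> ?p")
proof (rule omp_space_bound_matrix[OF m])
  define X where "X = (\<Sum>j\<in>J. (x j)\<^sup>2)"
  have fin: "finite J" using J finite_subset by blast
  have X: "X > 0" unfolding X_def using J x fin by (intro sum_pos) auto
  show E: "large_event m n x J \<in> sets (omp_space m n)" by (rule event_sets) (use J in auto)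
  fix w assume w: "w \<in> space (gvec m)"
  let ?F = "{A \<in> space (gmat m n). (A, w) \<in> large_event m n x J}"
  let ?x = "\<lambda>j. x j / sqrt X"
  show "measure (gmat m n) ?F \<le> ?p"
  proof (rule gmat_conditional_bound[OF m J(1), where x="?x"])
    show "?F \<in> sets (gmat m n)"
      using E w unfolding omp_space_def by measurable
    show "(\<Sum>j\<in>J. (?x j)\<^sup>2) = 1"
      using X by (simp add: power_divide sum_divide_distrib[symmetric] X_def)
    fix a :: "nat \<times> nat \<Rightarrow> real"
    \<comment> \<open>Written as \<open>1 + 1\<close> to match the upper norm tail at
      \<open>\<eta> = 1\<close>.\<close>
    define G where "G = {v \<in> space (gvec m). 1 + 1 \<le> dot m v v}"
    have "G \<in> sets (gvec m)" unfolding G_def by measurable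
    moreover have "measure (gvec m) G \<le> ?p"
      using gvec_norm_upper_tail[OF m, of 1] unfolding G_def by simp
    moreover have "comb m J ?x A \<in> G" if A: "A \<in> ?F" for A
    proof -
      let ?v = "comb m J ?x A"
      have "dot m (lincomb J x A) (lincomb J x A) = dot m (\<lambda>r. sqrt X * ?v r) (\<lambda>r. sqrt X * ?v r)"
        using X by (intro dot_cong) (auto simp: lincomb_normalized[OF X_def])
      also have "\<dots> = X * dot m ?v ?v" using X by (simp add: dot_scale_left dot_scale_right)
      finally have "dot m (lincomb J x A) (lincomb J x A) = X * dot m ?v ?v" .
      moreover have "?v \<in> space (gvec m)" by (auto simp: comb_def space_PiM)
      ultimately show ?thesis using A X unfolding large_event_def G_def X_def[symmetric]
        by (simp add: mult.commute[of X])
    qed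
    ultimately show "\<exists>G\<in>sets (gvec m). measure (gvec m) G \<le> ?p \<and>
       (\<forall>A\<in>?F. (\<forall>r<m. \<forall>i<n. i \<notin> J \<longrightarrow> A (r, i) = a (r, i)) \<longrightarrow> comb m J ?x A \<in> G)"
      by blast
  qed (use x X in auto)
qed auto

text \<open>Given the matrix, the correlation of the projected vector with the noise is Gaussian; a
  threshold proportional to its squared norm gives an exponent proportional to that squared
  norm.\<close>

lemma measure_align_event:
  assumes m: "m > 0" and J: "J \<subseteq> {..<n}" and I: "I \<subseteq> {..<n}" and \<eta>: "0 < \<eta>" "\<eta> < 1 / 2"
    and d: "d \<le> (\<Sum>j\<in>J. (x j)\<^sup>2)" "0 < d"
  shows "measure (omp_space m n) (align_event m n x J I \<eta>) \<le> 2 * exp (- (real m * \<eta>\<^sup>2 * (1 - 2 * \<eta>) * d / 2))"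
    (is "_ \<le> ?p")
proof (rule omp_space_bound_noise[OF m])
  show E: "align_event m n x J I \<eta> \<in> sets (omp_space m n)" by (rule event_sets) (use J I in auto)
  fix A assume A: "A \<in> space (gmat m n)"
  let ?b = "proj_perp m A I (lincomb J x A)"
  show "measure (gvec m) {w \<in> space (gvec m). (A, w) \<in> align_event m n x J I \<eta>} \<le> ?p"
  proof (cases "(1 - 2 * \<eta>) * (\<Sum>j\<in>J. (x j)\<^sup>2) < dot m ?b ?b")
    case True
    have "(1 - 2 * \<eta>) * d \<le> (1 - 2 * \<eta>) * (\<Sum>j\<in>J. (x j)\<^sup>2)" using \<eta> d by (intro mult_left_mono) auto
    then have D1: "(1 - 2 * \<eta>) * d \<le> dot m ?b ?b" using True by linarith
    moreover have "0 < (1 - 2 * \<eta>) * d" using \<eta> d by simp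
    ultimately have D: "(1 - 2 * \<eta>) * d \<le> dot m ?b ?b" "0 < dot m ?b ?b" by linarith+
    have "{w \<in> space (gvec m). (A, w) \<in> align_event m n x J I \<eta>}
       = {w \<in> space (gvec m). \<eta> * dot m ?b ?b \<le> \<bar>dot m ?b w\<bar>}"
      using True A by (auto simp: align_event_def omp_space_def space_pair_measure)
    then have "measure (gvec m) {w \<in> space (gvec m). (A, w) \<in> align_event m n x J I \<eta>}
        = measure (gvec m) {w \<in> space (gvec m). \<eta> * dot m ?b ?b \<le> \<bar>dot m ?b w\<bar>}"
      by (rule arg_cong)
    also have "\<dots> \<le> 2 * exp (- (real m * (\<eta> * dot m ?b ?b)\<^sup>2 / (2 * dot m ?b ?b)))"
      using \<eta> D by (intro gvec_linear_tail m) auto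
    also have "\<dots> = 2 * exp (- (real m * \<eta>\<^sup>2 * dot m ?b ?b / 2))"
    proof -
      have "real m * (\<eta> * c)\<^sup>2 / (2 * c) = real m * \<eta>\<^sup>2 * c / 2" if "c > 0" for c :: real
        using that by (simp add: power2_eq_square)
      from this[OF D(2)] show ?thesis by (simp only:)
    qed
    also have "\<dots> \<le> 2 * exp (- (real m * \<eta>\<^sup>2 * ((1 - 2 * \<eta>) * d) / 2))"
    proof -
      have "real m * \<eta>\<^sup>2 * ((1 - 2 * \<eta>) * d) \<le> real m * \<eta>\<^sup>2 * dot m ?b ?b"
        by (rule mult_left_mono[OF D(1)]) simp
      then show ?thesis by simp
    qed
    finally show ?thesis by (simp only: mult.assoc)
  next
    case False
    then have "{w \<in> space (gvec m). (A, w) \<in> align_event m n x J I \<eta>} = {}" by (auto simp: align_event_def)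
    then show ?thesis by (simp only: measure_empty) simp
  qed
qed simp

lemma measure_noise_event:
  assumes m: "m > 0" and T: "T \<subseteq> {..<n}" "card T \<le> k" and \<eta>: "0 < \<eta>" "\<eta> < 1"
  shows "measure (omp_space m n) (noise_event m n T \<eta>) \<le> exp (- ((\<eta> - ln (1 + \<eta>)) / 2 * real m)) +
    (exp (- ((- \<eta> - ln (1 - \<eta>)) / 2 * real m)) + 2 ^ k * exp (- (\<eta> / 4 * real m)))" (is "_ \<le> ?p")
proof (rule omp_space_bound_noise[OF m])
  have fin: "finite T" using T finite_subset by blast
  show E: "noise_event m n T \<eta> \<in> sets (omp_space m n)" by (rule event_sets[where J="{}"]) (use T in auto)
  fix A assume A: "A \<in> space (gmat m n)"
  interpret prob_space "gvec m" by (rule prob_space_PiM_gauss[OF m])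
  have "measure (gvec m) {w \<in> space (gvec m). (A, w) \<in> noise_event m n T \<eta>}
    \<le> measure (gvec m) ({w \<in> space (gvec m). 1 + \<eta> \<le> dot m w w} \<union>
        {w \<in> space (gvec m). dot m (proj_perp m A T w) (proj_perp m A T w) \<le> 1 - 2 * \<eta>})"
    using fin by (intro finite_measure_mono) (auto simp: noise_event_def)
  also have "\<dots> \<le> exp (- ((\<eta> - ln (1 + \<eta>)) / 2 * real m)) +
      (exp (- ((- \<eta> - ln (1 - \<eta>)) / 2 * real m)) + 2 ^ card T * exp (- (\<eta> / 4 * real m)))"
    using fin by (intro order.trans[OF measure_Un_le add_mono[OF gvec_norm_upper_tail[OF m \<eta>(1)] gvec_proj_perp_lower_tail[OF m fin \<eta>]]]) auto
  also have "\<dots> \<le> ?p" using T by (intro add_left_mono mult_right_mono power_increasing) auto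
  finally show "measure (gvec m) {w \<in> space (gvec m). (A, w) \<in> noise_event m n T \<eta>} \<le> ?p" .
qed (intro add_nonneg_nonneg mult_nonneg_nonneg; simp)

section \<open>Recovery outside the error events\<close>

text \<open>Here \<open>D\<close> and \<open>W\<close> are the squared norms of the projected
  unselected signal and of the projected noise, \<open>\<beta>\<close> is their inner product, and
  \<open>X\<close> is the squared norm of the \<open>s\<close> unselected coefficients. The
  hypothesis \<open>main\<close> is Cauchy--Schwarz with all correlations at most
  \<open>\<mu>\<close>.\<close>

lemma progress_numeric:
  fixes D \<beta> X s k \<eta> \<mu> W xm :: real
  assumes \<eta>: "0 < \<eta>" "\<eta> \<le> 1 / 48" and s: "0 < s" "s \<le> k"
    and main: "(D + \<beta>)\<^sup>2 \<le> X * (s * (\<mu> * (D + 2 * \<beta> + W)))"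
    and Z: "0 \<le> D + 2 * \<beta> + W"
    and \<beta>: "\<bar>\<beta>\<bar> \<le> \<eta> * D" and W: "W \<le> 1 + \<eta>"
    and D: "(1 - 2 * \<eta>) * X < D" and X: "s * xm \<le> X" and xm: "3 / \<eta> \<le> k * xm"
    and \<mu>: "\<mu> \<le> (1 - 12 * \<eta>) / k"
  shows False
proof -
  have k: "k > 0" using s by simp
  \<comment> \<open>The unselected fraction of the support.\<close>
  define q where "q = s / k"
  have q: "0 < q" "q \<le> 1" using s k by (auto simp: q_def)
  have xmpos: "0 < xm"
  proof -
    have "0 < 3 / \<eta>" using \<eta> by simp
    then have "0 < k * xm" using xm by linarith
    then show ?thesis using k by (simp add: zero_less_mult_iff)
  qed
  have Xpos: "X > 0" using X s xmpos mult_pos_pos[of s xm] by linarith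
  have Dpos: "D > 0"
  proof -
    have "0 < (1 - 2 * \<eta>) * X" using \<eta> Xpos by simp
    then show ?thesis using D by linarith
  qed
  \<comment> \<open>The noise energy enters weighted by \<open>q\<close>, and the signal energy is
    at least \<open>3 * q / \<eta>\<close>; so the weighted noise is absorbed by
    \<open>\<eta> * D\<close>.\<close>
  have "q * (3 / \<eta>) \<le> q * (k * xm)" using xm q by (intro mult_left_mono) auto
  also have "\<dots> = s * xm" using k by (simp add: q_def)
  finally have qX: "q * (3 / \<eta>) \<le> X" using X by linarith
  then have qX': "3 * q \<le> \<eta> * X" using \<eta> by (simp add: field_simps)
  have XD: "X \<le> 2 * D"
  proof -
    have "(1 / 2) * X \<le> (1 - 2 * \<eta>) * X" using \<eta> Xpos by (intro mult_right_mono) auto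
    then show ?thesis using D by linarith
  qed
  have q1: "q * (1 + \<eta>) \<le> \<eta> * D"
  proof -
    have "\<eta> * X \<le> \<eta> * (2 * D)" using XD \<eta> by (intro mult_left_mono) auto
    then have "3 * q \<le> 2 * (\<eta> * D)" using qX' by linarith
    moreover have "q * (1 + \<eta>) \<le> q * (3 / 2)" using q \<eta> by (intro mult_left_mono) auto
    ultimately show ?thesis by linarith
  qed
  have smu: "s * \<mu> \<le> q * (1 - 12 * \<eta>)"
  proof -
    have "s * \<mu> \<le> s * ((1 - 12 * \<eta>) / k)" using \<mu> s by (intro mult_left_mono) auto
    then show ?thesis by (simp add: q_def)
  qed
  have Zle: "D + 2 * \<beta> + W \<le> (1 + 2 * \<eta>) * D + (1 + \<eta>)"
    using \<beta> W by (simp add: algebra_simps abs_le_iff)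
  have "((1 - \<eta>) * D)\<^sup>2 \<le> (D + \<beta>)\<^sup>2"
    using \<beta> \<eta> Dpos by (intro power_mono) (auto simp: algebra_simps abs_le_iff)
  also have "\<dots> \<le> X * ((s * \<mu>) * (D + 2 * \<beta> + W))" using main by (simp add: mult.assoc)
  also have "\<dots> \<le> X * ((q * (1 - 12 * \<eta>)) * (D + 2 * \<beta> + W))"
    using Xpos Z smu by (intro mult_left_mono mult_right_mono) auto
  also have "\<dots> \<le> X * ((q * (1 - 12 * \<eta>)) * ((1 + 2 * \<eta>) * D + (1 + \<eta>)))"
    using Xpos q \<eta> Zle by (intro mult_left_mono) auto
  also have "\<dots> = X * (1 - 12 * \<eta>) * (q * ((1 + 2 * \<eta>) * D) + q * (1 + \<eta>))"
    by (simp add: algebra_simps)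
  also have "\<dots> \<le> X * (1 - 12 * \<eta>) * (1 * ((1 + 2 * \<eta>) * D) + \<eta> * D)"
    using Xpos \<eta> q q1 Dpos by (intro mult_left_mono add_mono mult_right_mono) auto
  also have "\<dots> = X * (1 - 12 * \<eta>) * ((1 + 3 * \<eta>) * D)" by (simp add: algebra_simps)
  finally have 1: "((1 - \<eta>)\<^sup>2 * D) * D \<le> (X * (1 - 12 * \<eta>) * (1 + 3 * \<eta>)) * D"
    by (simp add: power2_eq_square mult_ac)
  then have 2: "(1 - \<eta>)\<^sup>2 * D \<le> X * (1 - 12 * \<eta>) * (1 + 3 * \<eta>)"
    using Dpos by (rule mult_right_le_imp_le)
  have "(1 - \<eta>)\<^sup>2 * ((1 - 2 * \<eta>) * X) \<le> (1 - \<eta>)\<^sup>2 * D"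
    using D by (intro mult_left_mono) auto
  with 2 have "((1 - \<eta>)\<^sup>2 * (1 - 2 * \<eta>)) * X \<le> ((1 - 12 * \<eta>) * (1 + 3 * \<eta>)) * X"
    by (simp add: mult_ac)
  then have 3: "(1 - \<eta>)\<^sup>2 * (1 - 2 * \<eta>) \<le> (1 - 12 * \<eta>) * (1 + 3 * \<eta>)"
    using Xpos by (rule mult_right_le_imp_le)
  \<comment> \<open>The left side of the inequality just obtained is at least
    \<open>1 - 4 * \<eta>\<close>, the right side at most \<open>1 - 9 * \<eta>\<close>.\<close>
  have "(1 - 2 * \<eta>) * (1 - 2 * \<eta>) \<le> (1 - \<eta>)\<^sup>2 * (1 - 2 * \<eta>)"
    using \<eta> by (intro mult_right_mono) (auto simp: power2_eq_square algebra_simps)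
  moreover have "1 - 4 * \<eta> \<le> (1 - 2 * \<eta>) * (1 - 2 * \<eta>)" by (simp add: algebra_simps)
  moreover have "(1 - 12 * \<eta>) * (1 + 3 * \<eta>) \<le> 1 - 9 * \<eta>" by (simp add: algebra_simps)
  ultimately show False using 3 \<eta> by linarith
qed

lemma xmin_sq_le:
  assumes "j \<in> support n x"
  shows "(xmin n x)\<^sup>2 \<le> (x j)\<^sup>2"
proof -
  have "xmin n x \<le> \<bar>x j\<bar>" unfolding xmin_def using assms by (intro Min_le) auto
  moreover have "0 \<le> xmin n x" unfolding xmin_def using assms by (subst Min_ge_iff) auto
  ultimately have "(xmin n x)\<^sup>2 \<le> \<bar>x j\<bar>\<^sup>2" by (intro power_mono) auto
  then show ?thesis by simp
qed

lemma omp_progress: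
  assumes \<eta>: "0 < \<eta>" "\<eta> \<le> 1 / 48"
    and I: "I \<subset> support n x"
    and \<omega>: "(A, w) \<in> space (omp_space m n)"
    and noise: "(A, w) \<notin> noise_event m n (support n x) \<eta>"
    and shrink: "(A, w) \<notin> shrink_event m n x (support n x - I) I \<eta>"
    and align: "(A, w) \<notin> align_event m n x (support n x - I) I \<eta>"
    and xm: "3 / \<eta> \<le> real (card (support n x)) * (xmin n x)\<^sup>2"
    and \<mu>: "0 < \<mu>" "\<mu> \<le> (1 - 12 * \<eta>) / real (card (support n x))"
  shows "\<exists>j\<in>support n x. \<mu> < omp_rho m A (meas m n A x w) I j"
proof (rule ccontr)
  let ?T = "support n x"
  let ?P = "proj_perp m A I"
  define J where "J = ?T - I"
  define v where "v = lincomb J x A"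
  define b where "b = ?P v"
  define y where "y = meas m n A x w"
  define z where "z = ?P y"
  define X where "X = (\<Sum>j\<in>J. (x j)\<^sup>2)"
  assume "\<not> ?thesis"
  then have rho: "omp_rho m A y I j \<le> \<mu>" if "j \<in> J" for j
    using that by (auto simp: not_less J_def y_def)
  have fin: "finite I" "finite J" using I finite_subset[of I ?T] by (auto simp: J_def)
  \<comment> \<open>The already selected part of the signal lies in the span of \<open>I\<close> and
    is annihilated by the projection.\<close>
  have y_eq: "y = (\<lambda>r. lincomb I x A r + (v r + w r))"
  proof -
    have "lincomb ?T x A = (\<lambda>r. lincomb J x A r + lincomb I x A r)"
      unfolding lincomb_def J_def using I by (intro ext sum.subset_diff) auto
    then show ?thesis by (simp add: y_def meas_eq_lincomb v_def algebra_simps)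
  qed
  have z_eq: "z = (\<lambda>r. b r + ?P w r)"
    unfolding z_def y_eq b_def
    by (simp only: proj_perp_add_span[OF fin(1) lincomb_in_col_span] proj_perp_add[OF fin(1)])
  have bw: "dot m b (?P w) = dot m b w" unfolding b_def by (rule dot_proj_perp[OF fin(1), symmetric])
  have zz: "dot m z z = dot m b b + 2 * dot m b w + dot m (?P w) (?P w)"
    unfolding z_eq dot_self_add bw ..
  have zv: "dot m z v = dot m b b + dot m b w"
  proof -
    have "dot m z v = dot m z b" unfolding z_def b_def by (rule dot_proj_perp[OF fin(1)])
    also have "\<dots> = dot m b b + dot m (?P w) b" unfolding z_eq dot_add_left ..
    finally show ?thesis by (simp add: dot_commute[of m "?P w" b] bw)
  qed
  have zv': "dot m z v = (\<Sum>j\<in>J. x j * dot m (\<lambda>r. A (r, j)) z)"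
  proof -
    have "dot m z v = dot m v z" by (rule dot_commute)
    also have "\<dots> = (\<Sum>j\<in>J. dot m (\<lambda>r. A (r, j) * x j) z)"
      unfolding v_def lincomb_def by (rule dot_sum_left)
    also have "\<dots> = (\<Sum>j\<in>J. x j * dot m (\<lambda>r. A (r, j)) z)"
      by (intro sum.cong refl) (simp add: mult.commute[of _ "x _"] dot_scale_left)
    finally show ?thesis .
  qed
  \<comment> \<open>If \<open>z\<close> vanishes, the quotient \<open>omp_rho\<close> says nothing,
    but the correlation is then 0.\<close>
  have cz: "(dot m (\<lambda>r. A (r, j)) z)\<^sup>2 \<le> \<mu> * dot m z z" if "j \<in> J" for j
  proof (cases "dot m z z = 0")
    case True
    then have "dot m (\<lambda>r. A (r, j)) z = dot m (\<lambda>r. A (r, j)) (\<lambda>_. 0)"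
      by (intro dot_cong) (auto simp: dot_self_eq_0_iff)
    then show ?thesis using True by (simp add: dot_def)
  next
    case False
    then have "0 < dot m z z" using dot_self_nonneg[of m z] by linarith
    then show ?thesis using rho[OF that] unfolding omp_rho_altdef z_def[symmetric] by (simp add: divide_le_eq)
  qed
  \<comment> \<open>Expanding \<open>v\<close> in the columns of \<open>J\<close> expresses
    \<open>dot m z v\<close> through the individual correlations; Cauchy--Schwarz separates them
    from the coefficients.\<close>
  have main: "(dot m b b + dot m b w)\<^sup>2 \<le> X * (real (card J) * (\<mu> * dot m z z))"
  proof -
    have "(dot m z v)\<^sup>2 \<le> X * (\<Sum>j\<in>J. (dot m (\<lambda>r. A (r, j)) z)\<^sup>2)"
      unfolding zv' X_def by (rule Cauchy_Schwarz_ineq_sum)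
    also have "\<dots> \<le> X * (\<Sum>j\<in>J. \<mu> * dot m z z)"
      using cz by (intro mult_left_mono sum_mono) (auto simp: X_def sum_nonneg)
    finally show ?thesis by (simp add: zv)
  qed
  show False
  proof (rule progress_numeric[OF \<eta>])
    show "0 < real (card J)" using I fin by (auto simp: J_def card_gt_0_iff)
    show "real (card J) \<le> real (card ?T)" by (simp add: J_def card_mono)
    show "(dot m b b + dot m b w)\<^sup>2 \<le> X * (real (card J) * (\<mu> * (dot m b b + 2 * dot m b w + dot m (?P w) (?P w))))"
      using main unfolding zz .
    show "0 \<le> dot m b b + 2 * dot m b w + dot m (?P w) (?P w)"
      using dot_self_nonneg[of m z] unfolding zz .
    show D: "(1 - 2 * \<eta>) * X < dot m b b"
      using shrink \<omega> unfolding shrink_event_def J_def[symmetric] X_def[symmetric]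
      by (simp add: v_def[symmetric] b_def[symmetric] not_le)
    show "\<bar>dot m b w\<bar> \<le> \<eta> * dot m b b"
      using align \<omega> D unfolding align_event_def J_def[symmetric] X_def[symmetric]
      by (simp add: v_def[symmetric] b_def[symmetric] not_le less_imp_le)
    have "dot m w w < 1 + \<eta>" using noise \<omega> by (simp add: noise_event_def)
    then show "dot m (?P w) (?P w) \<le> 1 + \<eta>" using dot_proj_perp_le_self[OF fin(1), of m A w] by linarith
    have "(\<Sum>j\<in>J. (xmin n x)\<^sup>2) \<le> X" unfolding X_def by (intro sum_mono xmin_sq_le) (auto simp: J_def)
    then show "real (card J) * (xmin n x)\<^sup>2 \<le> X" by simp
  qed (use xm \<mu> in auto)
qed

section \<open>Exact recovery in the absence of the error events\<close>

lemma sqnorm_eq_support: "sqnorm n x = (\<Sum>j\<in>support n x. (x j)\<^sup>2)"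
  unfolding sqnorm_def by (rule sum.mono_neutral_right) (auto simp: support_def)

lemma genie_res_bounds:
  assumes \<eta>: "0 < \<eta>" "\<eta> \<le> 1 / 48" and \<omega>: "(A, w) \<in> space (omp_space m n)"
    and noise: "(A, w) \<notin> noise_event m n (support n x) \<eta>"
    and large: "(A, w) \<notin> large_event m n x (support n x)"
  shows "1 - 2 * \<eta> \<le> dot m (genie_res m n x A w t) (genie_res m n x A w t)"
    "dot m (genie_res m n x A w t) (genie_res m n x A w t) \<le> 4 * (1 + sqnorm n x)"
proof -
  let ?u = "lincomb (support n x) x A"
  have 1: "dot m w w < 1 + \<eta>" "1 - 2 * \<eta> < dot m (proj_perp m A (support n x) w) (proj_perp m A (support n x) w)"
    using noise \<omega> by (auto simp: noise_event_def)
  have 2: "dot m ?u ?u < 2 * sqnorm n x"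
    using large \<omega> by (auto simp: large_event_def sqnorm_eq_support)
  show "1 - 2 * \<eta> \<le> dot m (genie_res m n x A w t) (genie_res m n x A w t)"
    using 1(2) genie_res_lower[of m A n x w t] by linarith
  have "dot m (meas m n A x w) (meas m n A x w) = dot m ?u ?u + 2 * dot m ?u w + dot m w w"
    unfolding meas_eq_lincomb dot_self_add ..
  \<comment> \<open>Nonnegativity of the squared norm of \<open>?u - w\<close> bounds the cross term
    at the price of doubling both squared norms.\<close>
  moreover have "0 \<le> dot m ?u ?u - 2 * dot m ?u w + dot m w w"
    unfolding dot_self_diff[symmetric] by (rule dot_self_nonneg)
  ultimately have "dot m (meas m n A x w) (meas m n A x w) \<le> 2 * dot m ?u ?u + 2 * dot m w w" by linarith
  then have "dot m (genie_res m n x A w t) (genie_res m n x A w t) \<le> 2 * dot m ?u ?u + 2 * dot m w w"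
    using genie_res_upper[of m n x A w t] by (rule order.trans[rotated])
  also have "\<dots> \<le> 2 * (2 * sqnorm n x) + 2 * (1 + \<eta>)"
    using 1(1) 2 by (intro add_mono mult_left_mono) auto
  also have "\<dots> \<le> 4 * (1 + sqnorm n x)" using \<eta> by (simp add: algebra_simps)
  finally show "dot m (genie_res m n x A w t) (genie_res m n x A w t) \<le> 4 * (1 + sqnorm n x)" .
qed

text \<open>A coupling argument: as long as the actual run stays inside the support it coincides
  with the genie run, so \<open>off_event\<close> controls its off-support correlations and the next
  selected index lies in the support as well.\<close>

lemma omp_output_eq_support:
  assumes n: "n > 0" and \<eta>: "0 < \<eta>" "\<eta> \<le> 1 / 48"
    and \<omega>: "(A, w) \<in> space (omp_space m n)"
    and noise: "(A, w) \<notin> noise_event m n (support n x) \<eta>"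
    and large: "(A, w) \<notin> large_event m n x (support n x)"
    and shrink: "\<And>I. I \<subset> support n x \<Longrightarrow> (A, w) \<notin> shrink_event m n x (support n x - I) I \<eta>"
    and align: "\<And>I. I \<subset> support n x \<Longrightarrow> (A, w) \<notin> align_event m n x (support n x - I) I \<eta>"
    and off: "\<And>j. j < n \<Longrightarrow> j \<notin> support n x \<Longrightarrow>
       (A, w) \<notin> off_event m n x (card (support n x)) (1 - 2 * \<eta>) (4 * (1 + sqnorm n x)) \<nu> j"
    and xm: "3 / \<eta> \<le> real (card (support n x)) * (xmin n x)\<^sup>2"
    and \<mu>: "0 < \<mu>" "\<mu> \<le> (1 - 12 * \<eta>) / real (card (support n x))" "\<nu> \<le> \<mu>"
  shows "omp_output m n A (meas m n A x w) \<mu> = support n x"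
proof -
  let ?T = "support n x"
  let ?k = "card ?T"
  define y where "y = meas m n A x w"
  define B where "B = mask_cols ?T A"
  let ?S = "omp_set m n A y"
  have proj: "proj_perp m B S y = proj_perp m A S y" if "S \<subseteq> ?T" for S
    by (rule proj_perp_cong) (use that in \<open>auto simp: B_def mask_cols_def\<close>)
  have rho_B: "omp_rho m B y S j = (if j \<in> ?T then omp_rho m A y S j else 0)" if "S \<subseteq> ?T" for S j
  proof (cases "j \<in> ?T")
    case True
    have "omp_rho m B y S j = omp_rho m A y S j"
      by (rule omp_rho_cong) (use that True in \<open>auto simp: B_def mask_cols_def\<close>)
    then show ?thesis using True by simp
  next
    case False
    then have "dot m (\<lambda>r. B (r, j)) p = 0" for p by (simp add: B_def mask_cols_def dot_def)
    then show ?thesis using False by (simp add: omp_rho_altdef)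
  qed
  have rho_off: "omp_rho m A y (?S t) j \<le> \<mu>"
    if t: "t \<le> ?k" and S: "?S t = omp_set m n B y t" "?S t \<subseteq> ?T" and j: "j < n" "j \<notin> ?T" for t j
  proof -
    let ?z = "proj_perp m A (?S t) y"
    have g: "genie_res m n x A w t = ?z"
      using proj[OF S(2)] S(1) by (simp add: genie_res_def B_def[symmetric] y_def[symmetric])
    note bd = genie_res_bounds[OF \<eta> \<omega> noise large]
    have "\<not> (\<nu> * dot m ?z ?z < (dot m ?z (\<lambda>r. A (r, j)))\<^sup>2)"
      using off[OF j] \<omega> bd t unfolding g[symmetric] by (auto simp: off_event_def)
    then have "(dot m (\<lambda>r. A (r, j)) ?z)\<^sup>2 \<le> \<nu> * dot m ?z ?z" by (simp add: dot_commute[of m ?z "\<lambda>r. A (r, j)"] not_less)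
    moreover have "0 < dot m ?z ?z" using bd(1)[of t] \<eta> unfolding g by linarith
    ultimately have "omp_rho m A y (?S t) j \<le> \<nu>" by (simp add: omp_rho_altdef divide_le_eq)
    then show ?thesis using \<mu> by simp
  qed
  \<comment> \<open>The residual is orthogonal to selected columns, so no index is selected
    twice.\<close>
  have rho_sel: "omp_rho m A y S j = 0" if "finite S" "j \<in> S" for S j
    using proj_perp_orthogonal[OF that, of m A y] by (simp add: omp_rho_altdef)
  have star: "\<mu> < omp_rho_star m n A y S" if ST: "S \<subset> ?T" for S
  proof -
    obtain j where j: "j \<in> ?T" "\<mu> < omp_rho m A y S j"
      using omp_progress[OF \<eta> ST \<omega> noise shrink[OF ST] align[OF ST] xm \<mu>(1,2)] unfolding y_def by blast
    then have "omp_rho m A y S j \<le> omp_rho_star m n A y S"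
      unfolding omp_rho_star_def using support_subset[of n x] by (intro Max_ge) auto
    then show ?thesis using j by simp
  qed
  \<comment> \<open>Agreement with the genie run, inclusion in the support and the cardinality need
    each other in the induction: a set with fewer than \<open>?k\<close> elements is a proper
    subset, which guarantees progress.\<close>
  have path: "t \<le> ?k \<Longrightarrow> ?S t = omp_set m n B y t \<and> ?S t \<subseteq> ?T \<and> card (?S t) = t" for t
  proof (induction t)
    case (Suc t)
    then have IH: "?S t = omp_set m n B y t" "?S t \<subseteq> ?T" "card (?S t) = t" by auto
    then have sub: "?S t \<subset> ?T" using Suc.prems by auto
    define l where "l = omp_istar m n A y (?S t)"
    have rl: "\<mu> < omp_rho m A y (?S t) l" unfolding l_def omp_rho_istar[OF n] by (rule star[OF sub])
    have l_max: "l < n \<and> (\<forall>i<n. omp_rho m A y (?S t) i \<le> omp_rho m A y (?S t) l)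
        \<and> (\<forall>i<l. omp_rho m A y (?S t) i < omp_rho m A y (?S t) l)"
      using omp_istar_eq_iff[OF n, of m A y "?S t" l] by (simp add: l_def)
    have lT: "l \<in> ?T" using rho_off[of t l] IH Suc.prems rl l_max by (meson Suc_leD not_less)
    have "l \<notin> ?S t" using rho_sel[OF finite_omp_set, of l m n A y t] rl \<mu> by auto
    \<comment> \<open>Masking leaves the correlations in the support unchanged and sets the others
      to 0, below the positive value at \<open>l\<close>; so the same index wins, also under the tie
      rule.\<close>
    moreover have "omp_istar m n B y (?S t) = l"
      unfolding omp_istar_eq_iff[OF n] rho_B[OF IH(2)] using l_max lT rl \<mu>(1) by auto
    moreover have "omp_istar m n A y (omp_set m n B y t) = l" using IH(1) by (simp add: l_def)
    ultimately show ?case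
      using IH lT by (simp add: finite_omp_set)
  qed simp
  have Sk: "?S ?k = ?T"
    using path[of ?k] by (intro card_subset_eq) auto
  \<comment> \<open>At time \<open>?k\<close> selected columns have correlation 0 and the others at
    most \<open>\<mu>\<close>; at every earlier time progress forbids stopping.\<close>
  have "(LEAST t. \<not> (\<mu> < omp_rho_star m n A y (?S t))) = ?k"
  proof (rule Least_equality)
    have "omp_rho m A y (?S ?k) j \<le> \<mu>" if "j < n" for j
      using rho_off[of ?k j] path[of ?k] rho_sel[of ?T j] that \<mu>(1) Sk
      by (cases "j \<in> ?T") auto
    then have "omp_rho_star m n A y (?S ?k) \<le> \<mu>"
      unfolding omp_rho_star_def using n by (subst Max_le_iff) auto
    then show "\<not> (\<mu> < omp_rho_star m n A y (?S ?k))" by simp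
    fix t assume t: "\<not> (\<mu> < omp_rho_star m n A y (?S t))"
    show "?k \<le> t"
    proof (rule ccontr)
      assume "\<not> ?k \<le> t"
      then have "?S t \<subset> ?T" using path[of t] by auto
      then show False using star t by blast
    qed
  qed
  then show ?thesis unfolding omp_output_def y_def[symmetric] by (simp add: Sk)
qed

section \<open>The error probability\<close>

text \<open>No measurability of \<open>A\<close> is required, since the measure of a non-measurable set is \<open>0\<close>. This spares a
  proof that the error set of the algorithm is measurable.\<close>

lemma measure_le_of_cover:
  assumes "prob_space M" "B \<in> sets M" "A \<subseteq> B"
  shows "measure M A \<le> measure M B"
proof (cases "A \<in> sets M")
  case True
  interpret prob_space M by fact
  show ?thesis using assms by (intro finite_measure_mono) auto
next
  case False
  then show ?thesis by (simp add: measure_notin_sets)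
qed

text \<open>Expansion of the product of \<open>1 + q\<close> over \<open>T\<close>; the subtracted 1
  is the term of the full set.\<close>

lemma sum_proper_subsets_power:
  fixes q :: real
  assumes "finite T"
  shows "(\<Sum>I | I \<subset> T. q ^ card (T - I)) = (1 + q) ^ card T - 1"
proof -
  have "(1 + q) ^ card T = (\<Prod>i\<in>T. 1 + q)" by simp
  also have "\<dots> = (\<Sum>I\<in>Pow T. q ^ card (T - I))"
    using prod_add[OF assms, of "\<lambda>_. 1" "\<lambda>_. q"] by simp
  also have "Pow T = insert T {I. I \<subset> T}" by auto
  also have "(\<Sum>I\<in>insert T {I. I \<subset> T}. q ^ card (T - I)) = 1 + (\<Sum>I | I \<subset> T. q ^ card (T - I))"
    using assms by (subst sum.insert) (auto intro: finite_subset[of _ "Pow T"])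
  finally show ?thesis by simp
qed

lemma prob_space_omp_space: "m > 0 \<Longrightarrow> prob_space (omp_space m n)"
  unfolding omp_space_def by (intro prob_space_pair prob_space_PiM_gauss)

text \<open>The alignment bound weakens as fewer indices remain unselected, so its terms are summed
  by size through the binomial expansion; the shrink bound is uniform in \<open>I\<close> and is
  multiplied by \<open>2 ^ k\<close>.\<close>

lemma omp_error_union_bound:
  fixes x :: "nat \<Rightarrow> real" and m n :: nat
  defines "T \<equiv> support n x" and "k \<equiv> card (support n x)"
  assumes m: "m > 0" and n: "n > 0" and k: "k > 0" and \<eta>: "0 < \<eta>" "\<eta> \<le> 1 / 48"
    and \<alpha>: "0 < \<alpha>" and L: "0 \<le> L"
    and xm: "3 / \<eta> \<le> real k * (xmin n x)\<^sup>2"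
    and \<mu>: "0 < \<mu>" "\<mu> \<le> (1 - 12 * \<eta>) / real k" "(1 + 2 * \<alpha>)\<^sup>2 * (2 * L / real m) \<le> \<mu>"
  defines "P \<equiv> exp (- ((- \<eta> - ln (1 - \<eta>)) / 2 * real m)) + 2 ^ k * exp (- (\<eta> / 4 * real m))"
    and "q \<equiv> exp (- (real m * \<eta>\<^sup>2 * (1 - 2 * \<eta>) * (xmin n x)\<^sup>2 / 2))"
    and "R \<equiv> (ln (4 * (1 + sqnorm n x) / (1 - 2 * \<eta>)) / ln (1 + \<alpha>\<^sup>2 / 3) + 1) * (2 * exp (- ((1 + \<alpha>)\<^sup>2 * L)))
       + (real k + 1) * (2 * exp (- (3 * L)))"
  shows "\<P>(\<omega> in omp_space m n. omp_output m n (fst \<omega>) (meas m n (fst \<omega>) x (snd \<omega>)) \<mu> \<noteq> support n x)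
    \<le> (exp (- ((\<eta> - ln (1 + \<eta>)) / 2 * real m)) + P) + exp (- ((1 - ln 2) / 2 * real m)) + 2 ^ k * P
      + 2 * ((1 + q) ^ k - 1) + real (n - k) * R"
proof -
  let ?M = "omp_space m n"
  let ?hi = "4 * (1 + sqnorm n x)" and ?\<nu> = "(1 + 2 * \<alpha>)\<^sup>2 * (2 * L / real m)"
  interpret prob_space ?M by (rule prob_space_omp_space[OF m])
  define \<I> where "\<I> = {I. I \<subset> T}"
  define O' where "O' = {..<n} - T"
  have fT: "finite T" and Tn: "T \<subseteq> {..<n}" using support_subset by (auto simp: T_def)
  have T0: "T \<noteq> {}" using k by (auto simp: T_def k_def)
  have xT: "x j \<noteq> 0" if "j \<in> T" for j using that by (auto simp: T_def support_def)
  have f\<I>: "finite \<I>" unfolding \<I>_def using fT by (auto intro: finite_subset[of _ "Pow T"])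
  have c\<I>: "card \<I> \<le> 2 ^ k"
    using card_mono[of "Pow T" \<I>] fT by (auto simp: card_Pow \<I>_def T_def k_def)
  have I: "I \<subseteq> {..<n}" "T - I \<subseteq> {..<n}" "T - I \<noteq> {}" "I \<inter> (T - I) = {}" "card I \<le> k" if "I \<in> \<I>" for I
    using that Tn card_mono[OF fT, of I] by (auto simp: \<I>_def T_def k_def)
  let ?N = "noise_event m n T \<eta>" and ?Lg = "large_event m n x T"
  let ?S = "\<lambda>I. shrink_event m n x (T - I) I \<eta>" and ?A = "\<lambda>I. align_event m n x (T - I) I \<eta>"
  let ?O = "\<lambda>j. off_event m n x k (1 - 2 * \<eta>) ?hi ?\<nu> j"
  let ?B = "?N \<union> ?Lg \<union> (\<Union>I\<in>\<I>. ?S I) \<union> (\<Union>I\<in>\<I>. ?A I) \<union> (\<Union>j\<in>O'. ?O j)"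
  have sN: "?N \<in> events" and sL: "?Lg \<in> events"
    using event_sets[of T n T m] Tn by auto
  have sS: "?S I \<in> events" and sA: "?A I \<in> events" if "I \<in> \<I>" for I
    using event_sets[of "T - I" n I m] I[OF that] by auto
  have sO: "?O j \<in> events" if "j \<in> O'" for j
    using that by (intro off_event_sets[OF n]) (auto simp: O'_def)
  have U1: "(\<Union>I\<in>\<I>. ?S I) \<in> events" and U2: "(\<Union>I\<in>\<I>. ?A I) \<in> events" and U3: "(\<Union>j\<in>O'. ?O j) \<in> events"
    using f\<I> sS sA sO by (auto intro!: sets.finite_UN simp: O'_def)
  have "{\<omega> \<in> space ?M. omp_output m n (fst \<omega>) (meas m n (fst \<omega>) x (snd \<omega>)) \<mu> \<noteq> support n x} \<subseteq> ?B"
  proof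
    fix \<omega> assume \<omega>: "\<omega> \<in> {\<omega> \<in> space ?M. omp_output m n (fst \<omega>) (meas m n (fst \<omega>) x (snd \<omega>)) \<mu> \<noteq> support n x}"
    obtain A w where Aw: "\<omega> = (A, w)" by (cases \<omega>)
    show "\<omega> \<in> ?B"
    proof (rule ccontr)
      assume nB: "\<omega> \<notin> ?B"
      have "omp_output m n A (meas m n A x w) \<mu> = support n x"
      proof (rule omp_output_eq_support[OF n \<eta> _ _ _ _ _ _ _ \<mu>(1) _ \<mu>(3)])
        show "(A, w) \<notin> off_event m n x (card (support n x)) (1 - 2 * \<eta>) ?hi ?\<nu> j"
          if "j < n" "j \<notin> support n x" for j
          using nB that unfolding Aw O'_def T_def k_def by blast
      qed (use nB \<omega> xm \<mu> in \<open>auto simp: Aw \<I>_def T_def k_def\<close>)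
      then show False using \<omega> by (simp add: Aw)
    qed
  qed
  then have "\<P>(\<omega> in ?M. omp_output m n (fst \<omega>) (meas m n (fst \<omega>) x (snd \<omega>)) \<mu> \<noteq> support n x) \<le> prob ?B"
    using sN sL U1 U2 U3 by (intro measure_le_of_cover prob_space_omp_space m sets.Un)
  also have "\<dots> \<le> prob ?N + prob ?Lg + prob (\<Union>I\<in>\<I>. ?S I) + prob (\<Union>I\<in>\<I>. ?A I) + prob (\<Union>j\<in>O'. ?O j)"
    using sN sL U1 U2 U3
    by (intro order.trans[OF measure_Un_le] add_mono order.refl sets.Un)
  also have "\<dots> \<le> prob ?N + prob ?Lg + (\<Sum>I\<in>\<I>. prob (?S I)) + (\<Sum>I\<in>\<I>. prob (?A I)) + (\<Sum>j\<in>O'. prob (?O j))"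
    using f\<I> sS sA sO by (intro add_mono order.refl finite_measure_subadditive_finite) (auto simp: O'_def)
  also have "\<dots> \<le> (exp (- ((\<eta> - ln (1 + \<eta>)) / 2 * real m)) + P) + exp (- ((1 - ln 2) / 2 * real m)) + 2 ^ k * P
      + 2 * ((1 + q) ^ k - 1) + real (n - k) * R"
  proof (intro add_mono)
    show "prob ?N \<le> exp (- ((\<eta> - ln (1 + \<eta>)) / 2 * real m)) + P"
      unfolding P_def using \<eta> Tn by (intro measure_noise_event m) (auto simp: T_def k_def)
    show "prob ?Lg \<le> exp (- ((1 - ln 2) / 2 * real m))"
      using Tn T0 xT by (intro measure_large_event m) auto
    have P0: "0 \<le> P" unfolding P_def by (intro add_nonneg_nonneg mult_nonneg_nonneg; simp)
    have "(\<Sum>I\<in>\<I>. prob (?S I)) \<le> (\<Sum>I\<in>\<I>. P)"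
      unfolding P_def using \<eta> I xT by (intro sum_mono measure_shrink_event m) auto
    also have "\<dots> = real (card \<I>) * P" by simp
    also have "\<dots> \<le> 2 ^ k * P"
    proof (rule mult_right_mono[OF _ P0])
      show "real (card \<I>) \<le> 2 ^ k" using c\<I> by (metis of_nat_le_iff of_nat_numeral of_nat_power)
    qed
    finally show "(\<Sum>I\<in>\<I>. prob (?S I)) \<le> 2 ^ k * P" .
    have "prob (?A I) \<le> 2 * q ^ card (T - I)" if "I \<in> \<I>" for I
    proof -
      let ?J = "T - I"
      have cJ: "0 < card ?J" using I[OF that] fT by (auto simp: card_gt_0_iff)
      have xmpos: "0 < (xmin n x)\<^sup>2"
      proof -
        have "0 < 3 / \<eta>" using \<eta> by simp
        then have "0 < real k * (xmin n x)\<^sup>2" using xm by linarith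
        then show ?thesis using k by (simp add: zero_less_mult_iff)
      qed
      have "(\<Sum>j\<in>?J. (xmin n x)\<^sup>2) \<le> (\<Sum>j\<in>?J. (x j)\<^sup>2)"
        by (intro sum_mono xmin_sq_le) (auto simp: T_def)
      then have "prob (?A I) \<le> 2 * exp (- (real m * \<eta>\<^sup>2 * (1 - 2 * \<eta>) * (real (card ?J) * (xmin n x)\<^sup>2) / 2))"
        using \<eta> I[OF that] cJ xmpos by (intro measure_align_event m) auto
      also have "exp (- (real m * \<eta>\<^sup>2 * (1 - 2 * \<eta>) * (real (card ?J) * (xmin n x)\<^sup>2) / 2)) = q ^ card ?J"
        unfolding q_def exp_of_nat_mult[symmetric] by (simp add: mult_ac)
      finally show ?thesis .
    qed
    then have "(\<Sum>I\<in>\<I>. prob (?A I)) \<le> (\<Sum>I\<in>\<I>. 2 * q ^ card (T - I))" by (rule sum_mono)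
    also have "\<dots> = 2 * ((1 + q) ^ k - 1)"
      unfolding sum_distrib_left[symmetric] \<I>_def sum_proper_subsets_power[OF fT] by (simp add: T_def k_def)
    finally show "(\<Sum>I\<in>\<I>. prob (?A I)) \<le> 2 * ((1 + q) ^ k - 1)" .
    have sq: "0 \<le> sqnorm n x" by (simp add: sqnorm_def sum_nonneg)
    have "(\<Sum>j\<in>O'. prob (?O j)) \<le> (\<Sum>j\<in>O'. R)"
      unfolding R_def using \<eta> sq \<alpha> L by (intro sum_mono measure_off_event m n) (auto simp: O'_def T_def)
    also have "\<dots> = real (n - k) * R"
      using Tn fT by (simp add: O'_def card_Diff_subset) (simp add: T_def k_def)
    finally show "(\<Sum>j\<in>O'. prob (?O j)) \<le> real (n - k) * R" .
  qed
  finally show ?thesis .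
qed

text \<open>The number \<open>L\<close> is the logarithmic cost of a union: \<open>n - k\<close> and
  \<open>k + 1\<close> are both at most \<open>exp L\<close>. Each term of the union bound is
  reduced to one that depends on \<open>k\<close>, \<open>L\<close> and the logarithm of the signal
  energy.\<close>

lemma omp_error_bound:
  fixes x :: "nat \<Rightarrow> real" and m n :: nat
  defines "k \<equiv> card (support n x)"
  assumes m: "m > 0" and k: "k > 0" and \<eta>: "0 < \<eta>" "\<eta> \<le> 1 / 48" and \<alpha>: "0 < \<alpha>"
    and L: "0 \<le> L" and expL: "real (n - k) \<le> exp L" "real k + 1 \<le> exp L" and mL: "2 * real k * L \<le> real m"
    and c: "c \<le> (\<eta> - ln (1 + \<eta>)) / 2" "c \<le> (- \<eta> - ln (1 - \<eta>)) / 2" "c \<le> \<eta> / 4" "c \<le> (1 - ln 2) / 2"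
    and cm: "3 * real k \<le> c * real m"
    and xm: "3 / \<eta> \<le> real k * (xmin n x)\<^sup>2" "2 \<le> \<eta>\<^sup>2 * (1 - 2 * \<eta>) * (real k * (xmin n x)\<^sup>2)"
    and \<mu>: "0 < \<mu>" "\<mu> \<le> (1 - 12 * \<eta>) / real k" "(1 + 2 * \<alpha>)\<^sup>2 * (2 * L / real m) \<le> \<mu>"
  shows "\<P>(\<omega> in omp_space m n. omp_output m n (fst \<omega>) (meas m n (fst \<omega>) x (snd \<omega>)) \<mu> \<noteq> support n x)
    \<le> 6 * exp (- real k) + 2 * (exp (exp (- L)) - 1)
      + 2 * (ln (8 * (1 + sqnorm n x)) / ln (1 + \<alpha>\<^sup>2 / 3) + 1) * exp (- (2 * \<alpha> * L)) + 2 * exp (- L)"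
proof -
  define P where "P = exp (- ((- \<eta> - ln (1 - \<eta>)) / 2 * real m)) + 2 ^ k * exp (- (\<eta> / 4 * real m))"
  define q where "q = exp (- (real m * \<eta>\<^sup>2 * (1 - 2 * \<eta>) * (xmin n x)\<^sup>2 / 2))"
  define G where "G = ln (4 * (1 + sqnorm n x) / (1 - 2 * \<eta>)) / ln (1 + \<alpha>\<^sup>2 / 3) + 1"
  define G' where "G' = ln (8 * (1 + sqnorm n x)) / ln (1 + \<alpha>\<^sup>2 / 3) + 1"
  define R where "R = G * (2 * exp (- ((1 + \<alpha>)\<^sup>2 * L))) + (real k + 1) * (2 * exp (- (3 * L)))"
  have n: "n > 0" using k by (cases n) (auto simp: k_def support_def)
  \<comment> \<open>The factor 3 leaves \<open>exp (- real k)\<close> after paying twice for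
    \<open>2 ^ k\<close>: once inside \<open>P\<close> and once for the choice of
    \<open>I\<close>.\<close>
  have small: "exp (- (b * real m)) \<le> exp (- 3 * real k)" if "c \<le> b" for b
  proof -
    have "c * real m \<le> b * real m" using that by (intro mult_right_mono) auto
    then show ?thesis using cm by simp
  qed
  have two: "(2::real) ^ k \<le> exp (real k)"
  proof -
    have "(2::real) ^ k \<le> exp 1 ^ k" using exp_ge_add_one_self[of 1] by (intro power_mono) auto
    then show ?thesis by (simp add: exp_of_nat_mult[symmetric])
  qed
  have P: "P \<le> exp (- 3 * real k) + exp (real k) * exp (- 3 * real k)"
    unfolding P_def using c two by (intro add_mono mult_mono small) auto
  have P1: "P \<le> exp (- real k) + exp (- real k)"
  proof (rule order.trans[OF P], rule add_mono)
    show "exp (real k) * exp (- 3 * real k) \<le> exp (- real k)" unfolding exp_add[symmetric] by simp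
  qed simp
  have P0: "0 \<le> P" unfolding P_def by (intro add_nonneg_nonneg mult_nonneg_nonneg; simp)
  have P2: "2 ^ k * P \<le> exp (- real k) + exp (- real k)"
  proof -
    have "2 ^ k * P \<le> exp (real k) * (exp (- 3 * real k) + exp (real k) * exp (- 3 * real k))"
      using two P P0 by (intro mult_mono) auto
    also have "\<dots> \<le> exp (- real k) + exp (- real k)"
      unfolding distrib_left
    proof (rule add_mono)
      show "exp (real k) * exp (- 3 * real k) \<le> exp (- real k)" unfolding exp_add[symmetric] by simp
      show "exp (real k) * (exp (real k) * exp (- 3 * real k)) \<le> exp (- real k)" unfolding exp_add[symmetric] by simp
    qed
    finally show ?thesis .
  qed
  have small1: "exp (- (b * real m)) \<le> exp (- real k)" if "c \<le> b" for b
    by (rule order.trans[OF small[OF that]]) simp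
  have q: "(1 + q) ^ k - 1 \<le> exp (exp (- L)) - 1"
  proof -
    have q0: "0 \<le> q" by (simp add: q_def)
    \<comment> \<open>The bound on \<open>k * xmin\<^sup>2\<close> and
      \<open>2 * k * L \<le> m\<close> give \<open>q \<le> exp (- (2 * L))\<close>; multiplying by
      \<open>k \<le> exp L\<close> leaves \<open>exp (- L)\<close>.\<close>
    have "2 * (2 * L) \<le> \<eta>\<^sup>2 * (1 - 2 * \<eta>) * (real k * (xmin n x)\<^sup>2) * (2 * L)"
      using xm(2) L by (intro mult_right_mono) auto
    also have "\<dots> = (\<eta>\<^sup>2 * (1 - 2 * \<eta>) * (xmin n x)\<^sup>2) * (2 * real k * L)" by (simp add: mult_ac)
    also have "\<dots> \<le> (\<eta>\<^sup>2 * (1 - 2 * \<eta>) * (xmin n x)\<^sup>2) * real m"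
      using \<eta> mL by (intro mult_left_mono) auto
    finally have "q \<le> exp (- (2 * L))" unfolding q_def by (simp add: mult_ac)
    then have "real k * q \<le> exp L * exp (- (2 * L))" using expL q0 by (intro mult_mono) auto
    then have kq: "real k * q \<le> exp (- L)" by (simp add: exp_add[symmetric])
    have "(1 + q) ^ k \<le> exp q ^ k" using q0 by (intro power_mono) auto
    also have "\<dots> = exp (real k * q)" by (simp add: exp_of_nat_mult)
    also have "\<dots> \<le> exp (exp (- L))" using kq by simp
    finally show ?thesis by simp
  qed
  have sq: "0 \<le> sqnorm n x" by (simp add: sqnorm_def sum_nonneg)
  have la: "0 < ln (1 + \<alpha>\<^sup>2 / 3)" using \<alpha> by (intro ln_gt_zero) simp
  have G0: "0 \<le> G"
    unfolding G_def using \<eta> sq la by (intro add_nonneg_nonneg divide_nonneg_nonneg ln_ge_zero) (auto simp: le_divide_eq)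
  have GG: "G \<le> G'"
  proof -
    have "4 * (1 + sqnorm n x) / (1 - 2 * \<eta>) \<le> 4 * (1 + sqnorm n x) / (1 / 2)"
      using \<eta> sq by (intro divide_left_mono) auto
    then have "ln (4 * (1 + sqnorm n x) / (1 - 2 * \<eta>)) \<le> ln (8 * (1 + sqnorm n x))"
      using \<eta> sq by (subst ln_le_cancel_iff) auto
    then show ?thesis unfolding G_def G'_def using la by (intro add_right_mono divide_right_mono) auto
  qed
  have R: "real (n - k) * R \<le> 2 * G' * exp (- (2 * \<alpha> * L)) + 2 * exp (- L)"
  proof -
    \<comment> \<open>The factor \<open>exp (- L)\<close> pays for the union over columns; the
      surplus \<open>2 * \<alpha> * L\<close> is left to beat the number of norm classes.\<close>
    have "exp (- ((1 + \<alpha>)\<^sup>2 * L)) \<le> exp (- L) * exp (- (2 * \<alpha> * L))"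
    proof -
      have "L + 2 * \<alpha> * L \<le> (1 + \<alpha>)\<^sup>2 * L" using L by (simp add: power2_eq_square algebra_simps)
      then show ?thesis by (simp add: exp_add[symmetric])
    qed
    then have 1: "G * (2 * exp (- ((1 + \<alpha>)\<^sup>2 * L))) \<le> G' * (2 * (exp (- L) * exp (- (2 * \<alpha> * L))))"
      using GG G0 by (intro mult_mono) auto
    have 2: "(real k + 1) * (2 * exp (- (3 * L))) \<le> exp L * (2 * exp (- (3 * L)))"
      using expL by (intro mult_right_mono) auto
    have "R \<le> exp (- L) * (2 * G' * exp (- (2 * \<alpha> * L)) + 2 * exp (- L))"
    proof -
      have "exp L * (2 * exp (- (3 * L))) = exp (- L) * (2 * exp (- L))" by (simp add: exp_add[symmetric])
      then show ?thesis using 1 2 unfolding R_def by (simp add: algebra_simps)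
    qed
    moreover have "0 \<le> R" unfolding R_def using G0 by simp
    ultimately have "real (n - k) * R \<le> exp L * (exp (- L) * (2 * G' * exp (- (2 * \<alpha> * L)) + 2 * exp (- L)))"
      using expL by (intro mult_mono) auto
    then show ?thesis by (simp add: mult.assoc[symmetric] exp_add[symmetric])
  qed
  have "\<P>(\<omega> in omp_space m n. omp_output m n (fst \<omega>) (meas m n (fst \<omega>) x (snd \<omega>)) \<mu> \<noteq> support n x)
    \<le> (exp (- ((\<eta> - ln (1 + \<eta>)) / 2 * real m)) + P) + exp (- ((1 - ln 2) / 2 * real m)) + 2 ^ k * P
      + 2 * ((1 + q) ^ k - 1) + real (n - k) * R"
    unfolding P_def q_def R_def G_def k_def
    by (rule omp_error_union_bound) (use m n k \<eta> \<alpha> L xm \<mu> in \<open>auto simp: k_def\<close>)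
  also have "\<dots> \<le> (exp (- real k) + (exp (- real k) + exp (- real k))) + exp (- real k) + (exp (- real k) + exp (- real k))
      + 2 * (exp (exp (- L)) - 1) + (2 * G' * exp (- (2 * \<alpha> * L)) + 2 * exp (- L))"
    using c P1 P2 q R by (intro add_mono mult_left_mono small1) auto
  finally show ?thesis unfolding G'_def by simp
qed

section \<open>Choice of the constants and passage to the limit\<close>

lemma ln_less_minus_one: "0 < z \<Longrightarrow> z \<noteq> 1 \<Longrightarrow> ln z < z - (1::real)"
  using ln_le_minus_one[of z] ln_eq_minus_one[of z] by fastforce

text \<open>The oversampling factor \<open>1 + d\<close> leaves a gap between the off-support level,
  about \<open>2 * L / m\<close>, and the progress level, about \<open>1 / k\<close>. The factor
  \<open>1 + d / 2\<close> places the threshold inside the gap.\<close>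

lemma omp_error_tendsto_0:
  fixes \<delta> :: real and kmin kmax m :: "nat \<Rightarrow> nat" and x :: "nat \<Rightarrow> nat \<Rightarrow> real"
  assumes kb: "\<And>n. n \<ge> 1 \<Longrightarrow> kmin n \<le> card (support n (x n)) \<and> card (support n (x n)) \<le> kmax n"
    and kmin: "filterlim kmin at_top sequentially" and kmax: "\<And>n. n \<ge> 1 \<Longrightarrow> 2 * kmax n < n" and \<delta>: "\<delta> > 0"
    and mb: "\<And>n. n \<ge> 1 \<Longrightarrow> real (m n) \<ge> (1 + \<delta>) * 2 * real (kmax n) * ln (real (n - kmin n))"
    and xm: "filterlim (\<lambda>n. real (card (support n (x n))) * (xmin n (x n))\<^sup>2) at_top sequentially"
    and xd: "\<And>\<epsilon>. \<epsilon> > 0 \<Longrightarrow>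
       (\<lambda>n. real (n - card (support n (x n))) powr (-\<epsilon>) * ln (1 + sqnorm n (x n))) \<longlonglongrightarrow> 0"
    and \<mu>: "\<And>n. 0 < ln (real (n - kmin n)) \<Longrightarrow> 0 < m n \<Longrightarrow>
       \<mu> n = (1 + min \<delta> 1 / 2) * (2 * ln (real (n - kmin n)) / real (m n))"
  shows "(\<lambda>n. \<P>(\<omega> in omp_space (m n) n.
      omp_output (m n) n (fst \<omega>) (meas (m n) n (fst \<omega>) (x n) (snd \<omega>)) (\<mu> n) \<noteq> support n (x n))) \<longlonglongrightarrow> 0"
proof -
  \<comment> \<open>Capping at 1 preserves the sampling hypothesis and allows
    \<open>d * d \<le> d\<close>.\<close>
  define d where "d = min \<delta> 1"
  \<comment> \<open>Solves \<open>1 - 12 * \<eta> = (1 + d / 2) / (1 + d)\<close>, so that the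
    threshold just meets the progress condition.\<close>
  define \<eta> where "\<eta> = d / (24 * (1 + d))"
  \<comment> \<open>Small enough that \<open>(1 + 2 * \<alpha>)\<^sup>2\<close> stays below the
    threshold factor \<open>1 + d / 2\<close>.\<close>
  define \<alpha> where "\<alpha> = d / 16"
  define k where "k = (\<lambda>n. card (support n (x n)))"
  define L where "L = (\<lambda>n. ln (real (n - kmin n)))"
  define l0 where "l0 = ln (1 + \<alpha>\<^sup>2 / 3)"
  define c where "c = Min {(\<eta> - ln (1 + \<eta>)) / 2, (- \<eta> - ln (1 - \<eta>)) / 2, \<eta> / 4, (1 - ln 2) / 2}"
  define p where "p = (\<lambda>n. \<P>(\<omega> in omp_space (m n) n.
      omp_output (m n) n (fst \<omega>) (meas (m n) n (fst \<omega>) (x n) (snd \<omega>)) (\<mu> n) \<noteq> support n (x n)))"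
  \<comment> \<open>The error bound rewritten with powers of \<open>n - k\<close>, so that the
    hypothesis on \<open>sqnorm\<close> applies with exponent \<open>2 * \<alpha>\<close>.\<close>
  define V where "V = (\<lambda>n. 6 * exp (- real (k n)) + 2 * (exp (exp (- L n)) - 1)
     + 2 / l0 * (real (n - k n) powr (- (2 * \<alpha>)) * ln (1 + sqnorm n (x n)))
     + 2 * (ln 8 / l0 + 1) * real (n - k n) powr (- (2 * \<alpha>)) + 2 * exp (- L n))"
  have d: "0 < d" "d \<le> 1" "d \<le> \<delta>" using \<delta> by (auto simp: d_def)
  have \<eta>: "0 < \<eta>" "\<eta> \<le> 1 / 48" using d by (auto simp: \<eta>_def field_simps)
  have \<eta>12: "1 - 12 * \<eta> = (1 + d / 2) / (1 + d)" using d by (simp add: \<eta>_def field_simps)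
  have \<alpha>: "0 < \<alpha>" using d by (simp add: \<alpha>_def)
  have \<alpha>d: "(1 + 2 * \<alpha>)\<^sup>2 \<le> 1 + d / 2"
  proof -
    have "(1 + 2 * \<alpha>)\<^sup>2 = 1 + d / 4 + d * d / 64" by (simp add: \<alpha>_def power2_eq_square algebra_simps)
    moreover have "d * d \<le> d" using d by (simp add: mult_le_one)
    ultimately show ?thesis using d by linarith
  qed
  have l0: "0 < l0" unfolding l0_def using \<alpha> by (intro ln_gt_zero) simp
  \<comment> \<open>Positivity of the rates is the strict inequality between \<open>ln z\<close> and
    \<open>z - 1\<close> away from 1.\<close>
  have c0: "0 < c"
    unfolding c_def using \<eta> ln_less_minus_one[of "1 + \<eta>"] ln_less_minus_one[of "1 - \<eta>"] ln_less_minus_one[of 2]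
    by (auto simp: Min_gr_iff)
  have cle: "c \<le> (\<eta> - ln (1 + \<eta>)) / 2" "c \<le> (- \<eta> - ln (1 - \<eta>)) / 2" "c \<le> \<eta> / 4" "c \<le> (1 - ln 2) / 2"
    unfolding c_def by (intro Min_le; simp)+
  have kn: "kmin n \<le> k n" "2 * k n < n" "k n \<le> kmax n" if "n \<ge> 1" for n
    using kb[OF that] kmax[OF that] by (auto simp: k_def)
  have k_top: "filterlim (\<lambda>n. real (k n)) at_top sequentially"
  proof -
    have "filterlim k at_top sequentially"
      by (rule filterlim_at_top_mono[OF kmin]) (use kn in \<open>auto intro: eventually_sequentiallyI[of 1]\<close>)
    then show ?thesis by (rule filterlim_compose[OF filterlim_real_sequentially])
  qed
  have half_top: "filterlim (\<lambda>n. real n / 2) at_top sequentially"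
    using filterlim_tendsto_pos_mult_at_top[OF tendsto_const _ filterlim_real_sequentially, of "1 / 2"] by simp
  have N_top: "filterlim (\<lambda>n. real (n - k n)) at_top sequentially"
  proof (rule filterlim_at_top_mono[OF half_top], rule eventually_sequentiallyI[of 1])
    show "real n / 2 \<le> real (n - k n)" if "1 \<le> n" for n
      using kn(2)[OF that] by (simp add: of_nat_diff)
  qed
  have N'_top: "filterlim (\<lambda>n. real (n - kmin n)) at_top sequentially"
    by (rule filterlim_at_top_mono[OF N_top]) (use kn(1) in \<open>auto intro!: eventually_sequentiallyI[of 1] diff_le_mono2\<close>)
  have L_top: "filterlim L at_top sequentially"
    unfolding L_def by (rule filterlim_compose[OF ln_at_top N'_top])
  have bound: "eventually (\<lambda>n. p n \<le> V n) sequentially"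
  proof -
    \<comment> \<open>With \<open>2 * k * L \<le> m\<close> this yields
      \<open>3 * k \<le> c * m\<close>.\<close>
    have "eventually (\<lambda>n. 3 / (2 * c) \<le> L n) sequentially"
      using L_top unfolding filterlim_at_top by blast
    moreover have "eventually (\<lambda>n. 1 \<le> L n) sequentially" using L_top unfolding filterlim_at_top by blast
    moreover have "eventually (\<lambda>n. 1 \<le> real (k n)) sequentially" using k_top unfolding filterlim_at_top by blast
    moreover have "eventually (\<lambda>n. 3 / \<eta> \<le> real (k n) * (xmin n (x n))\<^sup>2) sequentially"
      using xm unfolding filterlim_at_top k_def by blast
    moreover have "eventually (\<lambda>n. 2 / (\<eta>\<^sup>2 * (1 - 2 * \<eta>)) \<le> real (k n) * (xmin n (x n))\<^sup>2) sequentially"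
      using xm unfolding filterlim_at_top k_def by blast
    ultimately show ?thesis using eventually_ge_at_top[of 1]
    proof eventually_elim
      case (elim n)
      have L0: "0 < L n" using elim by simp
      have k0: "0 < k n" using elim by simp
      have N'0: "0 < real (n - kmin n)" using kn(1,2)[OF elim(6)] by simp
      have expL: "exp (L n) = real (n - kmin n)" using N'0 by (simp add: L_def)
      have mk: "(1 + d) * (2 * real (k n) * L n) \<le> real (m n)"
      proof -
        have "(1 + d) * (2 * real (k n) * L n) \<le> (1 + \<delta>) * (2 * real (kmax n) * L n)"
          using d L0 kn(3)[OF elim(6)] by (intro mult_mono) auto
        also have "\<dots> = (1 + \<delta>) * 2 * real (kmax n) * L n" by (simp only: mult.assoc)
        also have "\<dots> \<le> real (m n)" unfolding L_def by (rule mb[OF elim(6)])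
        finally show ?thesis .
      qed
      have kL: "0 < 2 * real (k n) * L n" using k0 L0 by simp
      have mk': "2 * real (k n) * L n \<le> real (m n)"
      proof -
        have "1 * (2 * real (k n) * L n) \<le> (1 + d) * (2 * real (k n) * L n)"
          using d kL by (intro mult_right_mono) auto
        then show ?thesis using mk by linarith
      qed
      then have "0 < real (m n)" using kL by linarith
      then have m0: "0 < m n" by simp
      have \<mu>n: "\<mu> n = (1 + d / 2) * (2 * L n / real (m n))"
        using \<mu>[of n] L0 m0 by (simp add: L_def d_def)
      have \<mu>0: "0 < \<mu> n" unfolding \<mu>n using d L0 m0 by simp
      \<comment> \<open>The sampling bound gives \<open>2 * L / m \<le> 1 / ((1 + d) * k)\<close>;
        the threshold factor then produces exactly \<open>1 - 12 * \<eta>\<close>.\<close>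
      have \<mu>k: "\<mu> n \<le> (1 - 12 * \<eta>) / real (k n)"
      proof -
        have "0 < real (k n) + d * real (k n)" using k0 d by (simp add: add_pos_pos)
        then have "2 * L n / real (m n) \<le> 1 / ((1 + d) * real (k n))"
          using mk m0 by (simp add: field_simps)
        then have "\<mu> n \<le> (1 + d / 2) * (1 / ((1 + d) * real (k n)))"
          unfolding \<mu>n using d by (intro mult_left_mono) auto
        then show ?thesis unfolding \<eta>12 by simp
      qed
      have \<mu>\<nu>: "(1 + 2 * \<alpha>)\<^sup>2 * (2 * L n / real (m n)) \<le> \<mu> n"
        unfolding \<mu>n using \<alpha>d L0 by (intro mult_right_mono) auto
      have cm: "3 * real (k n) \<le> c * real (m n)"
      proof -
        have "3 * real (k n) \<le> c * (2 * real (k n) * L n)"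
          using elim(1) c0 k0 by (simp add: field_simps)
        also have "\<dots> \<le> c * real (m n)" using mk' c0 by (intro mult_left_mono) auto
        finally show ?thesis .
      qed
      have xm2: "2 \<le> \<eta>\<^sup>2 * (1 - 2 * \<eta>) * (real (k n) * (xmin n (x n))\<^sup>2)"
      proof -
        have "0 < \<eta>\<^sup>2 * (1 - 2 * \<eta>)" using \<eta> by simp
        then show ?thesis using elim(5) by (simp only: pos_divide_le_eq mult.commute)
      qed
      have sq: "0 \<le> sqnorm n (x n)" by (simp add: sqnorm_def sum_nonneg)
      have "p n \<le> 6 * exp (- real (k n)) + 2 * (exp (exp (- L n)) - 1)
          + 2 * (ln (8 * (1 + sqnorm n (x n))) / l0 + 1) * exp (- (2 * \<alpha> * L n)) + 2 * exp (- L n)"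
        unfolding p_def l0_def k_def
      proof (rule omp_error_bound[OF m0 _ \<eta> \<alpha> less_imp_le[OF L0] _ _ _ cle])
        show "real (n - card (support n (x n))) \<le> exp (L n)"
          unfolding expL using kn(1)[OF elim(6)] by (simp add: k_def diff_le_mono2)
        show "real (card (support n (x n))) + 1 \<le> exp (L n)"
          unfolding expL using kn(1,2)[OF elim(6)] by (simp add: k_def of_nat_diff)
      qed (use k0 mk' cm elim xm2 \<mu>0 \<mu>k \<mu>\<nu> in \<open>auto simp: k_def\<close>)
      also have "2 * (ln (8 * (1 + sqnorm n (x n))) / l0 + 1) * exp (- (2 * \<alpha> * L n))
          \<le> 2 * (ln (8 * (1 + sqnorm n (x n))) / l0 + 1) * real (n - k n) powr (- (2 * \<alpha>))"
      proof (rule mult_left_mono)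
        have N0: "0 < real (n - k n)" using kn(2)[OF elim(6)] by simp
        \<comment> \<open>Since \<open>n - kmin\<close> is at least \<open>n - k\<close>, its
          negative power is the smaller one.\<close>
        have "exp (- (2 * \<alpha> * L n)) = real (n - kmin n) powr (- (2 * \<alpha>))"
          using N'0 by (simp add: powr_def L_def)
        also have "\<dots> \<le> real (n - k n) powr (- (2 * \<alpha>))"
          using N0 \<alpha> kn(1)[OF elim(6)] by (intro powr_mono2') (auto intro: diff_le_mono2)
        finally show "exp (- (2 * \<alpha> * L n)) \<le> real (n - k n) powr (- (2 * \<alpha>))" .
        show "0 \<le> 2 * (ln (8 * (1 + sqnorm n (x n))) / l0 + 1)"
          using sq l0 by (intro mult_nonneg_nonneg add_nonneg_nonneg divide_nonneg_nonneg ln_ge_zero) auto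
      qed
      also have "2 * (ln (8 * (1 + sqnorm n (x n))) / l0 + 1) * real (n - k n) powr (- (2 * \<alpha>))
         = 2 / l0 * (real (n - k n) powr (- (2 * \<alpha>)) * ln (1 + sqnorm n (x n)))
           + 2 * (ln 8 / l0 + 1) * real (n - k n) powr (- (2 * \<alpha>))"
      proof -
        have "ln (8 * (1 + sqnorm n (x n))) = ln 8 + ln (1 + sqnorm n (x n))" using sq by (intro ln_mult_pos) auto
        then show ?thesis by (simp only: add_divide_distrib) (simp add: algebra_simps)
      qed
      finally show ?case by (simp add: V_def)
    qed
  qed
  have exp_L: "(\<lambda>n. exp (- L n)) \<longlonglongrightarrow> 0"
    by (rule filterlim_compose[OF exp_at_bot]) (use L_top in \<open>simp add: filterlim_uminus_at_bot\<close>)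
  have exp_k: "(\<lambda>n. exp (- real (k n))) \<longlonglongrightarrow> 0"
    by (rule filterlim_compose[OF exp_at_bot]) (use k_top in \<open>simp add: filterlim_uminus_at_bot\<close>)
  have powN: "(\<lambda>n. real (n - k n) powr (- (2 * \<alpha>))) \<longlonglongrightarrow> 0"
    by (rule tendsto_neg_powr[OF _ N_top]) (use \<alpha> in simp)
  have sqN: "(\<lambda>n. real (n - k n) powr (- (2 * \<alpha>)) * ln (1 + sqnorm n (x n))) \<longlonglongrightarrow> 0"
    using xd[of "2 * \<alpha>"] \<alpha> by (simp add: k_def)
  have "V \<longlonglongrightarrow> 6 * 0 + 2 * (exp 0 - 1) + 2 / l0 * 0 + 2 * (ln 8 / l0 + 1) * 0 + 2 * 0"
    unfolding V_def by (intro tendsto_intros exp_L exp_k powN sqN)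
  then have V: "V \<longlonglongrightarrow> 0" by simp
  have "p \<longlonglongrightarrow> 0"
    by (rule tendsto_sandwich[OF _ bound tendsto_const V]) (simp add: p_def)
  then show ?thesis by (simp add: p_def)
qed

theorem theorem1:
  shows "\<exists>F :: nat \<Rightarrow> nat \<Rightarrow> nat \<Rightarrow> nat \<Rightarrow> real \<Rightarrow> real.
    (\<forall>a b c d e. F a b c d e > 0) \<and>
    (\<forall>(\<delta>::real) (kmin::nat \<Rightarrow> nat) (kmax::nat \<Rightarrow> nat) (m::nat \<Rightarrow> nat) (x::nat \<Rightarrow> nat \<Rightarrow> real).
       (\<forall>n\<ge>1. kmin n \<le> card (support n (x n)) \<and> card (support n (x n)) \<le> kmax n) \<and>
       filterlim kmin at_top sequentially \<and>
       (\<forall>n\<ge>1. 2 * kmax n < n) \<and>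
       \<delta> > 0 \<and>
       (\<forall>n\<ge>1. real (m n) \<ge> (1 + \<delta>) * 2 * real (kmax n) * ln (real (n - kmin n))) \<and>
       filterlim (\<lambda>n. real (card (support n (x n))) * (xmin n (x n))\<^sup>2) at_top sequentially \<and>
       (\<forall>\<epsilon>>0. (\<lambda>n. real (n - card (support n (x n))) powr (-\<epsilon>) * ln (1 + sqnorm n (x n)))
                 \<longlonglongrightarrow> 0)
     \<longrightarrow>
       (\<lambda>n. \<P>(\<omega> in omp_space (m n) n.
              omp_output (m n) n (fst \<omega>) (meas (m n) n (fst \<omega>) (x n) (snd \<omega>))
                 (F (kmin n) (kmax n) n (m n) \<delta>) \<noteq> support n (x n)))
       \<longlonglongrightarrow> 0)"
proof -
  \<comment> \<open>The default value 1 keeps \<open>F\<close> positive on all arguments. Under the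
    hypotheses, \<open>\<delta>\<close> is positive and the logarithm and \<open>m n\<close> are
    eventually positive, so the formula eventually applies.\<close>
  define F :: "nat \<Rightarrow> nat \<Rightarrow> nat \<Rightarrow> nat \<Rightarrow> real \<Rightarrow> real" where
    "F = (\<lambda>a b c d e. if 0 < ln (real (c - a)) \<and> 0 < d \<and> 0 < e
       then (1 + min e 1 / 2) * (2 * ln (real (c - a)) / real d) else 1)"
  have pos: "F a b c d e > 0" for a b c d e
    by (auto simp: F_def intro!: mult_pos_pos divide_pos_pos add_pos_pos)
  have F: "F a b c d e = (1 + min e 1 / 2) * (2 * ln (real (c - a)) / real d)"
    if "0 < e" "0 < ln (real (c - a))" "0 < d" for a b c d e
    using that by (simp add: F_def)
  show ?thesis
  proof (intro exI[of _ F] conjI allI impI pos, elim conjE, goal_cases)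
    case (1 \<delta> kmin kmax m x)
    show ?case
      by (rule omp_error_tendsto_0[of kmin x kmax \<delta> m]) (use 1 F in blast)+
  qed
qed

end
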